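(* Let $d\ge1$ divide $q+1$, let $1\le k\le d$, and let $X=\mathrm{Sp}\,K\langle x,\frac{1}{x^{q-1}-1}\rangle$. Put $\Delta=x^q-\pi_F^{q-1}x$ and \[R=\Delta\,\partial+\frac{k}{d}\,(qx^{q-1}-\pi_F^{q-1})\in\mathcal{D}(X),\qquad \beta=\sum_{n=0}^\infty\frac{\pi_F^n}{n!}\partial^n\in\mathcal{D}^\dagger_\varpi(X).\] Then $\beta\notin\mathcal{D}^\dagger_{\varpi/|\pi_F|}(X)+\mathcal{D}^\dagger_\varpi(X)\,R$.
   Context: $F$ is a finite extension of $\mathbb{Q}_p$ with uniformiser $\pi_F$ and residue field of size $q$; $K$ is a complete discretely valued field extension of $F$ with $|p|=1/p$; $\varpi=p^{-1/(p-1)}$. $\mathbb{A}$ is the rigid $K$-analytic affine line with coordinate $x$, $\partial_x=d/dx$. For an affinoid subdomain $X$ and $c$ greater than the spectral radius $\lim_n\|\partial_x^n\|^{1/n}$ of $\partial_x$ on $\mathcal{O}(X)$ (here equal to $\varpi$), $\mathcal{D}_c(X)$ is the $K$-Banach algebra of series $\sum_{j\ge0}a_j\partial^j$ ($a_j\in\mathcal{O}(X)$, $|a_j|_Xc^j\to0$) with product $(\sum u_i\partial^i)(\sum v_j\partial^j)=\sum_k(\sum_iu_i\sum_{m\ge0}\binom{i}{m}\partial_x^m(v_{k-i+m}))\partial^k$; for $t\ge\varpi$, $\mathcal{D}^\dagger_t(X)=\mathrm{colim}_{c>t}\mathcal{D}_c(X)$ (an increasing union), so $\mathcal{D}^\dagger_{\varpi/|\pi_F|}(X)\subseteq\mathcal{D}^\dagger_\varpi(X)$.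 $R$ is the operator $\Delta(\partial_x-\frac1d\,\partial_x(w)/w)$ for $w=\Delta^{-k}$. *)

theory Defs
  imports
    "HOL-Analysis.Abstract_Metric_Spaces"
    "HOL-Algebra.Embedded_Algebras"
    "HOL-Algebra.QuotRing"
    "HOL-Algebra.Algebraic_Closure_Type"
begin

section \<open>The fields\<close>

text \<open>The field \<open>K\<close> is a whole type \<open>'k\<close> together with its absolute value; subfields of \<open>K\<close> are
  subsets of the type.\<close>

definition nonarch_abs :: "('k::field \<Rightarrow> real) \<Rightarrow> bool" where
  "nonarch_abs av \<longleftrightarrow>
     (\<forall>x. 0 \<le> av x) \<and> (\<forall>x. av x = 0 \<longleftrightarrow> x = 0) \<and>
     (\<forall>x y. av (x * y) = av x * av y) \<and>
     (\<forall>x y. av (x + y) \<le> max (av x) (av y))"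

definition complete_discretely_valued :: "('k::field \<Rightarrow> real) \<Rightarrow> bool" where
  "complete_discretely_valued av \<longleftrightarrow>
     nonarch_abs av \<and>
     (\<exists>r. 0 < r \<and> r < 1 \<and> av ` (UNIV - {0}) = range (\<lambda>n::int. r powi n)) \<and>
     Metric_space.mcomplete UNIV (\<lambda>x y. av (x - y))"

text \<open>If \<open>K\<close> is complete and \<open>av p = 1/p\<close>, then \<open>av\<close> restricts to the usual \<open>p\<close>-adic absolute value
  on the rationals, so their closure in \<open>K\<close> is a copy of the field of \<open>p\<close>-adic numbers, and the
  only one on which \<open>av\<close> is the \<open>p\<close>-adic absolute value.\<close>

definition padic_numbers :: "('k::field_char_0 \<Rightarrow> real) \<Rightarrow> 'k set" where
  "padic_numbers av = {x. \<exists>s :: nat \<Rightarrow> rat. (\<lambda>n. av (x - of_rat (s n))) \<longlonglongrightarrow> 0}"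

definition finite_ext_of_padic :: "('k::field_char_0 \<Rightarrow> real) \<Rightarrow> 'k set \<Rightarrow> bool" where
  "finite_ext_of_padic av F \<longleftrightarrow>
     subfield F (ring_of_type_algebra :: 'k ring) \<and>
     padic_numbers av \<subseteq> F \<and>
     ring.finite_dimension (ring_of_type_algebra :: 'k ring) (padic_numbers av) F"

definition valuation_ring :: "('k::field \<Rightarrow> real) \<Rightarrow> 'k set \<Rightarrow> 'k ring" where
  "valuation_ring av F = (ring_of_type_algebra :: 'k ring)\<lparr>carrier := {x \<in> F. av x \<le> 1}\<rparr>"

definition valuation_ideal :: "('k::field \<Rightarrow> real) \<Rightarrow> 'k set \<Rightarrow> 'k set" where
  "valuation_ideal av F = {x \<in> F. av x < 1}"

definition is_uniformiser :: "('k::field \<Rightarrow> real) \<Rightarrow> 'k set \<Rightarrow> 'k \<Rightarrow> bool" where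
  "is_uniformiser av F \<pi> \<longleftrightarrow>
     \<pi> \<in> valuation_ideal av F \<and>
     valuation_ideal av F = PIdl\<^bsub>valuation_ring av F\<^esub> \<pi>"

definition residue_field :: "('k::field \<Rightarrow> real) \<Rightarrow> 'k set \<Rightarrow> 'k set ring" where
  "residue_field av F = valuation_ring av F Quot valuation_ideal av F"


section \<open>The affinoid algebra\<close>

text \<open>A power series in \<open>x, y\<close> is an element of \<open>K[[x]][[y]]\<close>: the coefficient of \<open>x\<^sup>i y\<^sup>j\<close> in \<open>f\<close> is
  \<open>fps_nth (fps_nth f j) i\<close>.\<close>

type_synonym 'k fps2 = "'k fps fps"

definition const2 :: "'k::field \<Rightarrow> 'k fps2" where
  "const2 a = fps_const (fps_const a)"

definition varx :: "'k::field fps2" where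
  "varx = fps_const fps_X"

definition vary :: "'k::field fps2" where
  "vary = fps_X"

definition tate_algebra :: "('k::field \<Rightarrow> real) \<Rightarrow> 'k fps2 ring" where
  "tate_algebra av = (ring_of_type_algebra :: 'k fps2 ring)
     \<lparr>carrier := {f. ((\<lambda>(i, j). av (fps_nth (fps_nth f j) i)) \<longlongrightarrow> 0) cofinite}\<rparr>"

definition gauss_norm :: "('k::field \<Rightarrow> real) \<Rightarrow> 'k fps2 \<Rightarrow> real" where
  "gauss_norm av f = (SUP (i, j). av (fps_nth (fps_nth f j) i))"

text \<open>\<open>K\<langle>x, 1/(x\<^sup>q\<^sup>-\<^sup>1 - 1)\<rangle>\<close> is the quotient of \<open>K\<langle>x, y\<rangle>\<close> by the ideal generated by
  \<open>(x\<^sup>q\<^sup>-\<^sup>1 - 1) y - 1\<close>.\<close>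

definition X_ideal :: "('k::field \<Rightarrow> real) \<Rightarrow> nat \<Rightarrow> 'k fps2 set" where
  "X_ideal av q = PIdl\<^bsub>tate_algebra av\<^esub> ((varx ^ (q - 1) - 1) * vary - 1)"

definition O_X :: "('k::field \<Rightarrow> real) \<Rightarrow> nat \<Rightarrow> 'k fps2 set ring" where
  "O_X av q = tate_algebra av Quot X_ideal av q"

definition X_class :: "('k::field \<Rightarrow> real) \<Rightarrow> nat \<Rightarrow> 'k fps2 \<Rightarrow> 'k fps2 set" where
  "X_class av q f = X_ideal av q +>\<^bsub>tate_algebra av\<^esub> f"

text \<open>The residue norm of the above presentation.  If \<open>k\<close> is the residue field of \<open>K\<close>, the
  presentation reduces to the reduced ring \<open>k[x, 1/(x\<^sup>q\<^sup>-\<^sup>1 - 1)]\<close>; hence the residue norm is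
  power-multiplicative and coincides with the supremum norm on \<open>X\<close>.\<close>

definition X_norm :: "('k::field \<Rightarrow> real) \<Rightarrow> 'k fps2 set \<Rightarrow> real" where
  "X_norm av a = (INF f\<in>a. gauss_norm av f)"

text \<open>The derivation \<open>d/dx\<close> of \<open>K\<langle>x, y\<rangle>\<close> for \<open>y = 1/(x\<^sup>q\<^sup>-\<^sup>1 - 1)\<close>, by the chain rule with
  \<open>dy/dx = -(q-1) x\<^sup>q\<^sup>-\<^sup>2 y\<^sup>2\<close>.  It maps the generator \<open>g\<close> of the ideal to \<open>-(q-1) x\<^sup>q\<^sup>-\<^sup>2 y g\<close>, so it induces
  a derivation of the quotient; all cosets in the union below are equal.\<close>

definition ddx2 :: "nat \<Rightarrow> 'k::field fps2 \<Rightarrow> 'k fps2" where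
  "ddx2 q f = Abs_fps (\<lambda>j. fps_deriv (fps_nth f j))
     - of_nat (q - 1) * varx ^ (q - 2) * vary ^ 2 * fps_deriv f"

definition X_deriv :: "('k::field \<Rightarrow> real) \<Rightarrow> nat \<Rightarrow> 'k fps2 set \<Rightarrow> 'k fps2 set" where
  "X_deriv av q a = (\<Union>f\<in>a. X_class av q (ddx2 q f))"

definition X_suminf :: "('k::field \<Rightarrow> real) \<Rightarrow> nat \<Rightarrow> (nat \<Rightarrow> 'k fps2 set) \<Rightarrow> 'k fps2 set" where
  "X_suminf av q a = (THE s. s \<in> carrier (O_X av q) \<and>
     (\<lambda>n. X_norm av ((\<Oplus>\<^bsub>O_X av q\<^esub>i\<in>{..<n}. a i) \<ominus>\<^bsub>O_X av q\<^esub> s)) \<longlonglongrightarrow> 0)"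


section \<open>Completed differential operators\<close>

text \<open>The series \<open>\<Sum>\<^sub>j a\<^sub>j \<partial>\<^sup>j\<close> is represented by its coefficient sequence \<open>a\<close>.\<close>

type_synonym 'k diffop = "nat \<Rightarrow> 'k fps2 set"

definition D_c :: "('k::field \<Rightarrow> real) \<Rightarrow> nat \<Rightarrow> real \<Rightarrow> 'k diffop set" where
  "D_c av q c = {a. (\<forall>j. a j \<in> carrier (O_X av q)) \<and> (\<lambda>j. X_norm av (a j) * c ^ j) \<longlonglongrightarrow> 0}"

definition D_dagger :: "('k::field \<Rightarrow> real) \<Rightarrow> nat \<Rightarrow> real \<Rightarrow> 'k diffop set" where
  "D_dagger av q t = (\<Union>c\<in>{t<..}. D_c av q c)"

definition D_add :: "('k::field \<Rightarrow> real) \<Rightarrow> nat \<Rightarrow> 'k diffop \<Rightarrow> 'k diffop \<Rightarrow> 'k diffop" where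
  "D_add av q u v = (\<lambda>j. u j \<oplus>\<^bsub>O_X av q\<^esub> v j)"

text \<open>Since the binomial coefficient vanishes for \<open>m > i\<close> and \<open>v\<close> has no coefficients of negative
  index, the sum over \<open>m\<close> of the coefficient formula runs over \<open>i - k \<le> m \<le> i\<close> only.\<close>

definition D_mult :: "('k::field \<Rightarrow> real) \<Rightarrow> nat \<Rightarrow> 'k diffop \<Rightarrow> 'k diffop \<Rightarrow> 'k diffop" where
  "D_mult av q u v = (\<lambda>k. X_suminf av q (\<lambda>i. u i \<otimes>\<^bsub>O_X av q\<^esub>
     (\<Oplus>\<^bsub>O_X av q\<^esub>m\<in>{m. m \<le> i \<and> i \<le> k + m}.
        [(i choose m)] \<cdot>\<^bsub>O_X av q\<^esub> (X_deriv av q ^^ m) (v (k + m - i)))))"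

definition varpi :: "nat \<Rightarrow> real" where
  "varpi p = real p powr (- 1 / (real p - 1))"

definition Delta :: "nat \<Rightarrow> 'k::field \<Rightarrow> 'k fps2" where
  "Delta q \<pi> = varx ^ q - const2 (\<pi> ^ (q - 1)) * varx"

definition R_op :: "('k::field \<Rightarrow> real) \<Rightarrow> nat \<Rightarrow> 'k \<Rightarrow> nat \<Rightarrow> nat \<Rightarrow> 'k diffop" where
  "R_op av q \<pi> d k = (\<lambda>j. X_class av q
     (if j = 0 then const2 (of_nat k / of_nat d)
                      * (of_nat q * varx ^ (q - 1) - const2 (\<pi> ^ (q - 1)))
      else if j = 1 then Delta q \<pi>
      else 0))"

definition beta_op :: "('k::field_char_0 \<Rightarrow> real) \<Rightarrow> nat \<Rightarrow> 'k \<Rightarrow> 'k diffop" where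
  "beta_op av q \<pi> = (\<lambda>n. X_class av q (const2 (\<pi> ^ n / fact n)))"

end

theory Submission
  imports Defs "HOL-Number_Theory.Residues" "HOL-Algebra.Sylow"
begin

text \<open>The operator \<open>\<beta>\<close> is translation by \<open>\<pi>\<close>.  Suppose \<open>\<beta> = P + Q R\<close> and put \<open>x = \<pi> y\<close>,
  \<open>\<Delta> = y\<^sup>q - y\<close>, \<open>\<lambda> = 1 - k/d\<close>.  Taking adjoints, every polynomial \<open>g\<close> satisfies
  \<open>g(y - 1) - P\<^sup>* g = - (\<Delta> G' + \<lambda> \<Delta>' G)\<close> with \<open>G = Q\<^sup>* g\<close> (up to a nonzero constant).  Here \<open>P\<^sup>*\<close> acts
  boundedly on every disc of radius \<open>r\<close>, for some \<open>r < 1\<close>, whereas \<open>Q\<^sup>*\<close> is bounded only for the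
  Gauss norm of the larger radius \<open>w = 1 / |\<pi>|\<close>.

  Let \<open>T\<close> be the set of the \<open>p\<close> roots of \<open>y\<^sup>p = y\<close>, which are zeros of \<open>\<Delta>\<close>, let \<open>\<Psi>\<close> be the product of
  the \<open>y - a\<close> with \<open>a \<in> T\<close>, and take \<open>g = \<Psi>(y + 1)\<^sup>N (1 - y)\<^sup>L\<close> with \<open>N\<close> a \<open>p\<close>-adic approximation of
  \<open>- \<lambda>\<close>.  Translation moves the part of \<open>g\<close> concentrated near \<open>0\<close> to \<open>1\<close>, but \<open>P\<^sup>*\<close> cannot, as it
  respects the small discs around the points of \<open>T\<close>.  So at \<open>y = 1\<close> the Taylor coefficient of index \<open>N\<close>
  of the left-hand side is essentially a unit, and solving the differential equation there divides it
  by \<open>N + \<lambda>\<close>, which is \<open>p\<close>-adically small: \<open>G\<close> is large.  On the other hand the equation bounds the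
  Taylor coefficients of \<open>G\<close> of index less than \<open>N\<close> at all points of \<open>T\<close>, and by interpolation these
  bounds and the bound at radius \<open>w\<close> give a bound for \<open>G\<close> on the unit disc independent of \<open>N\<close>.\<close>

section \<open>Gauss norms of polynomials and interpolation\<close>

text \<open>The two radii differ because d/dx is \<open>1 / \<pi>\<close> times d/dy. In terms of
  divided derivatives in \<open>y\<close> the coefficients of P acquire the factor
  \<open>fact n / \<pi> ^ n\<close>, roughly of size \<open>(varpi / av \<pi>) ^ n\<close>.
  Convergence beyond that radius leaves a decay \<open>r ^ n\<close>, which cancels the norm
  \<open>1 / r ^ n\<close> of the n-th divided derivative on discs of radius \<open>r\<close>. For Q
  only \<open>fact n\<close> is compensated and powers of \<open>w\<close> remain; radius
  \<open>w\<close> is the unit disc in \<open>x\<close>, where \<open>1 / (x ^ (q - 1) - 1)\<close>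
  is an integral power series. The obstacle is that the bound at radius \<open>w\<close> grows like
  \<open>w ^ D\<close> with the degree of \<open>g\<close>. This dictates the shape of
  \<open>g\<close>: the degree is \<open>p * N + L\<close>, and interpolation to order
  \<open>N\<close> at the p points of \<open>T\<close> removes exactly \<open>w ^ (p * N)\<close>,
  leaving \<open>w ^ L\<close> with \<open>L\<close> independent of \<open>N\<close>. The points of
  \<open>T\<close> are Teichmueller representatives because translation by 1 permutes these modulo
  p, so that \<open>\<Psi>(y + 1)\<close> has a zero near every one of them; the factor
  \<open>(1 - y) ^ L\<close> makes \<open>g\<close> smaller still near 1, where the part from P must
  stay below a unit.\<close>

locale nonarch_field =
  fixes av :: "'k::field_char_0 \<Rightarrow> real"
  assumes nonarch: "nonarch_abs av"
begin

section \<open>Ultrametric inequalities\<close>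

lemma av_nonneg [simp]: "0 \<le> av x"
  using nonarch by (simp add: nonarch_abs_def)

lemma av_eq_0_iff [simp]: "av x = 0 \<longleftrightarrow> x = 0"
  using nonarch by (simp add: nonarch_abs_def)

lemma av_0 [simp]: "av 0 = 0"
  by simp

lemma av_mult: "av (x * y) = av x * av y"
  using nonarch by (simp add: nonarch_abs_def)

lemma av_add: "av (x + y) \<le> max (av x) (av y)"
  using nonarch by (simp add: nonarch_abs_def)

lemma av_1 [simp]: "av 1 = 1"
  using av_mult[of 1 1] av_eq_0_iff[of 1] by (simp del: av_eq_0_iff)

lemma av_power: "av (x ^ n) = av x ^ n"
  by (induction n) (simp_all add: av_mult)

lemma av_uminus [simp]: "av (- x) = av x"
proof -
  have "av (- 1) * av (- 1) = 1"
    using av_mult[of "-1" "-1"] by simp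
  moreover have "0 \<le> av (- 1)" by simp
  ultimately have "av (- 1) = 1"
    by (smt (verit) mult_less_cancel_left1 mult_less_cancel_right1)
  then show ?thesis
    using av_mult[of "-1" x] by simp
qed

lemma av_diff: "av (x - y) \<le> max (av x) (av y)"
  using av_add[of x "- y"] by simp

lemma av_inverse: "av (inverse x) = inverse (av x)"
proof (cases "x = 0")
  case False
  then have "av x * av (inverse x) = 1"
    by (metis av_1 av_mult right_inverse)
  then show ?thesis
    by (metis inverse_unique)
qed simp

lemma av_divide: "av (x / y) = av x / av y"
  by (simp add: divide_inverse av_mult av_inverse)

lemma av_add_le: "av x \<le> C \<Longrightarrow> av y \<le> C \<Longrightarrow> av (x + y) \<le> C"
  using av_add[of x y] by linarith

lemma av_diff_le: "av x \<le> C \<Longrightarrow> av y \<le> C \<Longrightarrow> av (x - y) \<le> C"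
  using av_diff[of x y] by linarith

lemma av_add_less: "av x < C \<Longrightarrow> av y < C \<Longrightarrow> av (x + y) < C"
  using av_add[of x y] by linarith

lemma av_diff_less: "av x < C \<Longrightarrow> av y < C \<Longrightarrow> av (x - y) < C"
  using av_diff[of x y] by linarith

lemma av_sum_le: "(\<And>i. i \<in> A \<Longrightarrow> av (f i) \<le> C) \<Longrightarrow> 0 \<le> C \<Longrightarrow> av (sum f A) \<le> C"
  by (induction A rule: infinite_finite_induct) (auto intro: av_add_le)

lemma av_of_nat_le_1: "av (of_nat n) \<le> 1"
  by (induction n) (auto intro: av_add_le)

lemma av_minus_one_power [simp]: "av ((- 1) ^ n) = 1"
  by (simp add: av_power)

lemma av_add_eq: "av y < av x \<Longrightarrow> av (x + y) = av x"
  using av_add[of x y] av_add[of "x + y" "- y"] by (auto simp: max_def split: if_splits)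

text \<open>Bounds the Gauss norm at radius \<open>\<rho>\<close> without forming a supremum. It
  takes coefficient sequences so that it serves polynomials and power series alike.\<close>

definition gbound :: "real \<Rightarrow> real \<Rightarrow> (nat \<Rightarrow> 'k) \<Rightarrow> bool" where
  "gbound \<rho> C c \<longleftrightarrow> (\<forall>j. av (c j) * \<rho> ^ j \<le> C)"

abbreviation pbound :: "real \<Rightarrow> real \<Rightarrow> 'k poly \<Rightarrow> bool" where
  "pbound \<rho> C f \<equiv> gbound \<rho> C (poly.coeff f)"

lemma gboundI: "(\<And>j. av (c j) * \<rho> ^ j \<le> C) \<Longrightarrow> gbound \<rho> C c"
  by (simp add: gbound_def)

lemma gboundD: "gbound \<rho> C c \<Longrightarrow> av (c j) * \<rho> ^ j \<le> C"
  by (simp add: gbound_def)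

lemma gbound1_iff: "gbound 1 C c \<longleftrightarrow> (\<forall>j. av (c j) \<le> C)"
  by (simp add: gbound_def)

lemma gbound_mono: "gbound \<rho> C c \<Longrightarrow> C \<le> D \<Longrightarrow> gbound \<rho> D c"
  by (auto simp: gbound_def intro: order_trans)

lemma gbound_nonneg: "gbound \<rho> C c \<Longrightarrow> 0 \<le> C"
  using gboundD[of \<rho> C c 0] av_nonneg[of "c 0"] by (simp del: av_nonneg)

lemma gbound_radius_mono:
  assumes "gbound \<rho> C c" "0 \<le> \<sigma>" "\<sigma> \<le> \<rho>"
  shows "gbound \<sigma> C c"
proof (rule gboundI)
  fix j
  have "av (c j) * \<sigma> ^ j \<le> av (c j) * \<rho> ^ j"
    using assms by (intro mult_left_mono power_mono) auto
  then show "av (c j) * \<sigma> ^ j \<le> C"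
    using gboundD[OF assms(1), of j] by linarith
qed

lemma pbound_add:
  assumes "pbound \<rho> C f" "pbound \<rho> C g" "0 \<le> \<rho>"
  shows "pbound \<rho> C (f + g)"
proof (rule gboundI)
  fix j
  have "av (poly.coeff (f + g) j) * \<rho> ^ j
      \<le> max (av (poly.coeff f j)) (av (poly.coeff g j)) * \<rho> ^ j"
    using assms(3) av_add by (intro mult_right_mono) auto
  also have "\<dots> \<le> C"
    using gboundD[OF assms(1), of j] gboundD[OF assms(2), of j] by (simp add: max_def)
  finally show "av (poly.coeff (f + g) j) * \<rho> ^ j \<le> C" .
qed

lemma pbound_uminus: "pbound \<rho> C (- f) \<longleftrightarrow> pbound \<rho> C f"
  by (simp add: gbound_def)

lemma pbound_diff:
  "pbound \<rho> C f \<Longrightarrow> pbound \<rho> C g \<Longrightarrow> 0 \<le> \<rho> \<Longrightarrow> pbound \<rho> C (f - g)"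
  using pbound_add[of \<rho> C f "- g"] by (simp add: gbound_def)

lemma pbound_sum:
  "(\<And>i. i \<in> A \<Longrightarrow> pbound \<rho> C (f i)) \<Longrightarrow> 0 \<le> C \<Longrightarrow> 0 \<le> \<rho> \<Longrightarrow> pbound \<rho> C (sum f A)"
proof (induction A rule: infinite_finite_induct)
  case (insert x F)
  have "pbound \<rho> C (f x)" "pbound \<rho> C (sum f F)"
    using insert.prems by (auto intro!: insert.IH)
  then have "pbound \<rho> C (f x + sum f F)"
    using insert.prems by (intro pbound_add)
  then show ?case
    unfolding sum.insert[OF insert.hyps] .
qed (simp_all add: gbound_def)

lemma pbound_mult:
  assumes "pbound \<rho> C f" "pbound \<rho> D g" "0 \<le> \<rho>"
  shows "pbound \<rho> (C * D) (f * g)"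
proof (rule gboundI)
  fix j
  have "av (poly.coeff (f * g) j) * \<rho> ^ j
      = av (\<Sum>i\<le>j. poly.coeff f i * poly.coeff g (j - i)) * \<rho> ^ j"
    by (simp add: coeff_mult)
  show "av (poly.coeff (f * g) j) * \<rho> ^ j \<le> C * D"
  proof (cases "\<rho> ^ j = 0")
    case True
    then have "av (poly.coeff (f * g) j) * \<rho> ^ j = 0"
      by (simp only: mult_zero_right)
    then show ?thesis
      using mult_nonneg_nonneg[OF gbound_nonneg[OF assms(1)] gbound_nonneg[OF assms(2)]] by linarith
  next
    case False
    then have \<rho>: "0 < \<rho> ^ j"
      using zero_le_power[OF assms(3), of j] by linarith
    have "av (\<Sum>i\<le>j. poly.coeff f i * poly.coeff g (j - i)) \<le> C * D / \<rho> ^ j"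
    proof (rule av_sum_le)
      fix i assume "i \<in> {..j}"
      then have "\<rho> ^ j = \<rho> ^ i * \<rho> ^ (j - i)"
        by (simp flip: power_add)
      then have "av (poly.coeff f i * poly.coeff g (j - i)) * \<rho> ^ j
          = (av (poly.coeff f i) * \<rho> ^ i) * (av (poly.coeff g (j - i)) * \<rho> ^ (j - i))"
        by (simp add: av_mult)
      also have "\<dots> \<le> C * D"
        using assms gbound_nonneg[OF assms(1)] by (intro mult_mono gboundD) auto
      finally show "av (poly.coeff f i * poly.coeff g (j - i)) \<le> C * D / \<rho> ^ j"
        using \<rho> by (simp add: pos_le_divide_eq)
    qed (use gbound_nonneg[OF assms(1)] gbound_nonneg[OF assms(2)] \<rho> in auto)
    then show ?thesis
      using \<rho> by (simp add: coeff_mult pos_le_divide_eq)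
  qed
qed

lemma pbound_1: "pbound \<rho> 1 1"
  by (auto simp: gbound_def coeff_1)

lemma pbound_power: "pbound \<rho> C f \<Longrightarrow> 0 \<le> \<rho> \<Longrightarrow> pbound \<rho> (C ^ n) (f ^ n)"
  by (induction n) (auto intro: pbound_mult pbound_1)

lemma pbound_prod:
  "(\<And>i. i \<in> A \<Longrightarrow> pbound \<rho> 1 (f i)) \<Longrightarrow> 0 \<le> \<rho> \<Longrightarrow> pbound \<rho> 1 (prod f A)"
  by (induction A rule: infinite_finite_induct)
     (auto intro: pbound_1 pbound_mult[of _ 1 _ 1, simplified])

lemma pbound_smult:
  assumes "pbound \<rho> C f" "0 \<le> \<rho>" shows "pbound \<rho> (av a * C) (smult a f)"
  using assms by (auto simp: gbound_def av_mult mult.assoc intro!: mult_left_mono)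

lemma pbound_smult_le:
  "pbound \<rho> C f \<Longrightarrow> av a \<le> 1 \<Longrightarrow> 0 \<le> \<rho> \<Longrightarrow> pbound \<rho> C (smult a f)"
  by (metis gbound_mono gbound_nonneg mult_left_le_one_le av_nonneg pbound_smult)

lemma pbound_linear: "av a \<le> \<rho> \<Longrightarrow> pbound \<rho> \<rho> [:a, 1:]"
  by (auto simp: gbound_def coeff_pCons split: nat.splits)
     (smt (verit) av_nonneg)

text \<open>Dividing by \<open>fact n\<close> leaves binomial coefficients as matrix entries, so the
  norm at radius \<open>\<rho>\<close> is at most \<open>1 / \<rho> ^ n\<close>, with no p-adic
  loss.\<close>

definition hderiv :: "nat \<Rightarrow> 'k poly \<Rightarrow> 'k poly" where
  "hderiv n f = smult (inverse (fact n)) ((pderiv ^^ n) f)"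

lemma coeff_hderiv:
  "poly.coeff (hderiv n f) j = of_nat ((j + n) choose n) * poly.coeff f (j + n)"
proof -
  have "of_nat ((j + n) choose n) = (pochhammer (of_nat (Suc j)) n / fact n :: 'k)"
    by (simp add: binomial_gbinomial gbinomial_pochhammer' add.commute)
  then show ?thesis
    by (simp add: hderiv_def coeff_higher_pderiv divide_inverse)
qed

lemma hderiv_add: "hderiv n (f + g) = hderiv n f + hderiv n g"
  by (simp add: poly_eq_iff coeff_hderiv algebra_simps)

lemma hderiv_0 [simp]: "hderiv n 0 = 0"
  by (simp add: poly_eq_iff coeff_hderiv)

lemma hderiv_diff: "hderiv n (f - g) = hderiv n f - hderiv n g"
  by (simp add: poly_eq_iff coeff_hderiv algebra_simps)

lemma hderiv_sum: "hderiv n (sum f A) = (\<Sum>i\<in>A. hderiv n (f i))"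
  by (induction A rule: infinite_finite_induct) (simp_all add: hderiv_add)

lemma smult_sum_right: "smult c (sum f A) = (\<Sum>i\<in>A. smult c (f i))" for f :: "_ \<Rightarrow> 'k poly"
  by (induction A rule: infinite_finite_induct) (simp_all add: smult_add_right)

lemma pbound_hderiv:
  assumes "pbound \<rho> C f" "0 < \<rho>"
  shows "pbound \<rho> (C / \<rho> ^ n) (hderiv n f)"
proof (rule gboundI)
  fix j
  have "av (poly.coeff (hderiv n f) j) * \<rho> ^ j \<le> av (poly.coeff f (j + n)) * \<rho> ^ j"
    using assms av_of_nat_le_1[of "(j + n) choose n"]
    by (auto simp: coeff_hderiv av_mult intro!: mult_right_mono mult_left_le_one_le)
  also have "\<dots> = av (poly.coeff f (j + n)) * \<rho> ^ (j + n) / \<rho> ^ n"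
    using assms by (simp add: power_add)
  also have "\<dots> \<le> C / \<rho> ^ n"
    using assms gboundD[OF assms(1), of "j + n"] by (intro divide_right_mono) auto
  finally show "av (poly.coeff (hderiv n f) j) * \<rho> ^ j \<le> C / \<rho> ^ n" .
qed

abbreviation recenter :: "'k \<Rightarrow> 'k poly \<Rightarrow> 'k poly" where
  "recenter a f \<equiv> pcompose f [:a, 1:]"

lemma recenter_recenter: "recenter a (recenter b f) = recenter (a + b) f"
  by (simp add: pcompose_assoc [symmetric] pcompose_pCons add.commute)

text \<open>A disc of radius \<open>\<rho>\<close> around 0 is also one around \<open>a\<close>, so
  the Gauss norm does not see the centre. The induction is Horner's scheme: removing the constant
  term gains a factor \<open>1 / \<rho>\<close>, which \<open>[:a, 1:]\<close> gives back.\<close>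

lemma pbound_recenter:
  assumes "pbound \<rho> C f" "av a \<le> \<rho>" "0 < \<rho>"
  shows "pbound \<rho> C (recenter a f)"
  using assms(1)
proof (induction f arbitrary: C)
  case 0
  then show ?case by simp
next
  case (pCons c f)
  have c: "av c \<le> C"
    using gboundD[OF pCons.prems, of 0] by simp
  have "pbound \<rho> (C / \<rho>) f"
  proof (rule gboundI)
    fix j
    show "av (poly.coeff f j) * \<rho> ^ j \<le> C / \<rho>"
      using gboundD[OF pCons.prems, of "Suc j"] assms(3)
      by (simp add: field_simps)
  qed
  then have "pbound \<rho> (\<rho> * (C / \<rho>)) ([:a, 1:] * recenter a f)"
    using assms by (intro pbound_mult pbound_linear pCons.IH) auto
  then have *: "pbound \<rho> C ([:a, 1:] * recenter a f)"
    using assms(3) by (simp del: mult_pCons_left)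
  have "pbound \<rho> C [:c:]"
    using c av_nonneg[of c] by (auto simp: gbound_def coeff_pCons split: nat.splits)
      (meson order_trans av_nonneg)
  from pbound_add[OF this *] show ?case
    using assms(3) by (simp only: pcompose_pCons less_imp_le)
qed

lemma recenter_hderiv: "recenter a (hderiv n f) = hderiv n (recenter a f)"
proof -
  have "(pderiv ^^ n) (recenter a f) = recenter a ((pderiv ^^ n) f)"
    by (induction n) (simp_all add: pderiv_pcompose pderiv_pCons)
  then show ?thesis
    by (simp add: hderiv_def pcompose_smult)
qed

lemma recenter_power: "recenter a (f ^ n) = recenter a f ^ n"
  by (induction n) (simp_all add: pcompose_1 pcompose_mult)

lemma recenter_pderiv: "recenter a (pderiv f) = pderiv (recenter a f)"
  by (simp add: pderiv_pcompose pderiv_pCons)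

text \<open>Taylor's formula. For \<open>a = - 1\<close> the right-hand side is the adjoint of the
  operator beta in the rescaled coordinate.\<close>

lemma recenter_eq_sum_hderiv:
  assumes "Polynomial.degree f \<le> I"
  shows "recenter a f = (\<Sum>n\<le>I. smult (a ^ n) (hderiv n f))"
proof -
  have *: "recenter a (Polynomial.monom c m) = (\<Sum>n\<le>I. smult (a ^ n) (hderiv n (Polynomial.monom c m)))"
    if "m \<le> I" for c m
  proof (rule poly_eqI)
    fix j
    have "recenter a (Polynomial.monom c m) = smult c ([:a, 1:] ^ m)"
      by (induction m) (simp_all add: monom_Suc pcompose_pCons monom_0)
    then have "poly.coeff (recenter a (Polynomial.monom c m)) j = c * poly.coeff ([:a, 1:] ^ m) j"
      by simp
    also have "\<dots> = (if j \<le> m then of_nat (m choose j) * a ^ (m - j) * c else 0)"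
      by (auto simp: coeff_linear_poly_power intro!: coeff_eq_0
            le_less_trans[OF degree_power_le] )
    also have "\<dots> = (\<Sum>n\<le>I. if n = m - j \<and> j \<le> m then of_nat (m choose j) * a ^ (m - j) * c else 0)"
      using that by (auto simp: sum.delta)
    also have "\<dots> = (\<Sum>n\<le>I. poly.coeff (smult (a ^ n) (hderiv n (Polynomial.monom c m))) j)"
      by (intro sum.cong) (auto simp: coeff_hderiv binomial_symmetric[of j m])
    finally show "poly.coeff (recenter a (Polynomial.monom c m)) j
        = poly.coeff (\<Sum>n\<le>I. smult (a ^ n) (hderiv n (Polynomial.monom c m))) j"
      by (simp add: coeff_sum)
  qed
  have "recenter a f = recenter a (\<Sum>m\<le>Polynomial.degree f. Polynomial.monom (poly.coeff f m) m)"
    by (simp add: poly_as_sum_of_monoms)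
  also have "\<dots> = (\<Sum>m\<le>Polynomial.degree f. \<Sum>n\<le>I. smult (a ^ n) (hderiv n (Polynomial.monom (poly.coeff f m) m)))"
    using assms by (auto simp: pcompose_sum * intro!: sum.cong)
  also have "\<dots> = (\<Sum>n\<le>I. smult (a ^ n) (hderiv n (\<Sum>m\<le>Polynomial.degree f. Polynomial.monom (poly.coeff f m) m)))"
    by (subst sum.swap) (simp add: hderiv_sum smult_sum_right)
  also have "\<dots> = (\<Sum>n\<le>I. smult (a ^ n) (hderiv n f))"
    by (simp add: poly_as_sum_of_monoms)
  finally show ?thesis .
qed

text \<open>The coefficients of \<open>f\<close> are found from those of \<open>u * f\<close> one
  after the other, and the only division is by the constant term of \<open>u\<close>, a
  unit.\<close>

lemma coeff_bound_unit_cancel: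
  assumes "\<And>n. n < N \<Longrightarrow> av (poly.coeff (u * f) n) \<le> C"
    and "av (poly.coeff u 0) = 1" "pbound 1 1 u" "n < N"
  shows "av (poly.coeff f n) \<le> C"
  using assms(4)
proof (induction n rule: less_induct)
  case (less n)
  have C: "0 \<le> C"
    using assms(1)[OF less.prems] av_nonneg order_trans by blast
  have "poly.coeff (u * f) n = poly.coeff u 0 * poly.coeff f n
      + (\<Sum>i=1..n. poly.coeff u i * poly.coeff f (n - i))"
    by (simp add: coeff_mult sum.atMost_shift sum.atLeast1_atMost_eq)
  moreover have "av (\<Sum>i=1..n. poly.coeff u i * poly.coeff f (n - i)) \<le> C"
  proof (rule av_sum_le)
    fix i assume i: "i \<in> {1..n}"
    then have "av (poly.coeff f (n - i)) \<le> C"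
      using less.prems by (intro less.IH) auto
    moreover have "av (poly.coeff u i) \<le> 1"
      using assms(3) by (simp add: gbound1_iff)
    ultimately have "av (poly.coeff u i) * av (poly.coeff f (n - i)) \<le> 1 * C"
      by (intro mult_mono) auto
    then show "av (poly.coeff u i * poly.coeff f (n - i)) \<le> C"
      by (simp add: av_mult)
  qed (rule C)
  ultimately have "av (poly.coeff u 0 * poly.coeff f n) \<le> C"
    using av_diff_le[OF assms(1)[OF less.prems],
        of "\<Sum>i=1..n. poly.coeff u i * poly.coeff f (n - i)"]
    by simp
  then show ?case
    by (simp add: av_mult assms(2))
qed

text \<open>Divide by \<open>(x - a)\<^sup>N\<close> for one centre \<open>a\<close> after the other: each division gains a factor
  \<open>\<rho>\<^bsup>- N\<^esup>\<close> at radius \<open>\<rho>\<close> and preserves the bounds at the other centres.\<close>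

lemma pbound_interpolation:
  assumes "finite T" "1 \<le> \<rho>"
    and "\<And>a. a \<in> T \<Longrightarrow> av a \<le> 1"
    and "\<And>a b. a \<in> T \<Longrightarrow> b \<in> T \<Longrightarrow> a \<noteq> b \<Longrightarrow> av (b - a) = 1"
    and "\<And>a n. a \<in> T \<Longrightarrow> n < N \<Longrightarrow> av (poly.coeff (recenter a f) n) \<le> C"
    and "pbound \<rho> (C' * \<rho> ^ (N * card T)) f" "0 \<le> C" "C \<le> C'"
  shows "pbound 1 C' f"
  using assms
proof (induction T arbitrary: f rule: finite_induct)
  case empty
  then show ?case
    by (auto intro: gbound_radius_mono)
next
  case (insert a T)
  define low where "low = poly_cutoff N (recenter a f)"
  define f1 where "f1 = recenter (- a) (poly_shift N (recenter a f))"
  have a: "av a \<le> 1" and \<rho>: "0 < \<rho>" "1 \<le> \<rho>"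
    using insert.prems by auto
  have rec_f: "recenter a f = low + Polynomial.monom 1 N * poly_shift N (recenter a f)"
    by (rule poly_eqI) (auto simp: low_def coeff_poly_cutoff coeff_poly_shift coeff_monom_mult)
  have mon: "recenter c (Polynomial.monom 1 N) = [:c, 1:] ^ N" for c :: 'k
    by (induction N) (simp_all add: monom_Suc pcompose_pCons pcompose_1)
  have f: "f = recenter (- a) low + [:- a, 1:] ^ N * f1"
  proof -
    have "f = recenter (- a) (recenter a f)"
      by (simp add: recenter_recenter)
    then show ?thesis
      by (subst (asm) rec_f) (simp add: pcompose_add pcompose_mult mon f1_def)
  qed
  have low: "pbound 1 C low"
    using insert.prems(4)[of a] insert.prems(6) by (auto simp: gbound1_iff low_def coeff_poly_cutoff)
  then have low': "pbound 1 C (recenter (- a) low)"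
    using a by (intro pbound_recenter) auto
  have "pbound 1 C' f1"
  proof (rule insert.IH)
    fix b n assume b: "b \<in> T" "n < N"
    then have ne: "a \<noteq> b" using insert.hyps by auto
    have ab: "av (b - a) = 1"
      using insert.prems(3)[of a b] b ne by auto
    have rb: "recenter b f = recenter b (recenter (- a) low) + [:b - a, 1:] ^ N * recenter b f1"
      by (subst f) (simp add: pcompose_add pcompose_mult recenter_power pcompose_pCons)
    \<comment> \<open>Separation of the centres enters here: seen from \<open>b\<close>, the removed
      power has the unit \<open>(b - a) ^ N\<close> as constant term.\<close>
    show "av (poly.coeff (recenter b f1) n) \<le> C"
    proof (rule coeff_bound_unit_cancel[where u = "[:b - a, 1:] ^ N" and N = N])
      fix m assume m: "m < N"
      have "av (poly.coeff (recenter b f) m) \<le> C"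
        using insert.prems(4)[of b m] b m by auto
      moreover have "av (poly.coeff (recenter b (recenter (- a) low)) m) \<le> C"
        using pbound_recenter[OF low', of b] insert.prems(2)[of b] b by (simp add: gbound1_iff)
      ultimately show "av (poly.coeff ([:b - a, 1:] ^ N * recenter b f1) m) \<le> C"
        by (metis add_diff_cancel_left' av_diff_le coeff_diff rb)
    next
      show "av (poly.coeff ([:b - a, 1:] ^ N) 0) = 1"
        by (simp add: coeff_0_power av_power ab)
      show "pbound 1 1 ([:b - a, 1:] ^ N)"
        using pbound_power[OF pbound_linear[of "b - a" 1], of N] ab by simp
    qed (use b in auto)
  next
    have "pbound \<rho> (C' * \<rho> ^ (N * card T)) (poly_shift N (recenter a f))"
    proof (rule gboundI)
      fix j
      have "pbound \<rho> (C' * \<rho> ^ (N * card (insert a T))) (recenter a f)"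
        using insert.prems(5) a \<rho> by (intro pbound_recenter) auto
      then have "av (poly.coeff (recenter a f) (j + N)) * \<rho> ^ (j + N) \<le> C' * \<rho> ^ (N * card T + N)"
        using insert.hyps by (auto dest!: gboundD[of _ _ _ "j + N"] simp: add.commute)
      then have "(av (poly.coeff (recenter a f) (j + N)) * \<rho> ^ j) * \<rho> ^ N \<le> (C' * \<rho> ^ (N * card T)) * \<rho> ^ N"
        by (simp add: power_add mult.assoc)
      then show "av (poly.coeff (poly_shift N (recenter a f)) j) * \<rho> ^ j \<le> C' * \<rho> ^ (N * card T)"
        using \<rho> by (simp add: coeff_poly_shift)
    qed
    then show "pbound \<rho> (C' * \<rho> ^ (N * card T)) f1"
      using a \<rho> unfolding f1_def by (intro pbound_recenter) auto
  qed (use insert.prems in auto)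
  then have "pbound 1 (1 * C') ([:- a, 1:] ^ N * f1)"
    using pbound_power[OF pbound_linear[of "- a" 1], of N] a by (intro pbound_mult) auto
  then have "pbound 1 C' ([:- a, 1:] ^ N * f1)"
    by simp
  moreover have "pbound 1 C' (recenter (- a) low)"
    using low' insert.prems(7) gbound_mono by blast
  ultimately show ?case
    by (subst f) (intro pbound_add, auto)
qed

end

section \<open>The differential equation at the centres\<close>

locale padic_abs = nonarch_field av for av :: "'k::field_char_0 \<Rightarrow> real" +
  fixes p :: nat
  assumes prime_p: "Factorial_Ring.prime p"
    and av_p: "av (of_nat p) = 1 / real p"
begin

section \<open>Absolute values of natural numbers\<close>

lemma p_ge_2: "2 \<le> p"
  using prime_p prime_ge_2_nat by blast

text \<open>In a Bezout relation \<open>a * m + b * p = 1\<close> the second term has absolute value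
  below 1, so the first one cannot.\<close>

lemma av_of_nat_coprime:
  assumes "\<not> p dvd m"
  shows "av (of_nat m) = 1"
proof (rule antisym)
  have "coprime (int m) (int p)"
    using assms prime_p prime_imp_coprime[of p m] by (simp add: coprime_commute)
  then obtain a b where ab: "a * int m + b * int p = 1"
    using bezout_int[of "int m" "int p"] by auto
  have of_int: "av (of_int z) \<le> 1" for z
    by (cases z) (auto intro: av_of_nat_le_1 simp del: of_nat_Suc)
  have "(1::'k) = of_int (a * int m + b * int p)"
    unfolding ab by simp
  also have "\<dots> = of_int a * of_nat m + of_int b * of_nat p"
    by simp
  finally have "1 \<le> max (av (of_int a * of_nat m)) (av (of_int b * of_nat p))"
    using av_add[of "of_int a * of_nat m" "of_int b * of_nat p"] by simp
  moreover have "av (of_int b * of_nat p) < 1"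
  proof -
    have "av (of_int b * of_nat p) \<le> 1 * (1 / real p)"
      unfolding av_mult av_p using of_int[of b] by (intro mult_mono) auto
    also have "\<dots> < 1"
      using p_ge_2 by simp
    finally show ?thesis .
  qed
  ultimately have "1 \<le> av (of_int a) * av (of_nat m)"
    by (simp add: av_mult max_def split: if_splits)
  also have "\<dots> \<le> 1 * av (of_nat m)"
    using of_int[of a] by (intro mult_right_mono) auto
  finally show "1 \<le> av (of_nat m)" by simp
qed (rule av_of_nat_le_1)

lemma av_of_nat_dvd:
  assumes "p ^ M dvd m"
  shows "av (of_nat m) \<le> (1 / real p) ^ M"
proof -
  obtain c where "m = p ^ M * c" using assms by blast
  then have "av (of_nat m) = (1 / real p) ^ M * av (of_nat c)"
    by (simp add: av_mult av_power av_p)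
  also have "\<dots> \<le> (1 / real p) ^ M * 1"
    using av_of_nat_le_1 by (intro mult_left_mono) auto
  finally show ?thesis by simp
qed

lemma av_of_nat_not_dvd:
  assumes "\<not> p ^ Suc u dvd m"
  shows "(1 / real p) ^ u \<le> av (of_nat m)"
proof -
  have "m \<noteq> 0" using assms by (metis dvd_0_right)
  then obtain c where c: "m = p ^ multiplicity p m * c" "\<not> p dvd c"
    using multiplicity_decompose'[of m p] prime_p
    by (metis not_prime_unit)
  have "multiplicity p m \<le> u"
    using assms by (metis multiplicity_dvd' not_less_eq_eq)
  then have "(1 / real p) ^ u \<le> (1 / real p) ^ multiplicity p m"
    using p_ge_2 by (intro power_decreasing) auto
  also have "\<dots> = av (of_nat (p ^ multiplicity p m * c))"
    using av_of_nat_coprime[OF c(2)] by (simp add: av_mult av_power av_p)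
  finally show ?thesis using c(1) by simp
qed

text \<open>Write \<open>x + n = (N + x) - (N - n)\<close>: as \<open>0 < N - n < p ^ M\<close>, the
  valuation of \<open>N - n\<close> is less than \<open>M\<close>, hence is also that of
  \<open>x + n\<close>. Division by \<open>x + n\<close> thus costs at most a factor
  \<open>N - n\<close>, which geometric decay absorbs.\<close>

lemma av_of_nat_diff_ge:
  assumes "p ^ M dvd N + x" "n < N" "N < p ^ M"
  shows "1 / real (N - n) \<le> av (of_nat (x + n))"
proof -
  define j where "j = N - n"
  define u where "u = multiplicity p j"
  have j: "0 < j" "j < p ^ M" using assms by (auto simp: j_def)
  have pu: "p ^ u dvd j" "\<not> p ^ Suc u dvd j"
    using j prime_p unfolding u_def
    by (auto simp: multiplicity_dvd) (metis multiplicity_geI neq0_conv not_less_eq_eq not_prime_unit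
        order_refl power_Suc)
  have "p ^ u \<le> j" using pu(1) j(1) dvd_imp_le by blast
  then have "p ^ u < p ^ M" using j by simp
  then have "u < M" using p_ge_2 by (simp add: power_strict_increasing_iff)
  then have "p ^ Suc u dvd N + x"
    using assms(1) by (metis Suc_leI dvd_trans le_imp_power_dvd)
  moreover have "N + x = (x + n) + j" using assms(2) by (simp add: j_def)
  ultimately have "\<not> p ^ Suc u dvd x + n"
    using pu(2) by (metis dvd_add_right_iff)
  then have "(1 / real p) ^ u \<le> av (of_nat (x + n))"
    by (rule av_of_nat_not_dvd)
  moreover have "1 / real j \<le> (1 / real p) ^ u"
  proof -
    have "real (p ^ u) \<le> real j" using \<open>p ^ u \<le> j\<close> by (rule of_nat_mono)
    then show ?thesis
      using j p_ge_2 by (simp add: power_divide field_simps)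
  qed
  ultimately show ?thesis by (simp add: j_def)
qed

text \<open>The integrating factor \<open>\<Delta> ^ (x - 1)\<close> turns the right-hand side of
  \<open>F\<close> into the derivative of \<open>\<Delta> ^ x * G\<close>. With
  \<open>\<Delta> = t * v\<close> in the local coordinate \<open>t\<close> at \<open>a\<close>, the
  claim compares coefficients of \<open>t ^ (x - 1 + n)\<close>.\<close>

lemma local_ode:
  fixes G F \<Delta> v :: "'k poly"
  assumes F: "F = \<Delta> * pderiv G + smult (of_nat x) (pderiv \<Delta> * G)"
    and v: "recenter a \<Delta> = [:0, 1:] * v" and x: "1 \<le> x"
  shows "of_nat (x + n) * poly.coeff (v ^ x * recenter a G) n
    = poly.coeff (v ^ (x - 1) * recenter a F) n"
proof -
  define t :: "'k poly" where "t = [:0, 1:]"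
  define H where "H = v ^ x * recenter a G"
  have tn: "poly.coeff (t ^ m * f) (m + n) = poly.coeff f n" for m n f
  proof -
    have "t ^ m = Polynomial.monom 1 m"
      by (simp add: t_def monom_altdef)
    then show ?thesis by (simp add: coeff_monom_mult)
  qed
  obtain y where y: "x = Suc y" using x by (cases x) auto
  have F': "recenter a F = t * v * pderiv (recenter a G)
      + smult (of_nat x) (pderiv (t * v) * recenter a G)"
    unfolding F t_def v[symmetric]
    by (simp add: pcompose_add pcompose_mult pcompose_smult recenter_pderiv)
  define u where "u = t * v"
  have "t ^ x * H = u ^ Suc y * recenter a G"
    by (simp add: H_def u_def y power_mult_distrib mult_ac)
  then have "pderiv (t ^ x * H) = u ^ y * (u * pderiv (recenter a G)
      + smult (of_nat x) (pderiv u * recenter a G))"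
    unfolding y by (simp add: pderiv_mult pderiv_power_Suc algebra_simps del: of_nat_Suc power_Suc)
      (simp add: algebra_simps)
  then have "pderiv (t ^ x * H) = t ^ y * (v ^ y * recenter a F)"
    by (simp add: F' u_def power_mult_distrib mult_ac)
  then have "poly.coeff (pderiv (t ^ x * H)) (y + n) = poly.coeff (v ^ y * recenter a F) n"
    by (simp add: tn)
  then show ?thesis
    using tn[of x H n] by (simp add: coeff_pderiv y H_def)
qed

lemma power_seq_bound:
  fixes r :: real
  assumes "0 \<le> r" "r < 1"
  obtains C where "1 \<le> C" "\<And>j. r ^ j * real j \<le> C"
proof -
  have "(\<lambda>n. real n * r ^ n) \<longlonglongrightarrow> 0"
    using assms by (intro powser_times_n_limit_0) auto
  then have "Bseq (\<lambda>n. real n * r ^ n)"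
    by (intro convergent_imp_Bseq convergentI)
  then obtain K where "\<And>n. norm (real n * r ^ n) \<le> K"
    by (auto simp: Bseq_def)
  then have "r ^ j * real j \<le> max 1 K" for j
    by (smt (verit) mult.commute real_norm_def)
  then show thesis using that[of "max 1 K"] by auto
qed

lemma solve_congruence:
  fixes M :: nat
  assumes "coprime d p"
  obtains N where "N < p ^ M" "p ^ M dvd N * d + e"
proof -
  have cop: "coprime d (p ^ M)" using assms by simp
  obtain y where y: "[d * y = 1] (mod p ^ M)"
    using cong_solve_coprime_nat[OF cop] by auto
  \<comment> \<open>The factor \<open>p ^ M - 1\<close> stands for -1, so that \<open>N\<close> is a
    natural number with \<open>N * d\<close> congruent to \<open>- e\<close>.\<close>
  define N where "N = (y * (e * (p ^ M - 1))) mod p ^ M"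
  have "p ^ M > 0" using p_ge_2 by simp
  have "[N * d = (d * y) * (e * (p ^ M - 1))] (mod p ^ M)"
    by (simp add: N_def cong_def mod_mult_left_eq mod_mult_right_eq ac_simps)
  also have "[(d * y) * (e * (p ^ M - 1)) = 1 * (e * (p ^ M - 1))] (mod p ^ M)"
    by (intro cong_mult y cong_refl)
  finally have "[N * d + e = 1 * (e * (p ^ M - 1)) + e] (mod p ^ M)"
    by (intro cong_add cong_refl)
  moreover have "1 * (e * (p ^ M - 1)) + e = e * p ^ M"
    using \<open>p ^ M > 0\<close> by (metis add.commute mult_1 mult_Suc_right Suc_diff_1)
  ultimately have "p ^ M dvd N * d + e"
    by (simp add: cong_dvd_iff)
  moreover have "N < p ^ M" using \<open>p ^ M > 0\<close> by (simp add: N_def)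
  ultimately show thesis using that by blast
qed

text \<open>Hypothesis \<open>H\<close> is what remains of the operators: \<open>B\<close> comes
  from P and \<open>G\<close> from Q, with \<open>C\<close>, \<open>r\<close> and \<open>w\<close>
  fixed before \<open>g\<close>. This order matters, as \<open>g\<close> is built from integers
  depending on these constants. By \<open>succ\<close>, translation by 1 carries the residue disc of
  each point of \<open>T\<close> to another such disc.\<close>

theorem translation_not_overconvergent:
  fixes T :: "'k set" and q d k :: nat and C r w :: real
  assumes T: "finite T" "card T = p" "1 \<in> T"
    and root: "\<And>a. a \<in> T \<Longrightarrow> a ^ q = a"
    and T_le: "\<And>a. a \<in> T \<Longrightarrow> av a \<le> 1"
    and sep: "\<And>a b. a \<in> T \<Longrightarrow> b \<in> T \<Longrightarrow> a \<noteq> b \<Longrightarrow> av (b - a) = 1"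
    and succ: "\<And>a. a \<in> T \<Longrightarrow> \<exists>b\<in>T. av (a + 1 - b) \<le> 1 / real p"
    and q: "p dvd q" "0 < q" and d: "\<not> p dvd d" "1 \<le> k" "k \<le> d"
    and C: "1 \<le> C" and r: "1 / real p \<le> r" "r < 1" and w: "1 \<le> w"
    and \<Delta>_def: "\<Delta> = Polynomial.monom 1 q - [:0, 1:]"
    and H: "\<And>g D \<epsilon>. pbound 1 1 g \<Longrightarrow> Polynomial.degree g \<le> D \<Longrightarrow> 0 < \<epsilon> \<Longrightarrow>
      \<exists>I G B. pbound w (C * w ^ D) G \<and> (\<forall>n. pbound 1 (C * r ^ n) (B n)) \<and>
        pbound 1 \<epsilon> (recenter (- 1) g - (\<Sum>n\<le>I. smult ((- 1) ^ n) (hderiv n (B n * g)))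
          + (\<Delta> * pderiv G + smult (1 - of_nat k / of_nat d) (pderiv \<Delta> * G)))"
  shows False
proof -
  have "0 < 1 / real p" using p_ge_2 by simp
  then have r0: "0 < r" "0 \<le> r" "r \<le> 1"
    using r by linarith+
  obtain C2 where C2: "1 \<le> C2" "\<And>j. r ^ j * real j \<le> C2"
    using power_seq_bound[OF r0(2) r(2)] by blast
  \<comment> \<open>\<open>L\<close> will make the contribution of P to the decisive coefficient at
    1 smaller than a unit.\<close>
  have "(\<lambda>L. C * r ^ L) \<longlonglongrightarrow> C * 0"
    using r0 r by (intro tendsto_intros LIMSEQ_realpow_zero) auto
  then obtain L where L: "C * r ^ L < 1"
    using order_tendstoD(2)[of _ "C * 0" sequentially 1]
    by (metis (no_types, lifting) eventually_sequentially le_refl mult_zero_right zero_less_one)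
  \<comment> \<open>\<open>K\<close> will bound \<open>G\<close> on the unit disc:
    \<open>C * C2\<close> comes from its Taylor coefficients at \<open>T\<close>,
    \<open>C * w ^ L\<close> from the bound at radius \<open>w\<close>. Being free of
    \<open>N\<close>, it can be beaten by the choice of \<open>M\<close>.\<close>
  define K where "K = max (C * C2) (C * w ^ L)"
  have K: "0 \<le> K" "C * C2 \<le> K" "C * w ^ L \<le> K"
    using C C2 by (auto simp: K_def le_max_iff_disj)
  have p1: "0 \<le> 1 / real p" "1 / real p < 1" using p_ge_2 by auto
  have small: "\<exists>M. (1 / real p) ^ M * c < e" if "0 < e" for c e :: real
  proof -
    have "(\<lambda>M. (1 / real p) ^ M * c) \<longlonglongrightarrow> 0 * c"
      using p1 by (intro tendsto_intros LIMSEQ_realpow_zero) auto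
    from order_tendstoD(2)[OF this, of e] show ?thesis
      using that by (auto simp: eventually_sequentially)
  qed
  obtain M where M: "(1 / real p) ^ M * K < 1"
    using small[of 1 K] by auto
  have cop: "coprime d p"
    using d prime_p prime_imp_coprime coprime_commute by blast
  \<comment> \<open>So \<open>N\<close> is congruent to \<open>k / d - 1\<close>, minus the exponent
    of the equation, modulo \<open>p ^ M\<close>.\<close>
  obtain N where N: "N < p ^ M" "p ^ M dvd N * d + (d - k)"
    using solve_congruence[OF cop] by blast
  define \<Psi> where "\<Psi> = (\<Prod>b\<in>T. [:- b, 1:])"
  define g where "g = recenter 1 \<Psi> ^ N * [:1, - 1:] ^ L"
  define D where "D = p * N + L"
  \<comment> \<open>The error must not disturb bounds of size \<open>r ^ N\<close> near the points
    of \<open>T\<close>, and it must stay below 1.\<close>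
  define \<epsilon> where "\<epsilon> = r ^ (N + L)"
  have \<epsilon>: "0 < \<epsilon>" "\<epsilon> < 1" 
  proof -
    have "r ^ (N + L) \<le> r ^ L" using r0 by (intro power_decreasing) auto
    also have "r ^ L \<le> C * r ^ L" using C r0 by simp
    finally show "\<epsilon> < 1" using L by (simp add: \<epsilon>_def)
  qed (use r0 in \<open>simp add: \<epsilon>_def\<close>)
  have lin: "pbound 1 1 [:c, 1:]" "pbound r 1 [:c, 1:]" "pbound 1 1 [:c, - 1:]" "pbound r 1 [:c, - 1:]"
    if "av c \<le> 1" for c
  proof -
    show 1: "pbound 1 1 [:c, 1:]" using pbound_linear[of c 1] that by simp
    have "pbound 1 1 [:- c, 1:]" using pbound_linear[of "- c" 1] that by simp
    then have "pbound 1 1 (- [:- c, 1:])" by (simp only: pbound_uminus)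
    then show 2: "pbound 1 1 [:c, - 1:]" by simp
    show "pbound r 1 [:c, 1:]" "pbound r 1 [:c, - 1:]"
      using gbound_radius_mono[OF 1, of r] gbound_radius_mono[OF 2, of r] r0 by auto
  qed
  have \<Psi>1: "pbound 1 1 \<Psi>"
    unfolding \<Psi>_def by (intro pbound_prod lin) (auto simp: T_le)
  have g1: "pbound 1 1 g"
    using pbound_mult[OF pbound_power[OF pbound_recenter[OF \<Psi>1, of 1], of N] pbound_power[OF lin(3)[of 1], of L]]
    by (simp add: g_def)
  have deg_g: "Polynomial.degree g \<le> D"
  proof -
    have "Polynomial.degree \<Psi> \<le> (\<Sum>b\<in>T. Polynomial.degree [:- b, 1:])"
      unfolding \<Psi>_def by (rule degree_prod_sum_le[unfolded o_def]) (rule T)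
    then have "Polynomial.degree \<Psi> \<le> p" using T by simp
    then have "Polynomial.degree (recenter 1 \<Psi>) \<le> p"
      using degree_pcompose_le[of \<Psi> "[:1, 1:]"] by simp
    then have "Polynomial.degree (recenter 1 \<Psi> ^ N) \<le> p * N"
      using degree_power_le[of "recenter 1 \<Psi>" N] mult_le_mono1 order_trans by blast
    moreover have "Polynomial.degree ([:1, - 1 :: 'k:] ^ L) \<le> L"
      using degree_power_le[of "[:1, - 1 :: 'k:]" L] by simp
    ultimately show ?thesis
      using degree_mult_le[of "recenter 1 \<Psi> ^ N" "[:1, - 1:] ^ L"] by (simp add: g_def D_def)
  qed
  obtain I G B where G: "pbound w (C * w ^ D) G" and B: "\<And>n. pbound 1 (C * r ^ n) (B n)"
    and e0: "pbound 1 \<epsilon> (recenter (- 1) g - (\<Sum>n\<le>I. smult ((- 1) ^ n) (hderiv n (B n * g)))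
          + (\<Delta> * pderiv G + smult (1 - of_nat k / of_nat d) (pderiv \<Delta> * G)))" (is "pbound 1 \<epsilon> ?e0")
    using H[OF g1 deg_g \<epsilon>(1)] by blast
  define P where "P = (\<Sum>n\<le>I. smult ((- 1) ^ n) (hderiv n (B n * g)))"
  define S where "S = recenter (- 1) g"
  have S: "S = \<Psi> ^ N * [:2, - 1:] ^ L"
    by (simp add: S_def g_def pcompose_mult recenter_power recenter_recenter pcompose_pCons)
  have G1: "pbound 1 (C * w ^ D) G"
    using gbound_radius_mono[OF G, of 1] w by simp
  \<comment> \<open>\<open>m\<close> is the precision of the integer exponent \<open>x\<close>
    chosen next. At this stage \<open>G\<close> is only known to be bounded by
    \<open>C * w ^ D\<close> on the unit disc, and the change of exponent must cost at most
    \<open>\<epsilon>\<close>.\<close>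
  obtain m where m: "(1 / real p) ^ m * (C * w ^ D) < \<epsilon>" "M \<le> m"
  proof -
    obtain m0 where m0: "(1 / real p) ^ m0 * (C * w ^ D) < \<epsilon>"
      using small[OF \<epsilon>(1)] by blast
    have "(1 / real p) ^ max m0 M * (C * w ^ D) \<le> (1 / real p) ^ m0 * (C * w ^ D)"
      using p1 C w by (intro mult_right_mono power_decreasing) auto
    then show thesis using m0 that[of "max m0 M"] by auto
  qed
  \<comment> \<open>A natural number \<open>x\<close> close to \<open>\<lambda>\<close> replaces it, so that \<open>v\<^sup>x\<close> below is a polynomial.\<close>
  obtain x where x: "1 \<le> x" "p ^ m dvd x * d + (p ^ m - 1) * (d - k)"
  proof -
    obtain y where y: "p ^ m dvd y * d + (p ^ m - 1) * (d - k)"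
      using solve_congruence[OF cop] by blast
    \<comment> \<open>Adding \<open>p ^ m\<close> makes \<open>x\<close> positive, so that
      \<open>x - 1\<close> is a genuine exponent.\<close>
    have "(y + p ^ m) * d + (p ^ m - 1) * (d - k) = (y * d + (p ^ m - 1) * (d - k)) + p ^ m * d"
      by (simp add: algebra_simps)
    then have "p ^ m dvd (y + p ^ m) * d + (p ^ m - 1) * (d - k)"
      using y by (metis dvd_add dvd_triv_left)
    moreover have "1 \<le> y + p ^ m" using p_ge_2 by (simp add: Suc_le_eq)
    ultimately show thesis using that by blast
  qed
  have xd: "(p ^ m - 1) * (d - k) + (d - k) = p ^ m * (d - k)"
  proof -
    have "0 < p ^ m" using p_ge_2 by simp
    then show ?thesis by (metis Suc_diff_1 add.commute mult_Suc)
  qed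
  define lam :: 'k where "lam = 1 - of_nat k / of_nat d"
  have d0: "(of_nat d :: 'k) \<noteq> 0" using d by auto
  have av_d: "av (of_nat d) = 1" using av_of_nat_coprime d by blast
  have xlam: "av (of_nat x - lam) \<le> (1 / real p) ^ m"
  proof -
    have "lam = of_nat (d - k) / of_nat d"
      using d d0 by (simp add: lam_def of_nat_diff diff_divide_distrib)
    then have "(of_nat x - lam) = (of_nat (x * d) - of_nat (d - k)) / of_nat d"
      using d0 by (simp add: field_simps)
    also have "\<dots> = (of_nat (x * d + (p ^ m - 1) * (d - k))
        - of_nat ((p ^ m - 1) * (d - k) + (d - k))) / of_nat d"
      by (simp only: of_nat_add) simp
    also have "\<dots> = (of_nat (x * d + (p ^ m - 1) * (d - k)) - of_nat (p ^ m * (d - k))) / of_nat d"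
      by (simp only: xd)
    finally have "av (of_nat x - lam) = av (of_nat (x * d + (p ^ m - 1) * (d - k)) - of_nat (p ^ m * (d - k)))"
      by (simp only: av_divide av_d div_by_1)
    also have "\<dots> \<le> (1 / real p) ^ m"
      by (intro av_diff_le av_of_nat_dvd x(2) dvd_triv_left)
    finally show ?thesis .
  qed
  have Nx: "p ^ M dvd N + x"
  proof -
    have "p ^ M dvd p ^ m" using m(2) by (rule le_imp_power_dvd)
    then have *: "p ^ M dvd x * d + (p ^ m - 1) * (d - k)" "p ^ M dvd p ^ m * (d - k)"
      using x(2) by (auto intro: dvd_trans)
    have "(N + x) * d + p ^ m * (d - k)
        = (N * d + (d - k)) + (x * d + (p ^ m - 1) * (d - k))"
      by (simp only: xd[symmetric] add_mult_distrib add_ac)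
    then have "p ^ M dvd (N + x) * d + p ^ m * (d - k)"
      using N(2) *(1) by (metis dvd_add)
    then have "p ^ M dvd (N + x) * d"
      using *(2) dvd_add_left_iff by blast
    then show ?thesis
      using cop by (simp add: coprime_dvd_mult_left_iff coprime_commute)
  qed
  define F where "F = \<Delta> * pderiv G + smult (of_nat x) (pderiv \<Delta> * G)"
  define e where "e = ?e0 + smult (of_nat x - lam) (pderiv \<Delta> * G)"
  have F: "F = P - S + e"
    by (simp add: F_def e_def P_def S_def lam_def[symmetric] smult_diff_left algebra_simps)
  have \<Delta>1: "pbound 1 1 \<Delta>"
    unfolding \<Delta>_def by (intro pbound_diff) (auto simp: gbound1_iff coeff_pCons split: nat.splits)
  have \<Delta>': "pbound 1 1 (pderiv \<Delta>)"
    unfolding gbound1_iff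
  proof
    fix j
    show "av (poly.coeff (pderiv \<Delta>) j) \<le> 1"
      using \<Delta>1 av_of_nat_le_1[of "Suc j"]
      by (auto simp: gbound1_iff coeff_pderiv av_mult simp del: of_nat_Suc intro!: mult_le_one)
  qed
  have e: "pbound 1 \<epsilon> e"
  proof -
    have "pbound 1 (av (of_nat x - lam) * (1 * (C * w ^ D))) (smult (of_nat x - lam) (pderiv \<Delta> * G))"
      by (intro pbound_smult pbound_mult \<Delta>' G1) auto
    moreover have "av (of_nat x - lam) * (1 * (C * w ^ D)) \<le> \<epsilon>"
    proof -
      have "av (of_nat x - lam) * (C * w ^ D) \<le> (1 / real p) ^ m * (C * w ^ D)"
        using xlam C w by (intro mult_right_mono) auto
      then show ?thesis using m(1) by simp
    qed
    ultimately have "pbound 1 \<epsilon> (smult (of_nat x - lam) (pderiv \<Delta> * G))"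
      using gbound_mono by blast
    then show ?thesis
      using e0 by (auto simp only: e_def intro: pbound_add)
  qed
  \<comment> \<open>The constant term of \<open>v a\<close> is the derivative of
    \<open>\<Delta>\<close> at \<open>a\<close>, namely \<open>q * a ^ (q - 1) - 1\<close>, a unit
    because p divides q.\<close>
  define v where "v a = poly_shift 1 (recenter a \<Delta>)" for a
  have v: "recenter a \<Delta> = [:0, 1:] * v a" "pbound 1 1 (v a)" "av (poly.coeff (v a) 0) = 1"
    if a: "a \<in> T" for a
  proof -
    have "poly.coeff (recenter a \<Delta>) 0 = poly \<Delta> a"
      by (simp add: poly_0_coeff_0[symmetric] poly_pcompose)
    also have "\<dots> = 0" using root[OF a] by (simp add: \<Delta>_def poly_monom)
    finally show "recenter a \<Delta> = [:0, 1:] * v a"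
      by (intro poly_eqI) (auto simp: v_def coeff_poly_shift coeff_pCons split: nat.splits)
    show "pbound 1 1 (v a)"
      using pbound_recenter[OF \<Delta>1, of a] T_le[OF a]
      by (auto simp: v_def gbound1_iff coeff_poly_shift)
    have "poly.coeff (v a) 0 = poly.coeff (pderiv (recenter a \<Delta>)) 0"
      by (simp add: v_def coeff_poly_shift coeff_pderiv)
    also have "\<dots> = poly (pderiv \<Delta>) a"
      by (simp add: recenter_pderiv[symmetric] poly_0_coeff_0[symmetric] poly_pcompose)
    also have "\<dots> = of_nat q * a ^ (q - 1) - 1"
      by (simp add: \<Delta>_def pderiv_diff pderiv_monom poly_monom pderiv_pCons)
    finally have v0: "poly.coeff (v a) 0 = - 1 + of_nat q * a ^ (q - 1)" by simp
    have "av (of_nat q * a ^ (q - 1)) \<le> (1 / real p) ^ 1 * 1"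
      unfolding av_mult av_power using q T_le[OF a]
      by (intro mult_mono av_of_nat_dvd power_le_one) auto
    then have "av (of_nat q * a ^ (q - 1)) < av (- 1)" using p1 by simp
    then show "av (poly.coeff (v a) 0) = 1"
      unfolding v0 by (subst av_add_eq) auto
  qed
  define \<gamma> where "\<gamma> a = recenter a (recenter 1 \<Psi>) ^ N" for a
  have ga: "recenter a g = \<gamma> a * [:1 - a, - 1:] ^ L" for a
    by (simp add: g_def \<gamma>_def pcompose_mult recenter_power pcompose_pCons)
  \<comment> \<open>The factor of \<open>\<Psi>(y + 1)\<close> belonging to the point
    \<open>b\<close> close to \<open>a + 1\<close> has norm at most \<open>r\<close> on the disc of
    radius \<open>r\<close> around \<open>a\<close>. This is where \<open>r\<close> must be at least
    \<open>1 / p\<close>.\<close>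
  have \<gamma>: "pbound r (r ^ N) (\<gamma> a)" if a: "a \<in> T" for a
  proof -
    obtain b where b: "b \<in> T" "av (a + 1 - b) \<le> 1 / real p" using succ[OF a] by blast
    have "recenter a (recenter 1 \<Psi>) = (\<Prod>b\<in>T. [:a + 1 - b, 1:])"
      by (simp add: \<Psi>_def pcompose_prod recenter_recenter pcompose_pCons algebra_simps)
    also have "\<dots> = [:a + 1 - b, 1:] * (\<Prod>b\<in>T - {b}. [:a + 1 - b, 1:])"
      using T(1) b(1) by (rule prod.remove)
    also have "pbound r (r * 1) \<dots>"
    proof (intro pbound_mult pbound_linear pbound_prod lin r0)
      show "av (a + 1 - b) \<le> r" using b(2) r(1) by linarith
      fix b' assume "b' \<in> T - {b}"
      then show "av (a + 1 - b') \<le> 1"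
        using T_le a by (intro av_diff_le av_add_le) auto
    qed
    finally show ?thesis
      unfolding \<gamma>_def using pbound_power[of r r _ N] r0 by simp
  qed
  have a1: "av (1 - a) \<le> 1" if "a \<in> T" for a
    using T_le[OF that] by (intro av_diff_le) auto
  have g_a: "pbound r (r ^ N) (recenter a g)" if a: "a \<in> T" for a
    using pbound_mult[OF \<gamma>[OF a] pbound_power[OF lin(4)[OF a1[OF a]], of L]] r0
    by (simp add: ga)
  \<comment> \<open>At the point 1 the factor \<open>(1 - y) ^ L\<close> is, up to sign, a power of
    the local coordinate and gains \<open>r ^ L\<close>.\<close>
  have g_1: "pbound r (r ^ (N + L)) (recenter 1 g)"
  proof -
    have "pbound r r (- [:0, 1:])"
      unfolding pbound_uminus by (rule pbound_linear) (use r0 in auto)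
    then have "pbound r (r ^ N * r ^ L) (recenter 1 g)"
      unfolding ga using r0 by (intro pbound_mult pbound_power \<gamma> T) auto
    then show ?thesis by (simp add: power_add)
  qed
  \<comment> \<open>Overconvergence of P: the decay \<open>r ^ n\<close> of \<open>B n\<close>
    cancels the norm \<open>1 / r ^ n\<close> of the n-th divided derivative, so smallness of
    \<open>g\<close> on a disc of radius \<open>r\<close> survives up to the factor
    \<open>C\<close>.\<close>
  have P_a: "pbound r (C * Y) (recenter a P)" if Y: "pbound r Y (recenter a g)" and a: "a \<in> T" for a Y
  proof -
    have "recenter a P = (\<Sum>n\<le>I. smult ((- 1) ^ n) (hderiv n (recenter a (B n) * recenter a g)))"
      by (simp add: P_def pcompose_sum pcompose_smult recenter_hderiv pcompose_mult)
    also have "pbound r (C * Y) \<dots>"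
    proof (rule pbound_sum)
      fix n
      have "pbound 1 (C * r ^ n) (recenter a (B n))"
        using B T_le[OF a] by (intro pbound_recenter) auto
      then have "pbound r (C * r ^ n) (recenter a (B n))"
        using r0 by (auto intro: gbound_radius_mono)
      then have "pbound r (C * r ^ n * Y) (recenter a (B n) * recenter a g)"
        using Y r0 by (intro pbound_mult) auto
      then have "pbound r (C * r ^ n * Y / r ^ n) (hderiv n (recenter a (B n) * recenter a g))"
        using r0 by (intro pbound_hderiv) auto
      then have "pbound r (C * Y) (hderiv n (recenter a (B n) * recenter a g))"
        using r0 by simp
      then show "pbound r (C * Y) (smult ((- 1) ^ n) (hderiv n (recenter a (B n) * recenter a g)))"
        using r0 by (intro pbound_smult_le) auto
    qed (use C r0 gbound_nonneg[OF Y] in auto)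
    finally show ?thesis .
  qed
  define \<psi> where "\<psi> a = (\<Prod>b\<in>T - {a}. [:a - b, 1:])" for a
  have \<Psi>_a: "recenter a \<Psi> = [:0, 1:] * \<psi> a" if a: "a \<in> T" for a
  proof -
    have "recenter a \<Psi> = (\<Prod>b\<in>T. [:a - b, 1:])"
      by (simp add: \<Psi>_def pcompose_prod pcompose_pCons)
    also have "\<dots> = [:0, 1:] * \<psi> a"
      using prod.remove[OF T(1) a, of "\<lambda>b. [:a - b, 1:]"] by (simp add: \<psi>_def)
    finally show ?thesis .
  qed
  have ab: "av (a - b) \<le> 1" if "a \<in> T" "b \<in> T" for a b
    using T_le that by (intro av_diff_le) auto
  have \<psi>1: "pbound 1 1 (\<psi> a)" if a: "a \<in> T" for a
    unfolding \<psi>_def using ab[OF a] by (intro pbound_prod lin) auto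
  have v_power: "pbound 1 1 (v a ^ y)" "pbound r 1 (v a ^ y)" if a: "a \<in> T" for a y
  proof -
    show 1: "pbound 1 1 (v a ^ y)" using pbound_power[OF v(2)[OF a], of y] by simp
    show "pbound r 1 (v a ^ y)" using gbound_radius_mono[OF 1] r0 by auto
  qed
  \<comment> \<open>All three parts of \<open>F\<close> are this small: \<open>S\<close> vanishes to
    order \<open>N\<close> at \<open>a\<close>, the part from P inherits the size of
    \<open>g\<close>, and \<open>e\<close> is bounded by \<open>\<epsilon>\<close>.\<close>
  have F_a: "pbound r (C * r ^ N) (recenter a F)" if a: "a \<in> T" for a
  proof -
    have CN: "r ^ N \<le> C * r ^ N" using C r0 by simp
    have "pbound r (r ^ N * 1) ([:0, 1:] ^ N * (\<psi> a ^ N * [:2 - a, - 1:] ^ L))"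
    proof (rule pbound_mult)
      show "pbound r (r ^ N) ([:0, 1:] ^ N)"
        using r0 by (intro pbound_power pbound_linear) auto
      have "pbound 1 (1 ^ N * 1 ^ L) (\<psi> a ^ N * [:2 - a, - 1:] ^ L)"
      proof (intro pbound_mult pbound_power \<psi>1 a lin)
        have "av (1 + (1 - a)) \<le> 1" by (intro av_add_le a1 a) auto
        then show "av (2 - a) \<le> 1" by (simp add: algebra_simps)
      qed auto
      then show "pbound r 1 (\<psi> a ^ N * [:2 - a, - 1:] ^ L)"
        using r0 by (auto intro: gbound_radius_mono)
    qed (use r0 in auto)
    moreover have "recenter a S = [:0, 1:] ^ N * (\<psi> a ^ N * [:2 - a, - 1:] ^ L)"
      by (simp add: S pcompose_mult recenter_power \<Psi>_a[OF a] power_mult_distrib pcompose_pCons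
          mult.assoc del: mult_pCons_left)
    ultimately have "pbound r (r ^ N) (recenter a S)" by simp
    then have S': "pbound r (C * r ^ N) (recenter a S)"
      using CN by (rule gbound_mono)
    have "pbound 1 \<epsilon> (recenter a e)"
      using e T_le[OF a] by (intro pbound_recenter) auto
    then have "pbound r \<epsilon> (recenter a e)"
      using r0 by (auto intro: gbound_radius_mono)
    moreover have "\<epsilon> \<le> C * r ^ N"
    proof -
      have "\<epsilon> \<le> r ^ N" unfolding \<epsilon>_def using r0 by (intro power_decreasing) auto
      then show ?thesis using CN by linarith
    qed
    ultimately have "pbound r (C * r ^ N) (recenter a e)"
      using gbound_mono by blast
    then show ?thesis
      using P_a[OF g_a[OF a] a] S' r0
      by (simp only: F pcompose_add pcompose_diff) (intro pbound_add pbound_diff)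
  qed
  \<comment> \<open>At index \<open>n\<close> the bound for \<open>F\<close> at radius
    \<open>r\<close> reads \<open>C * r ^ (N - n)\<close>; division by \<open>x + n\<close> costs
    \<open>N - n\<close>, and \<open>C2\<close> bounds \<open>r ^ (N - n) * (N - n)\<close>.\<close>
  have G_a: "av (poly.coeff (recenter a G) n) \<le> C * C2" if a: "a \<in> T" and n: "n < N" for a n
  proof (rule coeff_bound_unit_cancel[where u = "v a ^ x" and N = N])
    fix n assume n: "n < N"
    have ge: "1 / real (N - n) \<le> av (of_nat (x + n))"
      by (rule av_of_nat_diff_ge[OF Nx n N(1)])
    have "pbound r (1 * (C * r ^ N)) (v a ^ (x - 1) * recenter a F)"
      using r0 by (intro pbound_mult v_power F_a a)
    then have "av (poly.coeff (v a ^ (x - 1) * recenter a F) n) * r ^ n \<le> C * r ^ N"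
      by (auto dest: gboundD)
    then have "av (of_nat (x + n)) * av (poly.coeff (v a ^ x * recenter a G) n) * r ^ n \<le> C * r ^ N"
      by (simp only: local_ode[OF F_def v(1)[OF a] x(1), symmetric] av_mult)
    moreover have "r ^ N = r ^ (N - n) * r ^ n"
      using n by (simp flip: power_add)
    ultimately have "av (of_nat (x + n)) * av (poly.coeff (v a ^ x * recenter a G) n) \<le> C * r ^ (N - n)"
      using r0 by (simp add: mult.assoc[symmetric])
    moreover have "1 / real (N - n) * av (poly.coeff (v a ^ x * recenter a G) n)
        \<le> av (of_nat (x + n)) * av (poly.coeff (v a ^ x * recenter a G) n)"
      using ge by (intro mult_right_mono) auto
    ultimately have "1 / real (N - n) * av (poly.coeff (v a ^ x * recenter a G) n) \<le> C * r ^ (N - n)"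
      by (rule order_trans[rotated])
    then have "av (poly.coeff (v a ^ x * recenter a G) n) \<le> C * (r ^ (N - n) * real (N - n))"
      using n by (simp add: field_simps)
    also have "\<dots> \<le> C * C2"
      using C C2(2) by (intro mult_left_mono) auto
    finally show "av (poly.coeff (v a ^ x * recenter a G) n) \<le> C * C2" .
  qed (use v(2,3)[OF a] v_power[OF a] n in \<open>auto simp: coeff_0_power av_power\<close>)
  \<comment> \<open>The degree of \<open>g\<close> was arranged for this:
    \<open>D = p * N + L\<close> with p the size of \<open>T\<close>, so interpolation to order
    \<open>N\<close> removes \<open>w ^ (p * N)\<close> and leaves \<open>w ^ L\<close>.\<close>
  have "pbound 1 K G"
  proof (rule pbound_interpolation[where C = "C * C2" and T = T and \<rho> = w and N = N])
    have "C * w ^ D = C * w ^ L * w ^ (N * card T)"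
      by (simp add: D_def T(2) power_add mult_ac)
    also have "\<dots> \<le> K * w ^ (N * card T)"
      using K w by (intro mult_right_mono) auto
    finally show "pbound w (K * w ^ (N * card T)) G"
      using G gbound_mono by blast
  qed (use T T_le sep G_a w K C C2 in auto)
  then have "pbound 1 K (recenter 1 G)"
    by (intro pbound_recenter) auto
  then have "pbound 1 (1 * K) (v 1 ^ x * recenter 1 G)"
    by (intro pbound_mult v_power T) auto
  then have "av (poly.coeff (v 1 ^ x * recenter 1 G) N) \<le> K"
    by (simp add: gbound1_iff)
  \<comment> \<open>At index \<open>N\<close> the multiplier \<open>x + N\<close> is divisible by
    \<open>p ^ M\<close>, so the equation forces the coefficient of \<open>F\<close> below a
    unit.\<close>
  then have "av (of_nat (x + N)) * av (poly.coeff (v 1 ^ x * recenter 1 G) N) \<le> (1 / real p) ^ M * K"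
    using av_of_nat_dvd[of M "x + N"] Nx by (intro mult_mono) (auto simp: add.commute)
  then have lhs: "av (poly.coeff (v 1 ^ (x - 1) * recenter 1 F) N) < 1"
    using M by (simp only: local_ode[OF F_def v(1)[OF T(3)] x(1), symmetric] av_mult) 
  have tP: "av (poly.coeff (v 1 ^ (x - 1) * recenter 1 P) N) < 1"
  proof -
    have "pbound r (1 * (C * r ^ (N + L))) (v 1 ^ (x - 1) * recenter 1 P)"
      using r0 by (intro pbound_mult v_power P_a g_1 T)
    then have "av (poly.coeff (v 1 ^ (x - 1) * recenter 1 P) N) * r ^ N \<le> C * r ^ (N + L)"
      by (auto dest: gboundD)
    then have "av (poly.coeff (v 1 ^ (x - 1) * recenter 1 P) N) * r ^ N \<le> (C * r ^ L) * r ^ N"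
      by (simp add: power_add mult_ac)
    then have "av (poly.coeff (v 1 ^ (x - 1) * recenter 1 P) N) \<le> C * r ^ L"
      using r0 by simp
    then show ?thesis using L by linarith
  qed
  have te: "av (poly.coeff (v 1 ^ (x - 1) * recenter 1 e) N) < 1"
  proof -
    have "pbound 1 (1 * \<epsilon>) (v 1 ^ (x - 1) * recenter 1 e)"
      by (intro pbound_mult v_power T pbound_recenter e) auto
    then show ?thesis using \<epsilon>(2) by (auto simp: gbound1_iff intro: le_less_trans)
  qed
  \<comment> \<open>At 1 the translate \<open>S\<close> is the \<open>N\<close>-th power of the
    local coordinate times a polynomial whose constant term is a unit.\<close>
  have tS: "av (poly.coeff (v 1 ^ (x - 1) * recenter 1 S) N) = 1"
  proof -
    define f where "f = v 1 ^ (x - 1) * (\<psi> 1 ^ N * [:1, - 1:] ^ L)"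
    have "recenter 1 [:2, - 1 :: 'k:] = [:1, - 1:]"
      by (simp add: pcompose_pCons)
    then have "v 1 ^ (x - 1) * recenter 1 S = Polynomial.monom 1 N * f"
      by (simp add: f_def S pcompose_mult recenter_power \<Psi>_a[OF T(3)] power_mult_distrib
          monom_altdef mult_ac del: mult_pCons_left mult_pCons_right)
    then have "poly.coeff (v 1 ^ (x - 1) * recenter 1 S) N = poly.coeff f 0"
      by (simp add: coeff_monom_mult)
    also have "av \<dots> = av (poly.coeff (\<psi> 1) 0) ^ N"
      using v(3)[OF T(3)] by (simp add: f_def coeff_mult_0 coeff_0_power av_mult av_power)
    also have "poly.coeff (\<psi> 1) 0 = (\<Prod>b\<in>T - {1}. 1 - b)"
      by (simp add: \<psi>_def poly_0_coeff_0[symmetric] poly_prod)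
    also have "av \<dots> = 1"
    proof -
      have "av (\<Prod>b\<in>A. 1 - b) = 1" if "finite A" "A \<subseteq> T - {1}" for A
        using that
      proof (induction A rule: finite_induct)
        case (insert b A)
        then show ?case using sep[of b 1] T(3) by (auto simp: av_mult)
      qed simp
      then show ?thesis using T(1) by blast
    qed
    finally show ?thesis by simp
  qed
  have "poly.coeff (v 1 ^ (x - 1) * recenter 1 S) N = poly.coeff (v 1 ^ (x - 1) * recenter 1 P) N
      + poly.coeff (v 1 ^ (x - 1) * recenter 1 e) N - poly.coeff (v 1 ^ (x - 1) * recenter 1 F) N"
    by (simp add: F pcompose_add pcompose_diff algebra_simps)
  then have "av (poly.coeff (v 1 ^ (x - 1) * recenter 1 S) N) < 1"
    using av_diff_less[OF av_add_less[OF tP te] lhs] by (simp only:)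
  then show False using tS by simp
qed

end

section \<open>Adjoints of differential operators\<close>

context nonarch_field
begin

lemma pderiv_sum_poly: "pderiv (sum f A) = (\<Sum>i\<in>A. pderiv (f i))" for f :: "_ \<Rightarrow> 'k poly"
  by (induction A rule: infinite_finite_induct) (simp_all add: pderiv_add)

lemma pbound_0: "0 \<le> C \<Longrightarrow> pbound \<rho> C 0"
  by (simp add: gbound_def)

text \<open>By the Leibniz rule the left-hand side is the adjoint of "multiply by
  \<open>\<psi>\<close>, then differentiate \<open>i\<close> times", applied to
  \<open>\<phi>\<close>; adjoints reverse composition. In the induction, Pascal's rule and the
  product rule leave the case of \<open>pderiv \<phi>\<close> and the sum of the \<open>S n\<close>,
  which cancels all other terms.\<close>

lemma adjoint_leibniz_pderiv:
  fixes \<phi> \<psi> :: "'k poly"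
  shows "(\<Sum>n\<le>i. smult (of_nat (i choose n) * (- 1) ^ n) ((pderiv ^^ n) (\<phi> * (pderiv ^^ (i - n)) \<psi>)))
    = smult ((- 1) ^ i) (\<psi> * (pderiv ^^ i) \<phi>)"
proof (induction i arbitrary: \<phi>)
  case 0
  then show ?case by (simp add: mult.commute)
next
  case (Suc i)
  define D where "D n f = (pderiv ^^ n) f" for n and f :: "'k poly"
  define S where "S n = smult (of_nat (i choose n) * (- 1) ^ n) (D n (\<phi> * D (Suc (i - n)) \<psi>))" for n
  have "(\<Sum>n\<le>Suc i. smult (of_nat (Suc i choose n) * (- 1) ^ n) (D n (\<phi> * D (Suc i - n) \<psi>)))
      = \<phi> * D (Suc i) \<psi> + (\<Sum>n\<le>i. smult (of_nat (Suc i choose Suc n) * (- 1) ^ Suc n) (D (Suc n) (\<phi> * D (i - n) \<psi>)))"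
    by (subst sum.atMost_Suc_shift) (simp add: D_def)
  also have "(\<Sum>n\<le>i. smult (of_nat (Suc i choose Suc n) * (- 1) ^ Suc n) (D (Suc n) (\<phi> * D (i - n) \<psi>)))
      = (\<Sum>n\<le>i. smult (of_nat (i choose Suc n) * (- 1) ^ Suc n) (D (Suc n) (\<phi> * D (i - n) \<psi>)))
        - (\<Sum>n\<le>i. smult (of_nat (i choose n) * (- 1) ^ n) (D (Suc n) (\<phi> * D (i - n) \<psi>)))"
    unfolding sum_subtractf[symmetric] smult_diff_left[symmetric]
    by (intro sum.cong refl arg_cong2[where f = smult]) (simp add: algebra_simps)
  also have "(\<Sum>n\<le>i. smult (of_nat (i choose n) * (- 1) ^ n) (D (Suc n) (\<phi> * D (i - n) \<psi>)))
      = (\<Sum>n\<le>i. smult (of_nat (i choose n) * (- 1) ^ n) (D n (pderiv \<phi> * D (i - n) \<psi>))) + (\<Sum>n\<le>i. S n)"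
    by (auto simp: S_def D_def funpow_swap1[of pderiv] pderiv_mult higher_pderiv_add smult_add_right
        sum.distrib[symmetric] ac_simps intro!: sum.cong)
  also have "(\<Sum>n\<le>i. smult (of_nat (i choose n) * (- 1) ^ n) (D n (pderiv \<phi> * D (i - n) \<psi>)))
      = smult ((- 1) ^ i) (\<psi> * D i (pderiv \<phi>))"
    unfolding D_def by (rule Suc.IH)
  also have "(\<Sum>n\<le>i. S n) = \<phi> * D (Suc i) \<psi>
      + (\<Sum>n\<le>i. smult (of_nat (i choose Suc n) * (- 1) ^ Suc n) (D (Suc n) (\<phi> * D (i - n) \<psi>)))"
  proof -
    have "(\<Sum>n\<le>i. S n) = (\<Sum>n\<le>Suc i. S n)" by (simp add: S_def)
    also have "\<dots> = S 0 + (\<Sum>n\<le>i. S (Suc n))" by (rule sum.atMost_Suc_shift)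
    also have "(\<Sum>n\<le>i. S (Suc n)) = (\<Sum>n\<le>i. smult (of_nat (i choose Suc n) * (- 1) ^ Suc n)
        (D (Suc n) (\<phi> * D (i - n) \<psi>)))"
    proof (rule sum.cong[OF refl])
      fix n assume "n \<in> {..i}"
      then show "S (Suc n) = smult (of_nat (i choose Suc n) * (- 1) ^ Suc n) (D (Suc n) (\<phi> * D (i - n) \<psi>))"
        by (cases "n = i") (auto simp: S_def Suc_diff_Suc binomial_eq_0)
    qed
    finally show ?thesis by (simp add: S_def D_def)
  qed
  finally show ?case
    by (simp add: D_def funpow_swap1)
qed

lemma adjoint_leibniz:
  "(\<Sum>n\<le>i. smult ((- 1) ^ n) (hderiv n (hderiv (i - n) \<psi> * \<phi>))) = smult ((- 1) ^ i) (\<psi> * hderiv i \<phi>)"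
proof -
  have "smult ((- 1) ^ n) (hderiv n (hderiv (i - n) \<psi> * \<phi>))
      = smult (inverse (fact i)) (smult (of_nat (i choose n) * (- 1) ^ n) ((pderiv ^^ n) (\<phi> * (pderiv ^^ (i - n)) \<psi>)))"
    if "n \<le> i" for n
  proof -
    have "inverse (fact n) * inverse (fact (i - n)) = (inverse (fact i) * of_nat (i choose n) :: 'k)"
      using that by (simp add: binomial_fact divide_inverse)
    then show ?thesis
      unfolding hderiv_def higher_pderiv_smult mult_smult_left smult_smult mult.commute[of \<phi>]
      by (simp only: mult.assoc) (simp only: mult_ac)
  qed
  then have "(\<Sum>n\<le>i. smult ((- 1) ^ n) (hderiv n (hderiv (i - n) \<psi> * \<phi>)))
     = smult (inverse (fact i)) (\<Sum>n\<le>i. smult (of_nat (i choose n) * (- 1) ^ n) ((pderiv ^^ n) (\<phi> * (pderiv ^^ (i - n)) \<psi>)))"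
    by (simp add: smult_sum_right)
  then show ?thesis
    unfolding adjoint_leibniz_pderiv by (simp add: hderiv_def mult.commute)
qed

lemma pderiv_hderiv: "pderiv (hderiv n f) = smult (of_nat (Suc n)) (hderiv (Suc n) f)"
proof -
  have "inverse (fact n) = (of_nat (Suc n) * inverse (fact (Suc n)) :: 'k)"
    by (simp add: field_simps del: of_nat_Suc)
  then show ?thesis
    by (simp only: hderiv_def pderiv_smult smult_smult funpow.simps o_apply)
qed

text \<open>In terms of the divided derivatives \<open>\<partial>\<^sup>n / n!\<close>, the coefficient at index \<open>n\<close> of
  \<open>u (\<partial>\<^sup>i / i!) (V\<^sub>0 + V\<^sub>1 \<partial>)\<close> is \<open>u * op_coeff V\<^sub>0 V\<^sub>1 n i\<close>.\<close>

definition op_coeff :: "'k poly \<Rightarrow> 'k poly \<Rightarrow> nat \<Rightarrow> nat \<Rightarrow> 'k poly" where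
  "op_coeff V0 V1 n i = (if n \<le> i then hderiv (i - n) V0 else 0)
     + (if n \<le> Suc i then smult (of_nat n) (hderiv (Suc i - n) V1) else 0)"

text \<open>As adjoints reverse composition, \<open>V0 + V1 d/dy\<close> acts last, through its
  adjoint \<open>f \<mapsto> V0 f - (V1 f)'\<close>. \<open>I\<close> exceeds \<open>i\<close>
  because the composite operator has order \<open>i + 1\<close>.\<close>

lemma adjoint_op_coeff:
  assumes "i < I"
  shows "(\<Sum>n\<le>I. smult ((- 1) ^ n) (hderiv n (op_coeff V0 V1 n i * \<phi>)))
    = V0 * smult ((- 1) ^ i) (hderiv i \<phi>) - pderiv (V1 * smult ((- 1) ^ i) (hderiv i \<phi>))"
proof -
  define S where "S n = smult ((- 1) ^ n) (hderiv n ((if n \<le> i then hderiv (i - n) V0 else 0) * \<phi>))" for n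
  define S1 where "S1 n = smult ((- 1) ^ n) (hderiv n ((if n \<le> Suc i then smult (of_nat n) (hderiv (Suc i - n) V1) else 0) * \<phi>))" for n
  have hs: "hderiv n (smult c f) = smult c (hderiv n f)" for n c f
    by (simp add: poly_eq_iff coeff_hderiv)
  have "(\<Sum>n\<le>I. smult ((- 1) ^ n) (hderiv n (op_coeff V0 V1 n i * \<phi>))) = (\<Sum>n\<le>I. S n) + (\<Sum>n\<le>I. S1 n)"
    by (simp only: op_coeff_def S_def S1_def distrib_right hderiv_add smult_add_right sum.distrib)
  also have "(\<Sum>n\<le>I. S n) = (\<Sum>n\<le>i. S n)"
    using assms by (intro sum.mono_neutral_right) (auto simp: S_def)
  also have "\<dots> = (\<Sum>n\<le>i. smult ((- 1) ^ n) (hderiv n (hderiv (i - n) V0 * \<phi>)))"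
    by (intro sum.cong) (auto simp: S_def)
  also have "\<dots> = V0 * smult ((- 1) ^ i) (hderiv i \<phi>)"
    by (simp add: adjoint_leibniz)
  also have "(\<Sum>n\<le>I. S1 n) = (\<Sum>n\<le>Suc i. S1 n)"
    using assms by (intro sum.mono_neutral_right) (auto simp: S1_def)
  also have "\<dots> = (\<Sum>n\<le>i. S1 (Suc n))"
    by (subst sum.atMost_Suc_shift) (simp add: S1_def)
  also have "\<dots> = - (\<Sum>n\<le>i. pderiv (smult ((- 1) ^ n) (hderiv n (hderiv (i - n) V1 * \<phi>))))"
    unfolding sum_negf[symmetric]
    by (intro sum.cong refl) (simp add: S1_def hs pderiv_smult pderiv_hderiv)
  also have "\<dots> = - pderiv (\<Sum>n\<le>i. smult ((- 1) ^ n) (hderiv n (hderiv (i - n) V1 * \<phi>)))"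
    by (simp add: pderiv_sum_poly)
  also have "\<dots> = - pderiv (V1 * smult ((- 1) ^ i) (hderiv i \<phi>))"
    by (simp add: adjoint_leibniz)
  finally show ?thesis by simp
qed

section \<open>Size and truncation of operator coefficients\<close>

lemma hderiv_eq_0: "Polynomial.degree f < n \<Longrightarrow> hderiv n f = 0"
  by (simp add: poly_eq_iff coeff_hderiv coeff_eq_0)

lemma degree_hderiv_le: "Polynomial.degree (hderiv n f) \<le> Polynomial.degree f"
  by (rule degree_le) (simp add: coeff_hderiv coeff_eq_0)

lemma op_coeff_eq_0:
  assumes "Polynomial.degree V0 \<le> Q" "Polynomial.degree V1 \<le> Q" "n + Q < i"
  shows "op_coeff V0 V1 n i = 0"
  using assms by (simp add: op_coeff_def hderiv_eq_0)

lemma degree_op_coeff: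
  assumes "Polynomial.degree V0 \<le> Q" "Polynomial.degree V1 \<le> Q"
  shows "Polynomial.degree (op_coeff V0 V1 n i) \<le> Q"
  unfolding op_coeff_def
  by (intro degree_add_le)
     (auto intro: order_trans[OF degree_smult_le] order_trans[OF degree_hderiv_le] assms)

lemma pbound1_hderiv: "pbound 1 C f \<Longrightarrow> pbound 1 C (hderiv n f)"
  using pbound_hderiv[of 1 C f n] by simp

lemma pbound_op_coeff:
  assumes "pbound 1 1 V0" "pbound 1 1 V1"
  shows "pbound 1 1 (op_coeff V0 V1 n i)"
  unfolding op_coeff_def
proof (rule pbound_add)
  show "pbound 1 1 (if n \<le> i then hderiv (i - n) V0 else 0)"
    using assms by (auto intro: pbound1_hderiv pbound_0)
  show "pbound 1 1 (if n \<le> Suc i then smult (of_nat n) (hderiv (Suc i - n) V1) else 0)"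
    using pbound_smult_le[OF pbound1_hderiv[OF assms(2)] av_of_nat_le_1]
    by (auto intro: pbound_0)
qed simp

lemma pbound_radius_degree:
  assumes "pbound 1 1 f" "Polynomial.degree f \<le> D" "1 \<le> w"
  shows "pbound w (w ^ D) f"
proof (rule gboundI)
  fix j
  show "av (poly.coeff f j) * w ^ j \<le> w ^ D"
  proof (cases "j \<le> D")
    case True
    then have "av (poly.coeff f j) * w ^ j \<le> 1 * w ^ D"
      using assms by (intro mult_mono power_increasing) (auto simp: gbound1_iff)
    then show ?thesis by simp
  next
    case False
    then show ?thesis using assms by (simp add: coeff_eq_0)
  qed
qed

definition fps_trunc :: "nat \<Rightarrow> 'k fps \<Rightarrow> 'k poly" where
  "fps_trunc t f = (\<Sum>j<t. Polynomial.monom (fps_nth f j) j)"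

lemma coeff_fps_trunc: "poly.coeff (fps_trunc t f) j = (if j < t then fps_nth f j else 0)"
  by (simp add: fps_trunc_def coeff_sum)

lemma coeff_fps_trunc_mult:
  assumes "j < t"
  shows "poly.coeff (fps_trunc t f * g) j = fps_nth (f * fps_of_poly g) j"
  using assms by (auto simp: coeff_mult fps_mult_nth coeff_fps_trunc atLeast0AtMost intro!: sum.cong)

text \<open>The coefficient of \<open>E\<close> of index \<open>a\<close> enters that of
  \<open>E * g\<close> of index \<open>j + n\<close> only if \<open>j + n - a \<le> D\<close>, hence
  \<open>n \<le> a + D\<close>; the weighted alternative then implies the plain one.\<close>

lemma av_coeff_hderiv_mult_le:
  assumes E: "\<And>a. av (poly.coeff E a) \<le> \<epsilon> \<or> av (poly.coeff E a) * w ^ (a + D) \<le> \<epsilon> * w ^ n"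
    and g: "pbound 1 1 g" "Polynomial.degree g \<le> D" and "0 < \<epsilon>" "1 \<le> w"
  shows "av (poly.coeff (hderiv n (E * g)) j) \<le> \<epsilon>"
proof -
  have "av (poly.coeff (E * g) (j + n)) \<le> \<epsilon>"
    unfolding coeff_mult
  proof (rule av_sum_le)
    fix a assume a: "a \<in> {..j + n}"
    have g1: "av (poly.coeff g (j + n - a)) \<le> 1" using g by (simp add: gbound1_iff)
    show "av (poly.coeff E a * poly.coeff g (j + n - a)) \<le> \<epsilon>"
    proof (cases "j + n - a \<le> D")
      case True
      have "av (poly.coeff E a) \<le> \<epsilon>"
        using E[of a]
      proof
        assume *: "av (poly.coeff E a) * w ^ (a + D) \<le> \<epsilon> * w ^ n"
        have "av (poly.coeff E a) * w ^ n \<le> av (poly.coeff E a) * w ^ (a + D)"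
          using True a assms by (intro mult_left_mono power_increasing) auto
        then have "av (poly.coeff E a) * w ^ n \<le> \<epsilon> * w ^ n" using * by linarith
        then show ?thesis using assms by simp
      qed
      then have "av (poly.coeff E a) * av (poly.coeff g (j + n - a)) \<le> \<epsilon> * 1"
        using g1 assms by (intro mult_mono) auto
      then show ?thesis by (simp add: av_mult)
    next
      case False
      then show ?thesis using g assms by (simp add: coeff_eq_0)
    qed
  qed (use assms in auto)
  moreover have "av (poly.coeff (hderiv n (E * g)) j) \<le> 1 * av (poly.coeff (E * g) (j + n))"
    unfolding coeff_hderiv av_mult by (intro mult_right_mono av_of_nat_le_1) auto
  ultimately show ?thesis by simp
qed

lemma gbound_fps_mult:
  assumes "gbound \<rho> C (fps_nth f)" "gbound \<rho> D (fps_nth g)" "0 < \<rho>"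
  shows "gbound \<rho> (C * D) (fps_nth (f * g))"
proof (rule gboundI)
  fix j
  have "pbound \<rho> C (fps_trunc (Suc j) f)" "pbound \<rho> D (fps_trunc (Suc j) g)"
    using assms gbound_nonneg[OF assms(1)] gbound_nonneg[OF assms(2)]
    by (auto simp: gbound_def coeff_fps_trunc)
  then have "pbound \<rho> (C * D) (fps_trunc (Suc j) f * fps_trunc (Suc j) g)"
    using assms by (intro pbound_mult) auto
  moreover have "poly.coeff (fps_trunc (Suc j) f * fps_trunc (Suc j) g) j = fps_nth (f * g) j"
    by (auto simp: coeff_mult fps_mult_nth coeff_fps_trunc atLeast0AtMost intro!: sum.cong)
  ultimately show "av (fps_nth (f * g) j) * \<rho> ^ j \<le> C * D"
    by (metis gboundD)
qed

text \<open>Truncation of the left factor \<open>U\<close> turns the identity of operators into one of differential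
  operators of finite order with polynomial coefficients; its adjoint is applied to \<open>g\<close>.\<close>

lemma adjoint_approximation:
  fixes V0 V1 :: "'k poly" and \<delta> :: "nat \<Rightarrow> real"
  assumes \<delta>: "\<And>i. 0 \<le> \<delta> i" "\<And>i. \<delta> i \<le> C" "\<delta> \<longlonglongrightarrow> 0"
    and V: "pbound 1 1 V0" "pbound 1 1 V1" "Polynomial.degree V0 \<le> Q" "Polynomial.degree V1 \<le> Q"
    and w: "1 < w" and C: "0 \<le> C" and r: "0 \<le> r"
    and ops: "\<And>I \<epsilon>. 0 < \<epsilon> \<Longrightarrow> \<exists>U A. (\<forall>i. gbound w (\<delta> i * w ^ i) (fps_nth (U i))) \<and>
      (\<forall>n. gbound 1 (C * r ^ n) (fps_nth (A n))) \<and>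
      (\<forall>n\<le>I. \<forall>j. av (fps_nth (1 - A n - (\<Sum>i\<le>n + Q. U i * fps_of_poly (op_coeff V0 V1 n i))) j) \<le> \<epsilon>)"
    and g: "pbound 1 1 g" "Polynomial.degree g \<le> D" and \<epsilon>: "0 < \<epsilon>"
  shows "\<exists>I G B. pbound w (C * w ^ D) G \<and> (\<forall>n. pbound 1 (C * r ^ n) (B n)) \<and>
    pbound 1 \<epsilon> (recenter (- 1) g - (\<Sum>n\<le>I. smult ((- 1) ^ n) (hderiv n (B n * g)))
      - (V0 * G - pderiv (V1 * G)))"
proof -
  define W where "W = op_coeff V0 V1"
  have W1: "pbound 1 1 (W n i)" and Ww: "pbound w (w ^ Q) (W n i)" for n i
    using pbound_op_coeff[OF V(1,2)] degree_op_coeff[OF V(3,4)] w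
    by (auto simp: W_def intro: pbound_radius_degree)
  have W0: "W n i = 0" if "n + Q < i" for n i
    unfolding W_def by (rule op_coeff_eq_0[OF V(3,4) that])
  \<comment> \<open>\<open>2 * Q + D\<close> is the largest excess of weight: a term cut off at
    \<open>I\<close> has \<open>i \<le> n + Q\<close>, the factor \<open>W n i\<close> adds
    \<open>w ^ Q\<close>, and \<open>g\<close> shifts indices by up to \<open>D\<close>.\<close>
  have "(\<lambda>i. \<delta> i * w ^ (2 * Q + D)) \<longlonglongrightarrow> 0 * w ^ (2 * Q + D)"
    by (intro tendsto_intros \<delta>)
  then have "eventually (\<lambda>i. \<delta> i * w ^ (2 * Q + D) < \<epsilon>) sequentially"
    using order_tendstoD(2) \<epsilon> by force
  then obtain I0 where I0: "\<And>i. I0 \<le> i \<Longrightarrow> \<delta> i * w ^ (2 * Q + D) < \<epsilon>"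
    by (auto simp: eventually_sequentially)
  \<comment> \<open>\<open>D\<close> is included so that Taylor's formula for \<open>g\<close> is
    complete.\<close>
  define I where "I = max I0 D"
  obtain U A where U: "\<And>i. gbound w (\<delta> i * w ^ i) (fps_nth (U i))"
    and A: "\<And>n. gbound 1 (C * r ^ n) (fps_nth (A n))"
    and UA: "\<And>n j. n \<le> Suc I \<Longrightarrow> av (fps_nth (1 - A n - (\<Sum>i\<le>n + Q. U i * fps_of_poly (W n i))) j) \<le> \<epsilon>"
    using ops[OF \<epsilon>, of "Suc I"] unfolding W_def by blast
  \<comment> \<open>\<open>t\<close> cuts power series to polynomials, so high that the coefficients
    from index \<open>t\<close> on in products of truncations are at most
    \<open>\<epsilon>\<close>.\<close>
  obtain t where t: "1 \<le> t" "C * w ^ (I + Q) \<le> \<epsilon> * w ^ t"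
  proof -
    obtain m where "C * w ^ (I + Q) / \<epsilon> < w ^ m"
      using real_arch_pow[OF w] by blast
    then have "C * w ^ (I + Q) < \<epsilon> * w ^ m" using \<epsilon> by (simp add: field_simps)
    also have "\<dots> \<le> \<epsilon> * w ^ Suc m" using w \<epsilon> by (intro mult_left_mono power_increasing) auto
    finally show thesis using that[of "Suc m"] by auto
  qed
  define U' where "U' i = fps_trunc t (U i)" for i
  define G where "G = (\<Sum>i\<le>I. smult ((- 1) ^ i) (hderiv i (U' i * g)))"
  define B where "B n = fps_trunc t (A n)" for n
  define E where "E n = 1 - (\<Sum>i\<le>I. U' i * W n i) - B n" for n
  have g_w: "pbound w (w ^ D) g" using pbound_radius_degree g w by auto
  have U': "pbound w (\<delta> i * w ^ i) (U' i)" for i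
    using U[of i] \<delta>(1)[of i] w by (auto simp: U'_def gbound_def coeff_fps_trunc)
  have "pbound w (C * w ^ D) G"
    unfolding G_def
  proof (intro pbound_sum pbound_smult_le)
    fix i
    have "pbound w (\<delta> i * w ^ i * w ^ D / w ^ i) (hderiv i (U' i * g))"
      using w by (intro pbound_hderiv pbound_mult U' g_w) auto
    moreover have "\<delta> i * w ^ i * w ^ D / w ^ i \<le> C * w ^ D"
      using w \<delta>(2)[of i] by (simp add: mult_right_mono)
    ultimately show "pbound w (C * w ^ D) (hderiv i (U' i * g))" using gbound_mono by blast
  qed (use w C in auto)
  moreover have "pbound 1 (C * r ^ n) (B n)" for n
    using A[of n] C r by (auto simp: B_def gbound_def coeff_fps_trunc)
  moreover have "pbound 1 \<epsilon> (recenter (- 1) g - (\<Sum>n\<le>Suc I. smult ((- 1) ^ n) (hderiv n (B n * g)))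
      - (V0 * G - pderiv (V1 * G)))"
  proof -
    have "V0 * G - pderiv (V1 * G) = (\<Sum>i\<le>I. \<Sum>n\<le>Suc I. smult ((- 1) ^ n) (hderiv n (W n i * (U' i * g))))"
    proof -
      have "V0 * G - pderiv (V1 * G) = (\<Sum>i\<le>I. V0 * smult ((- 1) ^ i) (hderiv i (U' i * g))
          - pderiv (V1 * smult ((- 1) ^ i) (hderiv i (U' i * g))))"
        by (simp only: G_def sum_distrib_left pderiv_sum_poly sum_subtractf)
      also have "\<dots> = (\<Sum>i\<le>I. \<Sum>n\<le>Suc I. smult ((- 1) ^ n) (hderiv n (W n i * (U' i * g))))"
        unfolding W_def by (intro sum.cong refl adjoint_op_coeff[symmetric]) auto
      finally show ?thesis .
    qed
    also have "\<dots> = (\<Sum>n\<le>Suc I. smult ((- 1) ^ n) (hderiv n ((\<Sum>i\<le>I. U' i * W n i) * g)))"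
    proof (subst sum.swap, intro sum.cong refl)
      fix n
      have "(\<Sum>i\<le>I. U' i * W n i) * g = (\<Sum>i\<le>I. W n i * (U' i * g))"
        by (subst sum_distrib_right) (simp add: mult_ac)
      then show "(\<Sum>i\<le>I. smult ((- 1) ^ n) (hderiv n (W n i * (U' i * g))))
          = smult ((- 1) ^ n) (hderiv n ((\<Sum>i\<le>I. U' i * W n i) * g))"
        by (simp only: hderiv_sum smult_sum_right)
    qed
    finally have 1: "V0 * G - pderiv (V1 * G) = \<dots>" .
    have 2: "recenter (- 1) g = (\<Sum>n\<le>Suc I. smult ((- 1) ^ n) (hderiv n g))"
      using g by (intro recenter_eq_sum_hderiv) (auto simp: I_def)
    have "recenter (- 1) g - (\<Sum>n\<le>Suc I. smult ((- 1) ^ n) (hderiv n (B n * g)))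
      - (V0 * G - pderiv (V1 * G)) = (\<Sum>n\<le>Suc I. smult ((- 1) ^ n) (hderiv n (E n * g)))"
      unfolding 1 2 sum_subtractf[symmetric] smult_diff_right[symmetric] hderiv_diff[symmetric]
      by (intro sum.cong refl) (simp add: E_def algebra_simps)
    also have "pbound 1 \<epsilon> \<dots>"
    proof (intro pbound_sum pbound_smult_le)
      fix n assume n: "n \<in> {..Suc I}"
      \<comment> \<open>Below \<open>t\<close> the truncation is invisible, and the error is that of
        the given identity plus the terms with \<open>i > I\<close>; from \<open>t\<close> on only
        the overflow of the products remains.\<close>
      have "av (poly.coeff (E n) a) \<le> \<epsilon> \<or> av (poly.coeff (E n) a) * w ^ (a + D) \<le> \<epsilon> * w ^ n" for a
      proof (cases "a < t")
        case True
        define S where "S = (\<lambda>A. \<Sum>i\<in>A. fps_nth (U i * fps_of_poly (W n i)) a)"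
        have S0: "S {..I} + S {I<..n + Q} = S {..n + Q} + 0"
        proof (cases "I \<le> n + Q")
          case True
          then have "{..n + Q} = {..I} \<union> {I<..n + Q}" by auto
          then show ?thesis unfolding S_def by (simp add: sum.union_disjoint ivl_disj_int)
        next
          case False
          then have "S {..n + Q} = S {..I}"
            unfolding S_def by (intro sum.mono_neutral_left) (auto simp: W0)
          then show ?thesis using False by (simp add: S_def)
        qed
        have "poly.coeff (E n) a = fps_nth (1 - A n - (\<Sum>i\<le>n + Q. U i * fps_of_poly (W n i))) a + S {I<..n + Q}"
        proof -
          have "poly.coeff (\<Sum>i\<le>I. U' i * W n i) a = S {..I}"
            by (simp only: coeff_sum U'_def coeff_fps_trunc_mult[OF True] S_def)
          moreover have "fps_nth (1 - A n - (\<Sum>i\<le>n + Q. U i * fps_of_poly (W n i))) a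
              = poly.coeff 1 a - fps_nth (A n) a - S {..n + Q}"
            by (simp only: fps_sub_nth fps_sum_nth S_def) (simp add: coeff_1)
          moreover have "poly.coeff (E n) a
              = poly.coeff 1 a - poly.coeff (\<Sum>i\<le>I. U' i * W n i) a - fps_nth (A n) a"
            using True by (simp only: E_def B_def coeff_diff coeff_fps_trunc if_True)
          ultimately show ?thesis
            using S0 by (simp only:) (simp add: algebra_simps)
        qed
        moreover have "av (S {I<..n + Q}) * w ^ (a + D) \<le> \<epsilon> * w ^ n"
        proof -
          have "av (S {I<..n + Q}) \<le> \<epsilon> * w ^ n / w ^ (a + D)"
            unfolding S_def
          proof (rule av_sum_le)
            fix i assume i: "i \<in> {I<..n + Q}"
            have "gbound w (\<delta> i * w ^ i * w ^ Q) (fps_nth (U i * fps_of_poly (W n i)))"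
              using w Ww[of n i] by (intro gbound_fps_mult U) (auto simp: gbound_def)
            then have "av (fps_nth (U i * fps_of_poly (W n i)) a) * w ^ a \<le> \<delta> i * w ^ i * w ^ Q"
              by (rule gboundD)
            also have "\<dots> = \<delta> i * w ^ (i + Q)" by (simp add: power_add mult_ac)
            also have "\<dots> \<le> \<delta> i * w ^ (n + 2 * Q)"
              using i w \<delta>(1) by (intro mult_left_mono power_increasing) auto
            finally have "av (fps_nth (U i * fps_of_poly (W n i)) a) * w ^ a * w ^ D \<le> \<delta> i * w ^ (n + 2 * Q) * w ^ D"
              using w by (intro mult_right_mono) auto
            also have "\<dots> = (\<delta> i * w ^ (2 * Q + D)) * w ^ n" by (simp add: power_add mult_ac)
            also have "\<dots> \<le> \<epsilon> * w ^ n"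
              using I0[of i] i w by (intro mult_right_mono) (auto simp: I_def)
            finally show "av (fps_nth (U i * fps_of_poly (W n i)) a) \<le> \<epsilon> * w ^ n / w ^ (a + D)"
              using w by (simp add: field_simps power_add)
          qed (use \<epsilon> w in auto)
          then show ?thesis using w by (simp add: field_simps)
        qed
        moreover have "av (fps_nth (1 - A n - (\<Sum>i\<le>n + Q. U i * fps_of_poly (W n i))) a) \<le> \<epsilon>"
          using UA n by auto
        ultimately show ?thesis
          using av_add[of "fps_nth (1 - A n - (\<Sum>i\<le>n + Q. U i * fps_of_poly (W n i))) a" "S {I<..n + Q}"]
          by (smt (verit, del_insts) mult_right_mono w zero_le_power)
      next
        case False
        then have "poly.coeff (E n) a = - poly.coeff (\<Sum>i\<le>I. U' i * W n i) a"
          using t(1) by (simp add: E_def B_def coeff_fps_trunc coeff_1)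
        moreover have "av (poly.coeff (\<Sum>i\<le>I. U' i * W n i) a) \<le> \<epsilon>"
        proof -
          have "pbound w (C * w ^ (I + Q)) (\<Sum>i\<le>I. U' i * W n i)"
          proof (rule pbound_sum)
            fix i assume i: "i \<in> {..I}"
            have "pbound w (\<delta> i * w ^ i * w ^ Q) (U' i * W n i)"
              using w by (intro pbound_mult U' Ww) auto
            moreover have "\<delta> i * (w ^ i * w ^ Q) \<le> C * (w ^ I * w ^ Q)"
              using i w \<delta> C by (intro mult_mono power_increasing) auto
            ultimately show "pbound w (C * w ^ (I + Q)) (U' i * W n i)"
              by (auto simp: power_add mult.assoc intro: gbound_mono)
          qed (use w C in auto)
          then have "av (poly.coeff (\<Sum>i\<le>I. U' i * W n i) a) * w ^ a \<le> \<epsilon> * w ^ t"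
            using t(2) by (meson gboundD order_trans)
          also have "\<dots> \<le> \<epsilon> * w ^ a"
            using False w \<epsilon> by (intro mult_left_mono power_increasing) auto
          finally show ?thesis using w by simp
        qed
        ultimately show ?thesis by simp
      qed
      then show "pbound 1 \<epsilon> (hderiv n (E n * g))"
        unfolding gbound1_iff power_one mult_1_right
        using av_coeff_hderiv_mult_le[where E = "E n" and n = n and w = w, OF _ g \<epsilon>] w by auto
    qed (use \<epsilon> in auto)
    finally show ?thesis .
  qed
  ultimately show ?thesis by blast
qed

end

section \<open>Teichmueller representatives, factorials and the residue field\<close>

context padic_abs
begin

text \<open>Expand \<open>(y + e) ^ p\<close>: the inner binomial coefficients are divisible by p,
  and the last term is at most \<open>\<delta> ^ 2 \<le> \<delta> / p\<close>, which is where
  \<open>\<delta> \<le> 1 / p\<close> enters.\<close>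

lemma frobenius_contraction:
  assumes "av x \<le> 1" "av y \<le> 1" "av (x - y) \<le> \<delta>" "\<delta> \<le> 1 / real p"
  shows "av (x ^ p - y ^ p) \<le> \<delta> / real p"
proof -
  define e where "e = x - y"
  have \<delta>: "0 \<le> \<delta>" using assms(3) av_nonneg order_trans by blast
  have p: "2 \<le> p" by (rule p_ge_2)
  have "x ^ p = (\<Sum>i\<le>p. of_nat (p choose i) * e ^ i * y ^ (p - i))"
    using binomial_ring[of e y p] by (simp add: e_def)
  also have "\<dots> = y ^ p + (\<Sum>i<p. of_nat (p choose Suc i) * e ^ Suc i * y ^ (p - Suc i))"
    by (simp only: sum.atMost_shift) simp
  finally have "x ^ p - y ^ p = (\<Sum>i<p. of_nat (p choose Suc i) * e ^ Suc i * y ^ (p - Suc i))"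
    by simp
  also have "av \<dots> \<le> \<delta> / real p"
  proof (rule av_sum_le)
    fix i assume i: "i \<in> {..<p}"
    have y: "av (y ^ (p - Suc i)) \<le> 1" using assms(2) by (simp add: av_power power_le_one)
    have \<delta>1: "\<delta> \<le> 1" using assms(4) p by (smt (verit) divide_le_eq_1_pos of_nat_0_less_iff of_nat_1 of_nat_le_iff one_le_numeral order_trans pos2)
    have e: "av e \<le> \<delta>" using assms(3) by (simp add: e_def)
    have "av (of_nat (p choose Suc i)) * av (e ^ Suc i) \<le> \<delta> / real p"
    proof (cases "Suc i = p")
      case True
      have "av (e ^ Suc i) \<le> \<delta> ^ 2"
      proof -
        have "av (e ^ Suc i) \<le> \<delta> ^ Suc i"
          using e by (simp only: av_power) (intro power_mono, auto)
        also have "\<dots> \<le> \<delta> ^ 2"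
          using True p \<delta> \<delta>1 by (intro power_decreasing) auto
        finally show ?thesis .
      qed
      also have "\<dots> \<le> \<delta> * (1 / real p)"
        unfolding power2_eq_square using assms(4) \<delta> by (intro mult_left_mono)
      finally show ?thesis using True by simp
    next
      case False
      then have lt: "Suc i < p" using i by simp
      have "Suc i * (p choose Suc i) = p * ((p - 1) choose i)"
        using times_binomial_minus1_eq[of "Suc i" p] by simp
      then have "p dvd Suc i * (p choose Suc i)" by simp
      then have "p dvd (p choose Suc i)"
        using prime_p lt by (metis dvd_imp_le not_less prime_dvd_mult_iff zero_less_Suc)
      then have 1: "av (of_nat (p choose Suc i)) \<le> (1 / real p) ^ 1"
        by (intro av_of_nat_dvd) simp
      have "av (e ^ Suc i) \<le> \<delta> ^ Suc i"
        using e by (simp only: av_power) (intro power_mono, auto)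
      also have "\<dots> \<le> \<delta> ^ 1" using \<delta> \<delta>1 by (intro power_decreasing) auto
      finally have "av (of_nat (p choose Suc i)) * av (e ^ Suc i) \<le> (1 / real p) ^ 1 * \<delta> ^ 1"
        using 1 by (intro mult_mono) auto
      then show ?thesis by simp
    qed
    then have "av (of_nat (p choose Suc i)) * av (e ^ Suc i) * av (y ^ (p - Suc i)) \<le> \<delta> / real p * 1"
      using y \<delta> by (intro mult_mono) auto
    then show "av (of_nat (p choose Suc i) * e ^ Suc i * y ^ (p - Suc i)) \<le> \<delta> / real p"
      by (simp only: av_mult mult_1_right)
  qed (use \<delta> in auto)
  finally show ?thesis .
qed

text \<open>The root is the limit of \<open>c ^ (p ^ n)\<close>: by Fermat the first step has size
  at most \<open>1 / p\<close>, and every further step is contracted by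
  \<open>1 / p\<close>.\<close>

lemma teichmueller:
  assumes complete: "Metric_space.mcomplete UNIV (\<lambda>x y. av (x - y))"
  shows "\<exists>a. a ^ p = a \<and> av (a - of_nat c) \<le> 1 / real p"
proof -
  have sym: "av (x - y) = av (y - x)" for x y
    using av_uminus[of "x - y"] by simp
  interpret M: Metric_space UNIV "\<lambda>x y. av (x - y)"
  proof
    fix x y z :: 'k
    have "av (x - z) \<le> max (av (x - y)) (av (y - z))"
      using av_add[of "x - y" "y - z"] by simp
    also have "\<dots> \<le> av (x - y) + av (y - z)" by simp
    finally show "av (x - z) \<le> av (x - y) + av (y - z)" .
  qed (use sym in auto)
  have p: "0 < 1 / real p" "1 / real p < 1" using p_ge_2 by auto
  define \<sigma> :: "nat \<Rightarrow> 'k" where "\<sigma> n = of_nat c ^ (p ^ n)" for n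
  have \<sigma>1: "av (\<sigma> n) \<le> 1" for n
    by (simp add: \<sigma>_def av_power power_le_one av_of_nat_le_1)
  have \<sigma>_Suc: "\<sigma> (Suc n) = \<sigma> n ^ p" for n
    by (simp add: \<sigma>_def power_mult[symmetric] mult.commute)
  have step: "av (\<sigma> (Suc n) - \<sigma> n) \<le> (1 / real p) ^ Suc n" for n
  proof (induction n)
    case 0
    have "[c ^ p = c] (mod p)"
    proof (cases "p dvd c")
      case True
      then show ?thesis using p_ge_2
        by (metis cong_dvd_iff cong_0_iff cong_sym cong_trans dvd_power dvd_trans less_le_trans pos2)
    next
      case False
      have "[c * c ^ (p - 1) = c * 1] (mod p)"
        by (intro cong_mult cong_refl fermat_theorem prime_p False)
      then show ?thesis using p_ge_2 by (simp flip: power_Suc)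
    qed
    then have "[int (c ^ p) = int c] (mod int p)" by (simp only: cong_int_iff)
    then have "int p dvd int (c ^ p) - int c" by (simp only: cong_iff_dvd_diff)
    then obtain z where z: "int (c ^ p) - int c = int p * z" by blast
    have "\<sigma> (Suc 0) - \<sigma> 0 = of_int (int (c ^ p) - int c)"
      by (simp add: \<sigma>_def)
    also have "\<dots> = of_nat p * of_int z" by (simp only: z) simp
    also have "av \<dots> \<le> (1 / real p) * 1"
    proof -
      have "av (of_int z) \<le> 1"
        by (cases z) (auto intro: av_of_nat_le_1 simp del: of_nat_Suc)
      then show ?thesis unfolding av_mult av_p by (intro mult_left_mono) auto
    qed
    finally show ?case by simp
  next
    case (Suc n)
    have "(1 / real p) ^ Suc n \<le> (1 / real p) ^ 1"
      using p by (intro power_decreasing) auto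
    then have "av (\<sigma> (Suc n) ^ p - \<sigma> n ^ p) \<le> (1 / real p) ^ Suc n / real p"
      using Suc \<sigma>1 by (intro frobenius_contraction) auto
    then show ?case by (simp add: \<sigma>_Suc)
  qed
  have diff: "av (\<sigma> (n + k) - \<sigma> n) \<le> (1 / real p) ^ Suc n" for n k
  proof (induction k)
    case (Suc k)
    have "av (\<sigma> (Suc (n + k)) - \<sigma> (n + k)) \<le> (1 / real p) ^ Suc n"
      using step[of "n + k"] power_decreasing[of "Suc n" "Suc (n + k)" "1 / real p"] p by linarith
    then have "av ((\<sigma> (Suc (n + k)) - \<sigma> (n + k)) + (\<sigma> (n + k) - \<sigma> n)) \<le> (1 / real p) ^ Suc n"
      using Suc by (rule av_add_le)
    then show ?case by simp
  qed (use p in auto)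
  have pow0: "\<exists>n. (1 / real p) ^ Suc n < e" if e: "0 < e" for e
  proof -
    obtain n where "(1 / real p) ^ n < e" using real_arch_pow_inv[OF e p(2)] by blast
    moreover have "(1 / real p) ^ Suc n \<le> (1 / real p) ^ n" using p by (intro power_decreasing) auto
    ultimately show ?thesis by (meson le_less_trans)
  qed
  have "M.MCauchy \<sigma>"
    unfolding M.MCauchy_def
  proof (intro conjI allI impI)
    fix e :: real assume "0 < e"
    then obtain n where n: "(1 / real p) ^ Suc n < e" using pow0 by blast
    show "\<exists>N. \<forall>n n'. N \<le> n \<longrightarrow> N \<le> n' \<longrightarrow> av (\<sigma> n - \<sigma> n') < e"
    proof (intro exI allI impI)
      fix m m' assume "n \<le> m" "n \<le> m'"
      then have "av (\<sigma> m - \<sigma> n) \<le> (1 / real p) ^ Suc n" "av (\<sigma> m' - \<sigma> n) \<le> (1 / real p) ^ Suc n"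
        using diff[of n "m - n"] diff[of n "m' - n"] by auto
      then have "av ((\<sigma> m - \<sigma> n) - (\<sigma> m' - \<sigma> n)) \<le> (1 / real p) ^ Suc n"
        by (rule av_diff_le)
      then show "av (\<sigma> m - \<sigma> m') < e" using n by simp
    qed
  qed simp
  then obtain a where "limitin M.mtopology \<sigma> a sequentially"
    using complete by (auto simp: M.mcomplete_def)
  then have lim: "\<exists>N. \<forall>n\<ge>N. av (\<sigma> n - a) < e" if "0 < e" for e
    using that by (auto simp: M.limit_metric_sequentially)
  have a_diff: "av (a - \<sigma> n) \<le> (1 / real p) ^ Suc n" for n
  proof -
    obtain N where N: "\<And>m. N \<le> m \<Longrightarrow> av (\<sigma> m - a) < (1 / real p) ^ Suc n"
      using lim[of "(1 / real p) ^ Suc n"] p by auto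
    have "av (\<sigma> (n + N) - a) \<le> (1 / real p) ^ Suc n"
      using less_imp_le[OF N[of "n + N"]] by (simp only: le_add2)
    with diff[of n N] have "av ((\<sigma> (n + N) - \<sigma> n) - (\<sigma> (n + N) - a)) \<le> (1 / real p) ^ Suc n"
      by (rule av_diff_le)
    then show ?thesis by simp
  qed
  have a1: "av a \<le> 1"
  proof -
    have "av (a - \<sigma> 0) \<le> 1" using a_diff[of 0, unfolded power_Suc0_right] p(2) by linarith
    then have "av ((a - \<sigma> 0) + \<sigma> 0) \<le> 1" by (intro av_add_le \<sigma>1)
    then show ?thesis by simp
  qed
  have "a ^ p = a"
  proof (rule ccontr)
    assume "a ^ p \<noteq> a"
    then have "0 < av (a ^ p - a)" by (simp add: less_le)
    then obtain n where n: "(1 / real p) ^ Suc n < av (a ^ p - a)" using pow0 by blast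
    have "(1 / real p) ^ Suc n \<le> (1 / real p) ^ 1" using p by (intro power_decreasing) auto
    then have "av (a ^ p - \<sigma> n ^ p) \<le> (1 / real p) ^ Suc n / real p"
      using a_diff a1 \<sigma>1 by (intro frobenius_contraction) auto
    also have "\<dots> \<le> (1 / real p) ^ Suc n"
      using p_ge_2 by (simp add: field_simps)
    finally have 1: "av (a ^ p - \<sigma> n ^ p) \<le> (1 / real p) ^ Suc n" .
    have "av (a - \<sigma> (Suc n)) \<le> (1 / real p) ^ Suc n"
      using a_diff[of "Suc n"] power_decreasing[of "Suc n" "Suc (Suc n)" "1 / real p"] p by linarith
    with 1 have "av ((a ^ p - \<sigma> n ^ p) - (a - \<sigma> (Suc n))) \<le> (1 / real p) ^ Suc n"
      by (rule av_diff_le)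
    then show False using n by (simp add: \<sigma>_Suc)
  qed
  then show ?thesis using a_diff[of 0] by (auto simp: \<sigma>_def)
qed

lemma teichmueller_set:
  assumes complete: "Metric_space.mcomplete UNIV (\<lambda>x y. av (x - y))"
  obtains T where "finite T" "card T = p" "1 \<in> T" "\<And>a. a \<in> T \<Longrightarrow> a ^ p = a"
    "\<And>a. a \<in> T \<Longrightarrow> av a \<le> 1"
    "\<And>a b. a \<in> T \<Longrightarrow> b \<in> T \<Longrightarrow> a \<noteq> b \<Longrightarrow> av (b - a) = 1"
    "\<And>a. a \<in> T \<Longrightarrow> \<exists>b\<in>T. av (a + 1 - b) \<le> 1 / real p"
proof -
  obtain \<tau>0 where \<tau>0: "\<And>c. \<tau>0 c ^ p = \<tau>0 c \<and> av (\<tau>0 c - of_nat c) \<le> 1 / real p"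
    using teichmueller[OF complete] by metis
  have p: "0 < 1 / real p" "1 / real p < 1" "2 \<le> p" using p_ge_2 by auto
  \<comment> \<open>The chosen root near 1 is not known to be 1 itself, so 1 is put in by
    hand.\<close>
  define \<tau> where "\<tau> = \<tau>0(1 := 1)"
  have root: "\<tau> c ^ p = \<tau> c" and near: "av (\<tau> c - of_nat c) \<le> 1 / real p" for c
    using \<tau>0[of c] p by (auto simp: \<tau>_def)
  have le1: "av (\<tau> c) \<le> 1" for c
  proof -
    have "av (\<tau> c - of_nat c) \<le> 1" using near[of c] p(2) by linarith
    then have "av ((\<tau> c - of_nat c) + of_nat c) \<le> 1"
      by (intro av_add_le av_of_nat_le_1)
    then show ?thesis by simp
  qed
  have sep': "av (\<tau> b - \<tau> a) = 1" if "a < b" "b < p" for a b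
  proof -
    have "\<not> p dvd b - a" using that by (auto dest: dvd_imp_le)
    then have "av (of_nat (b - a)) = 1" by (rule av_of_nat_coprime)
    then have 1: "av (of_nat b - of_nat a) = 1" using that by (simp add: of_nat_diff)
    have 2: "av ((\<tau> b - of_nat b) - (\<tau> a - of_nat a)) \<le> 1 / real p"
      by (intro av_diff_le near)
    have "av ((of_nat b - of_nat a) + ((\<tau> b - of_nat b) - (\<tau> a - of_nat a))) = 1"
      by (subst av_add_eq) (use 1 2 p(2) in linarith)+
    then show ?thesis by (simp add: algebra_simps)
  qed
  have sep: "av (\<tau> b - \<tau> a) = 1" if "a \<noteq> b" "a < p" "b < p" for a b
    using sep'[of a b] sep'[of b a] that av_uminus[of "\<tau> b - \<tau> a"] by (cases a b rule: linorder_cases) auto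
  have inj: "inj_on \<tau> {..<p}"
    by (rule inj_onI) (metis av_0 diff_self lessThan_iff sep zero_neq_one)
  show thesis
  proof
    show "finite (\<tau> ` {..<p})" by simp
    show "card (\<tau> ` {..<p}) = p" using inj by (simp add: card_image)
    show "1 \<in> \<tau> ` {..<p}" using p by (auto simp: \<tau>_def image_iff intro!: bexI[of _ 1])
    show "a ^ p = a" "av a \<le> 1" if "a \<in> \<tau> ` {..<p}" for a
      using that root le1 by auto
    show "av (b - a) = 1" if "a \<in> \<tau> ` {..<p}" "b \<in> \<tau> ` {..<p}" "a \<noteq> b" for a b
    proof -
      obtain i j where "a = \<tau> i" "b = \<tau> j" "i < p" "j < p" using \<open>a \<in> _\<close> \<open>b \<in> _\<close> by auto
      then show ?thesis using sep[of i j] \<open>a \<noteq> b\<close> by auto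
    qed
    show "\<exists>b\<in>\<tau> ` {..<p}. av (a + 1 - b) \<le> 1 / real p" if a: "a \<in> \<tau> ` {..<p}" for a
    proof -
      obtain c where c: "c < p" "a = \<tau> c" using a by auto
      \<comment> \<open>Since \<open>c < p\<close>, the reduction changes \<open>c + 1\<close> only
        by 0 or p.\<close>
      define c' where "c' = Suc c mod p"
      have "of_nat (Suc c) - of_nat c' = (if Suc c = p then of_nat p else (0::'k))"
        using c by (auto simp: c'_def)
      then have "av (of_nat (Suc c) - of_nat c') \<le> 1 / real p" by (simp add: av_p)
      then have "av ((\<tau> c - of_nat c) + ((of_nat (Suc c) - of_nat c') - (\<tau> c' - of_nat c'))) \<le> 1 / real p"
        by (intro av_add_le[OF near] av_diff_le[OF _ near])
      then have "av (a + 1 - \<tau> c') \<le> 1 / real p" by (simp add: c algebra_simps)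
      moreover have "c' < p" using p by (simp add: c'_def)
      ultimately show ?thesis by blast
    qed
  qed
qed

text \<open>In each block of p consecutive factors only the multiple of p is kept; the other factors
  have absolute value at most 1.\<close>

lemma av_fact_mult: "av (fact (p * m)) \<le> (1 / real p) ^ m * av (fact m)"
proof (induction m)
  case (Suc m)
  have "fact (p * m) * (of_nat (p * Suc m) :: 'k) * of_nat (\<Prod>i\<in>{p * m <..< p * Suc m}. i)
      = fact (p * Suc m)"
  proof -
    have "{1..p * Suc m} = insert (p * Suc m) ({1..p * m} \<union> {p * m <..< p * Suc m})"
      using p_ge_2 by auto
    moreover have "\<Prod>(insert (p * Suc m) ({1..p * m} \<union> {p * m <..< p * Suc m}))
        = p * Suc m * (\<Prod>{1..p * m} * \<Prod>{p * m <..< p * Suc m})"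
      using p_ge_2 by (subst prod.insert; (subst prod.union_disjoint)?; auto)
    ultimately have "\<Prod>{1..p * Suc m} = p * Suc m * (\<Prod>{1..p * m} * \<Prod>{p * m <..< p * Suc m})"
      by (simp only:)
    then have "fact (p * Suc m) = (of_nat (p * Suc m * (\<Prod>{1..p * m} * \<Prod>{p * m <..< p * Suc m})) :: 'k)"
      by (simp only: fact_prod)
    also have "\<dots> = of_nat (p * Suc m) * (fact (p * m) * of_nat (\<Prod>{p * m <..< p * Suc m}))"
      by (simp only: fact_prod of_nat_mult)
    finally show ?thesis by (simp only: mult_ac)
  qed
  then have "av (fact (p * Suc m)) = av (fact (p * m)) * av (of_nat (p * Suc m)) * av (of_nat (\<Prod>i\<in>{p * m <..< p * Suc m}. i))"
    by (metis av_mult)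
  also have "\<dots> \<le> ((1 / real p) ^ m * av (fact m)) * av (of_nat (p * Suc m)) * 1"
    using Suc by (intro mult_mono av_of_nat_le_1) auto
  also have "\<dots> = (1 / real p) ^ Suc m * (av (fact m) * av (of_nat (Suc m)))"
    by (simp only: of_nat_mult av_mult av_p) (simp add: mult_ac)
  also have "av (fact m) * av (of_nat (Suc m)) = av (fact (Suc m))"
    by (simp add: av_mult del: of_nat_Suc)
  finally show ?case .
qed simp

text \<open>Recursion from \<open>n\<close> to \<open>m = n div p\<close>: the multiples of p
  contribute \<open>p ^ m * fact m\<close>, and \<open>1 / p ^ m\<close> is
  \<open>varpi p ^ ((p - 1) * m)\<close>. The remainder \<open>s < p\<close> costs at most a factor
  p, which \<open>p * m \<le> n\<close> pays for.\<close>

lemma av_fact_le: "av (fact n) \<le> real p * max 1 (real n) * varpi p ^ n"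
proof (induction n rule: less_induct)
  case (less n)
  define m s where "m = n div p" and "s = n mod p"
  have n: "n = p * m + s" and p: "2 \<le> p"
    using p_ge_2 by (auto simp: m_def s_def)
  have "s < p" using p by (simp add: s_def)
  then have s: "s \<le> p - 1" by linarith
  have vp: "0 < varpi p" "varpi p \<le> 1"
    using p by (auto simp: varpi_def powr_minus divide_simps ge_one_powr_ge_zero)
  have vp1: "varpi p ^ (p - 1) = 1 / real p"
  proof -
    have "varpi p ^ (p - 1) = real p powr ((- 1 / (real p - 1)) * real (p - 1))"
      using vp p by (simp add: varpi_def powr_realpow[symmetric] powr_powr)
    also have "(- 1 / (real p - 1)) * real (p - 1) = - 1"
      using p by (simp add: of_nat_diff)
    finally show ?thesis using p by (simp add: powr_minus_divide)
  qed
  have vps: "1 \<le> real p * varpi p ^ s"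
  proof -
    have "1 / real p \<le> varpi p ^ s"
      unfolding vp1[symmetric] using vp s by (intro power_decreasing) auto
    then show ?thesis using p by (simp add: field_simps)
  qed
  have fact_n: "av (fact n) \<le> av (fact (p * m))"
  proof -
    have "fact (p * m) dvd (fact n :: nat)" by (intro fact_dvd) (simp add: n)
    then obtain c :: nat where "(fact n :: nat) = fact (p * m) * c" by blast
    then have "(fact n :: 'k) = fact (p * m) * of_nat c" by (metis of_nat_fact of_nat_mult)
    then have "av (fact n) = av (fact (p * m)) * av (of_nat c)" by (simp add: av_mult)
    also have "\<dots> \<le> av (fact (p * m)) * 1" by (intro mult_left_mono av_of_nat_le_1) auto
    finally show ?thesis by simp
  qed
  show ?case
  proof (cases "m = 0")
    case True
    have "av (fact n) \<le> 1" using fact_n True by simp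
    also have "\<dots> \<le> real p * varpi p ^ n" using vps n True by simp
    also have "\<dots> \<le> real p * max 1 (real n) * varpi p ^ n"
    proof -
      have "real p * 1 \<le> real p * max 1 (real n)" by (intro mult_left_mono) auto
      then have "real p * 1 * varpi p ^ n \<le> real p * max 1 (real n) * varpi p ^ n"
        by (rule mult_right_mono) (use vp in simp)
      then show ?thesis by simp
    qed
    finally show ?thesis .
  next
    case False
    have "2 * m \<le> p * m" using p by (rule mult_le_mono1)
    then have "m < n" using False n by linarith
    then have "av (fact m) \<le> real p * max 1 (real m) * varpi p ^ m" by (rule less)
    then have "av (fact n) \<le> (1 / real p) ^ m * (real p * max 1 (real m) * varpi p ^ m)"
      using fact_n av_fact_mult[of m] p
      by (smt (verit) divide_nonneg_nonneg mult_left_mono of_nat_0_le_iff zero_le_power)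
    also have "(1 / real p) ^ m * varpi p ^ m = varpi p ^ (p * m)"
    proof -
      have "(1 / real p) ^ m = varpi p ^ ((p - 1) * m)" by (simp add: vp1[symmetric] power_mult)
      then show ?thesis using p by (simp flip: power_add add: diff_mult_distrib)
    qed
    then have "(1 / real p) ^ m * (real p * max 1 (real m) * varpi p ^ m)
        = real p * max 1 (real m) * varpi p ^ (p * m)" by simp
    also have "\<dots> \<le> real p * max 1 (real m) * (varpi p ^ (p * m) * (real p * varpi p ^ s))"
    proof -
      have "varpi p ^ (p * m) * 1 \<le> varpi p ^ (p * m) * (real p * varpi p ^ s)"
        using vps vp by (intro mult_left_mono) auto
      then show ?thesis by (intro mult_left_mono) auto
    qed
    also have "\<dots> = real p * (real p * real m) * varpi p ^ n"
      using False by (simp add: n power_add max_def mult_ac)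
    also have "\<dots> \<le> real p * max 1 (real n) * varpi p ^ n"
    proof -
      have "real p * real m \<le> max 1 (real n)" by (simp add: n)
      then show ?thesis using vp by (intro mult_right_mono mult_left_mono) auto
    qed
    finally show ?thesis .
  qed
qed

text \<open>The linear factor in \<open>av_fact_le\<close> is absorbed by the room between
  \<open>varpi p\<close> and \<open>c\<close>.\<close>

lemma av_fact_bound:
  assumes "varpi p < c"
  obtains C where "0 < C" "\<And>n. av (fact n) \<le> C * c ^ n"
proof -
  have vp: "0 < varpi p" using p_ge_2 by (simp add: varpi_def)
  define \<rho> where "\<rho> = varpi p / c"
  have \<rho>: "0 \<le> \<rho>" "\<rho> < 1" using vp assms by (auto simp: \<rho>_def)
  obtain K where K: "1 \<le> K" "\<And>j. \<rho> ^ j * real j \<le> K" using power_seq_bound[OF \<rho>] by blast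
  have "av (fact n) \<le> (real p * K) * c ^ n" for n
  proof -
    have "max 1 (real n) * \<rho> ^ n \<le> K"
      using K(1) K(2)[of n] \<rho> power_le_one[of \<rho> n] by (auto simp: max_def mult.commute)
    then have "max 1 (real n) * \<rho> ^ n * c ^ n \<le> K * c ^ n"
      using vp assms by (intro mult_right_mono) auto
    moreover have "\<rho> ^ n * c ^ n = varpi p ^ n"
      using vp assms by (simp add: \<rho>_def power_divide)
    ultimately have "max 1 (real n) * varpi p ^ n \<le> K * c ^ n" by (simp add: mult.assoc)
    then have "real p * (max 1 (real n) * varpi p ^ n) \<le> real p * (K * c ^ n)"
      by (intro mult_left_mono) auto
    then show ?thesis using av_fact_le[of n] by (simp add: mult.assoc)
  qed
  then show thesis using that[of "real p * K"] K p_ge_2 by auto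
qed

end

text \<open>Another prime \<open>r\<close> dividing the order would, by Cauchy's theorem
  (\<open>sylow_thm\<close> with exponent 1), give a nontrivial element whose order divides both
  \<open>r\<close> and \<open>p\<close>.\<close>

lemma (in group) order_prime_power:
  assumes fin: "finite (carrier G)" and p: "Factorial_Ring.prime (p::nat)"
    and exp: "\<And>x. x \<in> carrier G \<Longrightarrow> x [^] p = \<one>"
  shows "\<exists>f. Coset.order G = p ^ f"
proof -
  have pos: "Coset.order G \<noteq> 0" using fin by (simp add: order_gt_0_iff_finite)
  then obtain c where c: "Coset.order G = p ^ multiplicity p (Coset.order G) * c" "\<not> p dvd c"
    using multiplicity_decompose'[of "Coset.order G" p] p by (metis not_prime_unit)
  have "c = 1"
  proof (rule ccontr)
    assume "c \<noteq> 1"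
    then obtain r where r: "Factorial_Ring.prime r" "r dvd c" using prime_factor_nat by blast
    then have "r dvd Coset.order G" using c(1) by (metis dvd_mult)
    then obtain m where m: "Coset.order G = r ^ 1 * m" by auto
    obtain H where H: "subgroup H G" "card H = r ^ 1"
      using sylow_thm[OF r(1) is_group m fin] by blast
    have "H \<noteq> {\<one>}" using H(2) r(1) by (auto dest: prime_gt_1_nat)
    moreover have "\<one> \<in> H" by (rule subgroup.one_closed[OF H(1)])
    ultimately obtain x where x: "x \<in> H" "x \<noteq> \<one>" by auto
    have xG: "x \<in> carrier G" by (rule subgroup.mem_carrier[OF H(1) x(1)])
    interpret GH: group "G\<lparr>carrier := H\<rparr>" by (rule subgroup_imp_group[OF H(1)])
    have "x [^]\<^bsub>G\<lparr>carrier := H\<rparr>\<^esub> Coset.order (G\<lparr>carrier := H\<rparr>) = \<one>\<^bsub>G\<lparr>carrier := H\<rparr>\<^esub>"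
      using x by (intro GH.pow_order_eq_1) auto
    then have "x [^] r = \<one>"
      using H by (simp add: Coset.order_def nat_pow_consistent[symmetric])
    then have "ord x dvd r" "ord x dvd p" using pow_eq_id[OF xG] exp[OF xG] by auto
    moreover have "coprime r p" using r c(2) p by (metis dvd_trans primes_coprime)
    ultimately have "ord x = 1" by (metis coprime_common_divisor_nat)
    then show False using x(2) xG ord_eq_1 by blast
  qed
  then show ?thesis using c by (metis mult_1_right)
qed

section \<open>The affinoid algebra\<close>

context nonarch_field
begin

section \<open>The Tate algebra in two variables\<close>

abbreviation tate :: "'k fps2 ring" where "tate \<equiv> tate_algebra av"

abbreviation coeff2 :: "'k fps2 \<Rightarrow> nat \<Rightarrow> nat \<Rightarrow> 'k" where
  "coeff2 f i j \<equiv> fps_nth (fps_nth f j) i"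

lemma tate_simps [simp]:
  "f \<otimes>\<^bsub>tate\<^esub> g = f * g" "f \<oplus>\<^bsub>tate\<^esub> g = f + g"
  "\<one>\<^bsub>tate\<^esub> = 1" "\<zero>\<^bsub>tate\<^esub> = 0"
  by (simp_all add: tate_algebra_def ring_of_type_algebra_def)

lemma tate_iff: "f \<in> carrier tate \<longleftrightarrow> (\<forall>\<epsilon>>0. finite {(i, j). \<epsilon> \<le> av (coeff2 f i j)})"
  by (auto simp: tate_algebra_def tendsto_iff eventually_cofinite dist_real_def not_less case_prod_unfold)

lemma tateI: "(\<And>\<epsilon>. 0 < \<epsilon> \<Longrightarrow> finite {(i, j). \<epsilon> \<le> av (coeff2 f i j)}) \<Longrightarrow> f \<in> carrier tate"
  by (simp add: tate_iff)

lemma tateD: "f \<in> carrier tate \<Longrightarrow> 0 < \<epsilon> \<Longrightarrow> finite {(i, j). \<epsilon> \<le> av (coeff2 f i j)}"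
  by (simp add: tate_iff)

lemma tate_bounded:
  assumes "f \<in> carrier tate"
  obtains M where "0 < M" "\<And>i j. av (coeff2 f i j) \<le> M"
proof -
  define S where "S = (\<lambda>(i, j). av (coeff2 f i j)) ` {(i, j). 1 \<le> av (coeff2 f i j)}"
  have S: "finite S" using tateD[OF assms, of 1] by (simp add: S_def)
  have "av (coeff2 f i j) \<le> Max (insert 1 S)" for i j
  proof (cases "1 \<le> av (coeff2 f i j)")
    case True
    then have "av (coeff2 f i j) \<in> insert 1 S" by (force simp: S_def)
    then show ?thesis using S by (intro Max_ge) auto
  next
    case False
    moreover have "1 \<le> Max (insert 1 S)" using S by (intro Max_ge) auto
    ultimately show ?thesis by linarith
  qed
  moreover have "0 < Max (insert 1 S)"
    using S by (intro less_le_trans[OF zero_less_one Max_ge]) auto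
  ultimately show thesis using that by blast
qed

lemma tate_finite_support:
  assumes "finite {(i, j). coeff2 f i j \<noteq> 0}"
  shows "f \<in> carrier tate"
proof (rule tateI)
  fix \<epsilon> :: real assume "0 < \<epsilon>"
  then show "finite {(i, j). \<epsilon> \<le> av (coeff2 f i j)}"
    by (intro finite_subset[OF _ assms]) auto
qed

lemma tate_fps_const_poly: "fps_const (fps_of_poly u) \<in> carrier tate"
proof (rule tate_finite_support, rule finite_subset)
  show "{(i, j). coeff2 (fps_const (fps_of_poly u)) i j \<noteq> 0} \<subseteq> {..Polynomial.degree u} \<times> {0}"
    by (auto simp: le_degree split: if_splits)
qed simp

lemma tate_add: "f \<in> carrier tate \<Longrightarrow> g \<in> carrier tate \<Longrightarrow> f + g \<in> carrier tate"
proof (rule tateI)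
  fix \<epsilon> :: real assume *: "0 < \<epsilon>" "f \<in> carrier tate" "g \<in> carrier tate"
  have "\<epsilon> \<le> av x \<or> \<epsilon> \<le> av y" if "\<epsilon> \<le> av (x + y)" for x y
    using that av_add[of x y] by linarith
  then have "{(i, j). \<epsilon> \<le> av (coeff2 (f + g) i j)} \<subseteq> {(i, j). \<epsilon> \<le> av (coeff2 f i j)} \<union> {(i, j). \<epsilon> \<le> av (coeff2 g i j)}"
    by auto
  then show "finite {(i, j). \<epsilon> \<le> av (coeff2 (f + g) i j)}"
    using tateD * finite_subset by blast
qed

lemma tate_uminus: "f \<in> carrier tate \<Longrightarrow> - f \<in> carrier tate"
  by (simp add: tate_iff)

lemma tate_diff: "f \<in> carrier tate \<Longrightarrow> g \<in> carrier tate \<Longrightarrow> f - g \<in> carrier tate"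
  using tate_add[of f "- g"] tate_uminus[of g] by simp

text \<open>By the ultrametric inequality a large coefficient of the product needs one large
  summand, hence a large coefficient in each factor; finitely many index pairs have finitely many
  sums. Halving \<open>\<epsilon>\<close> leaves room for a strict inequality.\<close>

lemma tate_mult:
  assumes "f \<in> carrier tate" "g \<in> carrier tate"
  shows "f * g \<in> carrier tate"
proof (rule tateI)
  fix \<epsilon> :: real assume \<epsilon>: "0 < \<epsilon>"
  obtain M where M: "0 < M" "\<And>i j. av (coeff2 f i j) \<le> M" using tate_bounded[OF assms(1)] by blast
  obtain N where N: "0 < N" "\<And>i j. av (coeff2 g i j) \<le> N" using tate_bounded[OF assms(2)] by blast
  define A where "A = {(i, j). \<epsilon> / 2 / N \<le> av (coeff2 f i j)}"
  define B where "B = {(i, j). \<epsilon> / 2 / M \<le> av (coeff2 g i j)}"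
  have fin: "finite A" "finite B"
    unfolding A_def B_def using \<epsilon> M N assms by (auto intro!: tateD)
  have "{(i, j). \<epsilon> \<le> av (coeff2 (f * g) i j)} \<subseteq> (\<lambda>((i, j), (i', j')). (i + i', j + j')) ` (A \<times> B)"
  proof clarify
    fix i j assume ij: "\<epsilon> \<le> av (coeff2 (f * g) i j)"
    have "\<exists>b\<le>j. \<exists>a\<le>i. \<epsilon> / 2 < av (coeff2 f a b * coeff2 g (i - a) (j - b))"
    proof (rule ccontr)
      assume neg: "\<not> ?thesis"
      have "av (coeff2 (f * g) i j) \<le> \<epsilon> / 2"
        unfolding fps_mult_nth fps_sum_nth
      proof (intro av_sum_le)
        fix b a assume "b \<in> {0..j}" "a \<in> {0..i}"
        then show "av (coeff2 f a b * coeff2 g (i - a) (j - b)) \<le> \<epsilon> / 2"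
          using neg by (meson atLeastAtMost_iff not_le)
      qed (use \<epsilon> in auto)
      then show False using ij \<epsilon> by linarith
    qed
    then obtain a b where ab: "a \<le> i" "b \<le> j" "\<epsilon> / 2 < av (coeff2 f a b) * av (coeff2 g (i - a) (j - b))"
      by (auto simp: av_mult)
    have "\<epsilon> / 2 < av (coeff2 f a b) * N"
      using ab(3) N(2)[of "j - b" "i - a"] mult_left_mono[of _ N "av (coeff2 f a b)"] by (smt (verit) av_nonneg)
    then have 1: "(a, b) \<in> A" using N(1) by (auto simp: A_def pos_divide_le_eq)
    have "\<epsilon> / 2 < M * av (coeff2 g (i - a) (j - b))"
      using ab(3) M(2)[of b a] mult_right_mono[of _ M "av (coeff2 g (i - a) (j - b))"] by (smt (verit) av_nonneg)
    then have 2: "(i - a, j - b) \<in> B" using M(1) by (auto simp: B_def pos_divide_le_eq mult.commute)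
    show "(i, j) \<in> (\<lambda>((i, j), (i', j')). (i + i', j + j')) ` (A \<times> B)"
      using 1 2 ab by (intro image_eqI[of _ _ "((a, b), (i - a, j - b))"]) auto
  qed
  then show "finite {(i, j). \<epsilon> \<le> av (coeff2 (f * g) i j)}"
    using fin finite_subset by blast
qed

lemma tate_1: "1 \<in> carrier tate" and tate_0: "0 \<in> carrier tate"
  using tate_fps_const_poly[of 1] tate_fps_const_poly[of 0] by simp_all

lemma tate_of_nat: "of_nat n \<in> carrier tate"
  by (induction n) (auto intro: tate_add tate_1 tate_0)

lemma fps_of_poly_of_nat: "fps_of_poly (of_nat n) = (of_nat n :: 'k fps)"
  by (induction n) (simp_all add: fps_of_poly_add)

lemma tate_varx: "varx \<in> carrier tate"
  using tate_fps_const_poly[of "[:0, 1:]"] by (simp add: varx_def fps_of_poly_pCons)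

lemma tate_vary: "vary \<in> carrier tate"
proof (rule tate_finite_support, rule finite_subset)
  show "{(i, j). coeff2 (vary :: 'k fps2) i j \<noteq> 0} \<subseteq> {0} \<times> {1}"
    by (auto simp: vary_def fps_X_def split: if_splits)
qed simp

lemma tate_power: "f \<in> carrier tate \<Longrightarrow> f ^ n \<in> carrier tate"
  by (induction n) (auto intro: tate_1 tate_mult)

lemma tate_sum: "(\<And>i. i \<in> A \<Longrightarrow> f i \<in> carrier tate) \<Longrightarrow> sum f A \<in> carrier tate"
  by (induction A rule: infinite_finite_induct) (auto intro: tate_0 tate_add)

lemma cring_tate: "cring tate"
proof (rule cringI)
  show "abelian_group tate"
    by (rule abelian_groupI)
       (auto intro: tate_add tate_0 tate_uminus simp: algebra_simps intro!: bexI[of _ "- x" for x])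
  show "Group.comm_monoid tate"
    by (rule comm_monoidI) (auto intro: tate_mult tate_1 simp: algebra_simps)
qed (auto simp: algebra_simps)

end

locale affinoid = nonarch_field av for av :: "'k::field_char_0 \<Rightarrow> real" +
  fixes q :: nat
  assumes q_ge_2: "2 \<le> q"
begin

section \<open>The quotient ring and its classes\<close>

definition gen :: "'k fps2" where
  "gen = (varx ^ (q - 1) - 1) * vary - 1"

abbreviation IX :: "'k fps2 set" where "IX \<equiv> X_ideal av q"
abbreviation cls :: "'k fps2 \<Rightarrow> 'k fps2 set" where "cls \<equiv> X_class av q"
abbreviation OX :: "'k fps2 set ring" where "OX \<equiv> O_X av q"

lemma tate_gen: "gen \<in> carrier tate"
  unfolding gen_def by (intro tate_diff tate_mult tate_power tate_1 tate_varx tate_vary)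

lemma X_ideal_eq: "IX = {h * gen | h. h \<in> carrier tate}"
  by (simp add: X_ideal_def gen_def cgenideal_def)

lemma ideal_I: "ideal IX tate"
  unfolding X_ideal_def gen_def[symmetric]
  by (rule cring.cgenideal_ideal[OF cring_tate tate_gen])

lemma mem_I: "h \<in> carrier tate \<Longrightarrow> h * gen \<in> IX"
  by (auto simp: X_ideal_eq)

lemma cls_eq: "cls f = {h * gen + f | h. h \<in> carrier tate}"
  by (auto simp: X_class_def a_r_coset_def' X_ideal_eq)

lemma self_mem_cls: "f \<in> cls f"
  unfolding cls_eq using tate_0 by force

lemma cls_subset: "f \<in> carrier tate \<Longrightarrow> f' \<in> cls f \<Longrightarrow> f' \<in> carrier tate"
  by (auto simp: cls_eq intro!: tate_add tate_mult tate_gen)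

lemma cls_eqI:
  assumes "f' - f \<in> IX"
  shows "cls f' = cls f"
proof -
  obtain h where h: "h \<in> carrier tate" "f' = h * gen + f"
    using assms by (auto simp: X_ideal_eq) (metis diff_add_cancel)
  show ?thesis
    unfolding cls_eq
  proof (rule subset_antisym; rule subsetI)
    fix x assume "x \<in> {h * gen + f' |h. h \<in> carrier tate}"
    then obtain h' where h': "h' \<in> carrier tate" "x = h' * gen + f'" by blast
    then have "x = (h' + h) * gen + f" by (simp add: h algebra_simps)
    then show "x \<in> {h * gen + f |h. h \<in> carrier tate}" using tate_add[OF h'(1) h(1)] by blast
  next
    fix x assume "x \<in> {h * gen + f |h. h \<in> carrier tate}"
    then obtain h' where h': "h' \<in> carrier tate" "x = h' * gen + f" by blast
    then have "x = (h' - h) * gen + f'" by (simp add: h algebra_simps)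
    then show "x \<in> {h * gen + f' |h. h \<in> carrier tate}" using tate_diff[OF h'(1) h(1)] by blast
  qed
qed

lemma cls_mem: "f' \<in> cls f \<Longrightarrow> cls f' = cls f"
  by (rule cls_eqI) (auto simp: cls_eq mem_I)

lemma cls_eqD: "cls f' = cls f \<Longrightarrow> \<exists>h\<in>carrier tate. f' - f = h * gen"
  using self_mem_cls[of f'] by (auto simp: cls_eq)

lemma carrier_O: "carrier OX = cls ` carrier tate"
  by (auto simp: O_X_def FactRing_def A_RCOSETS_def' X_class_def a_r_coset_def)

lemma cls_closed: "f \<in> carrier tate \<Longrightarrow> cls f \<in> carrier OX"
  by (simp add: carrier_O)

lemma cls_hom: "cls \<in> ring_hom tate OX"
  using ideal.rcos_ring_hom[OF ideal_I] by (simp add: X_class_def[abs_def] O_X_def)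

lemma cring_O: "cring OX"
  unfolding O_X_def by (rule ideal.quotient_is_cring[OF ideal_I cring_tate])

lemma cls_mult: "f \<in> carrier tate \<Longrightarrow> g \<in> carrier tate \<Longrightarrow> cls f \<otimes>\<^bsub>OX\<^esub> cls g = cls (f * g)"
  using ring_hom_mult[OF cls_hom] by simp

lemma cls_add: "f \<in> carrier tate \<Longrightarrow> g \<in> carrier tate \<Longrightarrow> cls f \<oplus>\<^bsub>OX\<^esub> cls g = cls (f + g)"
  using ring_hom_add[OF cls_hom] by simp

lemma zero_O: "\<zero>\<^bsub>OX\<^esub> = cls 0"
  by (auto simp: O_X_def FactRing_def cls_eq X_ideal_eq)

lemma cls_minus:
  assumes "f \<in> carrier tate" "g \<in> carrier tate"
  shows "cls f \<ominus>\<^bsub>OX\<^esub> cls g = cls (f - g)"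
proof -
  interpret cring OX by (rule cring_O)
  have "cls (f - g) \<oplus>\<^bsub>OX\<^esub> cls g = cls f"
    using assms by (simp add: cls_add tate_diff)
  then show ?thesis
    using assms by (metis cls_closed tate_diff add.inv_solve_right' minus_eq)
qed

lemma cls_finsum:
  assumes "finite A" "\<And>i. i \<in> A \<Longrightarrow> f i \<in> carrier tate"
  shows "(\<Oplus>\<^bsub>OX\<^esub>i\<in>A. cls (f i)) = cls (\<Sum>i\<in>A. f i)"
proof -
  interpret cring OX by (rule cring_O)
  show ?thesis
    using assms
    by (induction A rule: finite_induct)
       (simp_all add: zero_O cls_closed cls_add tate_sum Pi_def)
qed

lemma cls_add_pow: "f \<in> carrier tate \<Longrightarrow> [(n::nat)] \<cdot>\<^bsub>OX\<^esub> cls f = cls (of_nat n * f)"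
proof -
  interpret cring OX by (rule cring_O)
  assume f: "f \<in> carrier tate"
  show ?thesis
  proof (induction n)
    case 0
    then show ?case by (simp add: zero_O)
  next
    case (Suc n)
    then show ?case using f
      by (simp add: cls_add tate_mult tate_of_nat algebra_simps)
  qed
qed

section \<open>The residue norm and infinite sums\<close>

lemma av_le_gauss_norm:
  assumes "f \<in> carrier tate"
  shows "av (coeff2 f i j) \<le> gauss_norm av f"
proof -
  obtain M where M: "\<And>i j. av (coeff2 f i j) \<le> M" using tate_bounded[OF assms] by metis
  have "(\<lambda>(i, j). av (coeff2 f i j)) (i, j) \<le> (SUP (i, j). av (coeff2 f i j))"
  proof (rule cSUP_upper[OF UNIV_I], rule bdd_aboveI)
    show "x \<le> M" if "x \<in> range (\<lambda>(i, j). av (coeff2 f i j))" for x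
      using that M by auto
  qed
  then show ?thesis by (simp add: gauss_norm_def)
qed

lemma gauss_norm_nonneg: "f \<in> carrier tate \<Longrightarrow> 0 \<le> gauss_norm av f"
  using av_le_gauss_norm[of f 0 0] av_nonneg order_trans by blast

lemma gauss_norm_0: "gauss_norm av 0 = 0"
  by (simp add: gauss_norm_def case_prod_unfold)

lemma X_norm_bdd: "f \<in> carrier tate \<Longrightarrow> bdd_below (gauss_norm av ` cls f)"
  using gauss_norm_nonneg cls_subset by (intro bdd_belowI[of _ 0]) auto

lemma X_norm_nonneg: "f \<in> carrier tate \<Longrightarrow> 0 \<le> X_norm av (cls f)"
  unfolding X_norm_def using self_mem_cls[of f] gauss_norm_nonneg cls_subset
  by (intro cINF_greatest) auto

lemma X_norm_zero: "X_norm av (cls 0) = 0"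
proof (rule antisym)
  have "X_norm av (cls 0) \<le> gauss_norm av 0"
    unfolding X_norm_def by (rule cINF_lower[OF X_norm_bdd[OF tate_0] self_mem_cls])
  then show "X_norm av (cls 0) \<le> 0" by (simp add: gauss_norm_0)
qed (rule X_norm_nonneg[OF tate_0])

lemma X_norm_representative:
  assumes "f \<in> carrier tate" "0 < \<epsilon>"
  obtains f' where "f' \<in> carrier tate" "cls f' = cls f" "gauss_norm av f' < X_norm av (cls f) + \<epsilon>"
proof -
  have "Inf (gauss_norm av ` cls f) < X_norm av (cls f) + \<epsilon>"
    using assms by (simp add: X_norm_def)
  then obtain f' where "f' \<in> cls f" "gauss_norm av f' < X_norm av (cls f) + \<epsilon>"
    using cInf_lessD[of "gauss_norm av ` cls f"] self_mem_cls by blast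
  then show thesis using that cls_subset[OF assms(1)] cls_mem by blast
qed

text \<open>The formal inverse of \<open>1 - (x\<^bsup>q-1\<^esup> - 1) y\<close> has integral coefficients, so a limit of multiples
  of the generator is again a multiple: the ideal is closed.\<close>

lemma X_norm_eq_0:
  assumes f: "f \<in> carrier tate" and "X_norm av (cls f) = 0"
  shows "cls f = cls 0"
proof -
  define a :: "'k fps" where "a = fps_X ^ (q - 1) - 1"
  define ginv :: "'k fps2" where "ginv = Abs_fps (\<lambda>j. a ^ j)"
  have a_int: "av (fps_nth (a ^ j) i) \<le> 1" for i j
  proof -
    have "gbound 1 (1 ^ j) (fps_nth (a ^ j))"
    proof (induction j)
      case (Suc j)
      have "gbound 1 1 (fps_nth a)"
        by (auto simp: gbound1_iff a_def fps_X_power_iff)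
      then have "gbound 1 (1 * 1 ^ j) (fps_nth (a * a ^ j))"
        using Suc by (intro gbound_fps_mult) auto
      then show ?case by simp
    qed (auto simp: gbound1_iff)
    then show ?thesis by (simp add: gbound1_iff)
  qed
  have gen_a: "gen = fps_const a * fps_X - 1"
    by (simp add: gen_def varx_def vary_def a_def fps_const_power)
  have gen_ginv: "gen * ginv = - 1"
  proof (rule fps_ext)
    fix j
    show "fps_nth (gen * ginv) j = fps_nth (- 1) j"
      by (cases j) (simp_all add: gen_a ginv_def algebra_simps mult.assoc)
  qed
  \<comment> \<open>The formal quotient of \<open>f\<close> by \<open>gen\<close>; it remains to
    show that its coefficients tend to 0.\<close>
  define h where "h = - (f * ginv)"
  have fh: "f = h * gen"
  proof -
    have "h * gen = - (f * (gen * ginv))" by (simp add: h_def mult_ac)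
    then show ?thesis by (simp add: gen_ginv)
  qed
  have "h \<in> carrier tate"
  proof (rule tateI)
    fix \<epsilon> :: real assume \<epsilon>: "0 < \<epsilon>"
    obtain f' where f': "f' \<in> carrier tate" "cls f' = cls f" "gauss_norm av f' < \<epsilon>"
      using X_norm_representative[OF f \<epsilon>] assms(2) by auto
    obtain u where u: "u \<in> carrier tate" "f' - f = u * gen" using cls_eqD[OF f'(2)] by blast
    \<comment> \<open>Adding \<open>u\<close> replaces \<open>f\<close> by the small representative
      \<open>f'\<close>. As \<open>ginv\<close> is integral, \<open>h\<close> agrees with
      \<open>- u\<close> up to less than \<open>\<epsilon>\<close>.\<close>
    have hu: "h + u = - (f' * ginv)"
    proof -
      have "- (f' * ginv) = - ((f + u * gen) * ginv)" using u(2) by (simp add: algebra_simps)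
      also have "\<dots> = h - u * (gen * ginv)" by (simp add: h_def algebra_simps)
      finally show ?thesis by (simp add: gen_ginv)
    qed
    have small: "av (coeff2 (h + u) i j) < \<epsilon>" for i j
    proof -
      have "av (coeff2 (f' * ginv) i j) \<le> gauss_norm av f'"
        unfolding fps_mult_nth fps_sum_nth
      proof (intro av_sum_le)
        fix b c
        have "av (coeff2 f' c b) * av (coeff2 ginv (i - c) (j - b)) \<le> gauss_norm av f' * 1"
          using av_le_gauss_norm[OF f'(1)] a_int gauss_norm_nonneg[OF f'(1)]
          by (intro mult_mono) (auto simp: ginv_def)
        then show "av (coeff2 f' c b * coeff2 ginv (i - c) (j - b)) \<le> gauss_norm av f'"
          by (simp add: av_mult)
      qed (use gauss_norm_nonneg[OF f'(1)] in auto)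
      then show ?thesis using f'(3) by (simp add: hu)
    qed
    have "{(i, j). \<epsilon> \<le> av (coeff2 h i j)} \<subseteq> {(i, j). \<epsilon> \<le> av (coeff2 u i j)}"
    proof clarify
      fix i j assume "\<epsilon> \<le> av (coeff2 h i j)"
      then show "\<epsilon> \<le> av (coeff2 u i j)"
        using small[of j i] av_diff[of "coeff2 (h + u) i j" "coeff2 u i j"] by simp
    qed
    then show "finite {(i, j). \<epsilon> \<le> av (coeff2 h i j)}"
      using tateD[OF u(1) \<epsilon>] finite_subset by blast
  qed
  then show ?thesis
    using fh mem_I by (intro cls_eqI) simp
qed

text \<open>The partial sums are eventually constant. As the limit is a definite description, its
  uniqueness is needed too, and this is the fact that only the zero class has norm 0.\<close>

lemma X_suminf_finite:
  assumes e: "\<And>i. e i \<in> carrier tate" and vanish: "\<And>i. M \<le> i \<Longrightarrow> cls (e i) = cls 0"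
  shows "X_suminf av q (\<lambda>i. cls (e i)) = cls (\<Sum>i<M. e i)"
proof -
  interpret cring OX by (rule cring_O)
  have part: "(\<Oplus>\<^bsub>OX\<^esub>i\<in>{..<n}. cls (e i)) = cls (\<Sum>i<M. e i)" if "M \<le> n" for n
    using that
  proof (induction n rule: dec_induct)
    case base
    then show ?case by (simp add: cls_finsum e)
  next
    case (step n)
    have "(\<Oplus>\<^bsub>OX\<^esub>i\<in>{..<Suc n}. cls (e i)) = cls (e n) \<oplus>\<^bsub>OX\<^esub> (\<Oplus>\<^bsub>OX\<^esub>i\<in>{..<n}. cls (e i))"
      by (simp add: lessThan_Suc cls_closed e Pi_def)
    also have "\<dots> = cls (\<Sum>i<M. e i)"
      using step vanish[of n] by (simp add: cls_add tate_0 tate_sum e)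
    finally show ?case .
  qed
  have S: "(\<Sum>i<M. e i) \<in> carrier tate" by (intro tate_sum e)
  show ?thesis
    unfolding X_suminf_def
  proof (rule the_equality)
    have "X_norm av ((\<Oplus>\<^bsub>OX\<^esub>i\<in>{..<n}. cls (e i)) \<ominus>\<^bsub>OX\<^esub> cls (\<Sum>i<M. e i)) = 0" if "M \<le> n" for n
      unfolding part[OF that] cls_minus[OF S S] by (simp add: X_norm_zero)
    then have "(\<lambda>n. X_norm av ((\<Oplus>\<^bsub>OX\<^esub>i\<in>{..<n}. cls (e i)) \<ominus>\<^bsub>OX\<^esub> cls (\<Sum>i<M. e i))) \<longlonglongrightarrow> 0"
      by (intro tendsto_eventually) (auto simp: eventually_sequentially)
    then show "cls (\<Sum>i<M. e i) \<in> carrier OX \<and>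
      (\<lambda>n. X_norm av ((\<Oplus>\<^bsub>OX\<^esub>i\<in>{..<n}. cls (e i)) \<ominus>\<^bsub>OX\<^esub> cls (\<Sum>i<M. e i))) \<longlonglongrightarrow> 0"
      using S cls_closed by blast
  next
    fix s assume s: "s \<in> carrier OX \<and> (\<lambda>n. X_norm av ((\<Oplus>\<^bsub>OX\<^esub>i\<in>{..<n}. cls (e i)) \<ominus>\<^bsub>OX\<^esub> s)) \<longlonglongrightarrow> 0"
    then obtain t where t: "t \<in> carrier tate" "s = cls t" by (auto simp: carrier_O)
    have "eventually (\<lambda>n. X_norm av ((\<Oplus>\<^bsub>OX\<^esub>i\<in>{..<n}. cls (e i)) \<ominus>\<^bsub>OX\<^esub> s)
        = X_norm av (cls ((\<Sum>i<M. e i) - t))) sequentially"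
      unfolding eventually_sequentially
      by (intro exI[of _ M] allI impI) (simp add: part t cls_minus S)
    then have "(\<lambda>n::nat. X_norm av (cls ((\<Sum>i<M. e i) - t))) \<longlonglongrightarrow> 0"
      using s by (simp cong: tendsto_cong)
    then have "X_norm av (cls ((\<Sum>i<M. e i) - t)) = 0"
      by (simp add: LIMSEQ_const_iff)
    then have "cls ((\<Sum>i<M. e i) - t) = cls 0"
      by (intro X_norm_eq_0 tate_diff S t)
    then obtain h where "h \<in> carrier tate" "(\<Sum>i<M. e i) - t = h * gen"
      using cls_eqD[of "(\<Sum>i<M. e i) - t" 0] by auto
    then have "cls (\<Sum>i<M. e i) = cls t" by (intro cls_eqI) (simp add: mem_I)
    then show "s = cls (\<Sum>i<M. e i)" by (simp add: t)
  qed
qed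

section \<open>The derivation and products of operators\<close>

lemma ddx2_add: "ddx2 q (f + g) = ddx2 q f + ddx2 q g"
  by (simp add: ddx2_def fps_eq_iff algebra_simps)

lemma ddx2_mult: "ddx2 q (f * g) = ddx2 q f * g + f * ddx2 q g" for f g :: "'k fps2"
proof -
  have "Abs_fps (\<lambda>j. fps_deriv (fps_nth (f * g) j))
      = Abs_fps (\<lambda>j. fps_deriv (fps_nth f j)) * g + f * Abs_fps (\<lambda>j. fps_deriv (fps_nth g j))"
    by (rule fps_ext) (simp add: fps_mult_nth fps_deriv_sum sum.distrib add.commute)
  then show ?thesis by (simp add: ddx2_def algebra_simps)
qed

lemma ddx2_const: "ddx2 q (fps_const u) = fps_const (fps_deriv u)" for u :: "'k fps"
  by (rule fps_ext) (simp add: ddx2_def)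

lemma ddx2_gen: "ddx2 q gen = - (of_nat (q - 1) * varx ^ (q - 2) * vary) * gen"
proof -
  obtain m where m: "q = Suc (Suc m)" using q_ge_2 by (metis Suc_le_D add_2_eq_Suc le_Suc_ex)
  define N :: "'k fps2" where "N = of_nat (q - 1) * varx ^ (q - 2)"
  define a :: "'k fps2" where "a = varx ^ (q - 1) - 1"
  have a: "a = fps_const (fps_X ^ (q - 1) - 1)" by (simp add: a_def varx_def fps_const_power)
  have "fps_deriv (fps_X ^ (q - 1) - 1 :: 'k fps) = of_nat (q - 1) * fps_X ^ (q - 2)"
    by (rule fps_ext, simp add: m fps_of_nat[symmetric] fps_X_power_iff del: of_nat_Suc)
       (simp add: add.commute)
  then have da: "ddx2 q a = N"
    unfolding a ddx2_const by (simp add: N_def varx_def fps_const_power fps_of_nat[symmetric] del: of_nat_Suc)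
  have "ddx2 q vary = - N * vary ^ 2"
  proof -
    have "Abs_fps (\<lambda>j. fps_deriv (fps_nth (vary :: 'k fps2) j)) = 0"
      by (rule fps_ext) (simp add: vary_def fps_X_def)
    moreover have "fps_deriv (vary :: 'k fps2) = 1" by (simp add: vary_def)
    ultimately show ?thesis by (simp only: ddx2_def N_def) simp
  qed
  moreover have "ddx2 q (- 1 :: 'k fps2) = 0"
    using ddx2_const[of "- 1"] by (simp flip: fps_const_neg)
  ultimately have "ddx2 q (a * vary + - 1) = N * vary + a * (- N * vary ^ 2)"
    by (simp only: ddx2_add ddx2_mult da) simp
  also have "\<dots> = - (N * vary) * (a * vary + - 1)"
    by (simp add: algebra_simps power2_eq_square)
  finally show ?thesis unfolding gen_def a_def[symmetric] by (simp add: N_def)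
qed

lemma tate_ddx2:
  assumes f: "f \<in> carrier tate"
  shows "ddx2 q f \<in> carrier tate"
proof -
  have 1: "Abs_fps (\<lambda>j. fps_deriv (fps_nth f j)) \<in> carrier tate"
  proof (rule tateI)
    fix \<epsilon> :: real assume \<epsilon>: "0 < \<epsilon>"
    have "{(i, j). \<epsilon> \<le> av (coeff2 (Abs_fps (\<lambda>j. fps_deriv (fps_nth f j))) i j)}
        \<subseteq> (\<lambda>(i, j). (i - 1, j)) ` {(i, j). \<epsilon> \<le> av (coeff2 f i j)}"
    proof clarify
      fix i j assume "\<epsilon> \<le> av (coeff2 (Abs_fps (\<lambda>j. fps_deriv (fps_nth f j))) i j)"
      then have "\<epsilon> \<le> av (of_nat (Suc i)) * av (coeff2 f (Suc i) j)"
        by (simp add: av_mult[symmetric] del: of_nat_Suc) 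
      also have "\<dots> \<le> av (coeff2 f (Suc i) j)"
        by (intro mult_left_le_one_le av_of_nat_le_1) auto
      finally show "(i, j) \<in> (\<lambda>(i, j). (i - 1, j)) ` {(i, j). \<epsilon> \<le> av (coeff2 f i j)}"
        by (intro image_eqI[of _ _ "(Suc i, j)"]) auto
    qed
    then show "finite {(i, j). \<epsilon> \<le> av (coeff2 (Abs_fps (\<lambda>j. fps_deriv (fps_nth f j))) i j)}"
      using tateD[OF f \<epsilon>] finite_subset by blast
  qed
  have 2: "fps_deriv f \<in> carrier tate"
  proof (rule tateI)
    fix \<epsilon> :: real assume \<epsilon>: "0 < \<epsilon>"
    have "{(i, j). \<epsilon> \<le> av (coeff2 (fps_deriv f) i j)}
        \<subseteq> (\<lambda>(i, j). (i, j - 1)) ` {(i, j). \<epsilon> \<le> av (coeff2 f i j)}"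
    proof clarify
      fix i j assume "\<epsilon> \<le> av (coeff2 (fps_deriv f) i j)"
      moreover have "coeff2 (fps_deriv f) i j = of_nat (Suc j) * coeff2 f i (Suc j)"
        by (simp add: fps_of_nat[symmetric] del: of_nat_Suc)
      ultimately have "\<epsilon> \<le> av (of_nat (Suc j)) * av (coeff2 f i (Suc j))"
        by (simp only: av_mult)
      also have "\<dots> \<le> av (coeff2 f i (Suc j))"
        by (intro mult_left_le_one_le av_of_nat_le_1) auto
      finally show "(i, j) \<in> (\<lambda>(i, j). (i, j - 1)) ` {(i, j). \<epsilon> \<le> av (coeff2 f i j)}"
        by (intro image_eqI[of _ _ "(i, Suc j)"]) auto
    qed
    then show "finite {(i, j). \<epsilon> \<le> av (coeff2 (fps_deriv f) i j)}"
      using tateD[OF f \<epsilon>] finite_subset by blast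
  qed
  show ?thesis
    unfolding ddx2_def
    by (intro tate_diff tate_mult tate_power tate_of_nat tate_varx tate_vary 1 2)
qed

lemma X_deriv_cls:
  assumes f: "f \<in> carrier tate"
  shows "X_deriv av q (cls f) = cls (ddx2 q f)"
proof -
  have "cls (ddx2 q f') = cls (ddx2 q f)" if f': "f' \<in> cls f" for f'
  proof -
    obtain h where h: "h \<in> carrier tate" "f' = h * gen + f" using f' unfolding cls_eq by blast
    have "ddx2 q f' - ddx2 q f = (ddx2 q h + h * - (of_nat (q - 1) * varx ^ (q - 2) * vary)) * gen"
      by (simp add: h ddx2_add ddx2_mult ddx2_gen algebra_simps)
    moreover have "ddx2 q h + h * - (of_nat (q - 1) * varx ^ (q - 2) * vary) \<in> carrier tate"
      by (intro tate_add tate_ddx2 h tate_mult tate_uminus tate_of_nat tate_power tate_varx tate_vary)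
    ultimately show ?thesis by (intro cls_eqI) (simp add: mem_I)
  qed
  then have "X_deriv av q (cls f) = (\<Union>f'\<in>cls f. cls (ddx2 q f))"
    unfolding X_deriv_def by (intro SUP_cong refl)
  also have "\<dots> = cls (ddx2 q f)"
    using self_mem_cls[of f] by (subst UN_constant) (metis empty_iff)
  finally show ?thesis .
qed

lemma X_deriv_power_poly:
  "(X_deriv av q ^^ m) (cls (fps_const (fps_of_poly u))) = cls (fps_const (fps_of_poly ((pderiv ^^ m) u)))"
  by (induction m)
     (simp_all add: X_deriv_cls tate_fps_const_poly ddx2_const fps_of_poly_pderiv)

text \<open>For a right factor whose coefficients \<open>V l\<close> are polynomials in \<open>x\<close>, the series defining the
  product of operators terminates.\<close>

definition op_prod_coeff :: "(nat \<Rightarrow> 'k poly) \<Rightarrow> nat \<Rightarrow> nat \<Rightarrow> 'k poly" where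
  "op_prod_coeff V n i = (\<Sum>m\<in>{m. m \<le> i \<and> i \<le> n + m}. of_nat (i choose m) * (pderiv ^^ m) (V (n + m - i)))"

lemma D_mult_cls:
  assumes e: "\<And>i. e i \<in> carrier tate"
    and zero: "\<And>i. M \<le> i \<Longrightarrow> op_prod_coeff V n i = 0"
  shows "D_mult av q (\<lambda>i. cls (e i)) (\<lambda>l. cls (fps_const (fps_of_poly (V l)))) n
    = cls (\<Sum>i<M. e i * fps_const (fps_of_poly (op_prod_coeff V n i)))"
proof -
  have "cls (e i) \<otimes>\<^bsub>OX\<^esub> (\<Oplus>\<^bsub>OX\<^esub>m\<in>{m. m \<le> i \<and> i \<le> n + m}.
      [(i choose m)] \<cdot>\<^bsub>OX\<^esub> (X_deriv av q ^^ m) (cls (fps_const (fps_of_poly (V (n + m - i))))))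
    = cls (e i * fps_const (fps_of_poly (op_prod_coeff V n i)))" for i
  proof -
    have "(\<Oplus>\<^bsub>OX\<^esub>m\<in>{m. m \<le> i \<and> i \<le> n + m}.
      [(i choose m)] \<cdot>\<^bsub>OX\<^esub> (X_deriv av q ^^ m) (cls (fps_const (fps_of_poly (V (n + m - i))))))
      = (\<Oplus>\<^bsub>OX\<^esub>m\<in>{m. m \<le> i \<and> i \<le> n + m}.
          cls (fps_const (fps_of_poly (of_nat (i choose m) * (pderiv ^^ m) (V (n + m - i))))))"
    proof -
      have "[(i choose m)] \<cdot>\<^bsub>OX\<^esub> (X_deriv av q ^^ m) (cls (fps_const (fps_of_poly (V (n + m - i)))))
        = cls (fps_const (fps_of_poly (of_nat (i choose m) * (pderiv ^^ m) (V (n + m - i)))))" for m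
        by (simp add: X_deriv_power_poly cls_add_pow tate_fps_const_poly fps_of_poly_mult fps_of_poly_of_nat
            fps_of_nat fps_const_mult[symmetric] del: fps_const_mult)
      then show ?thesis by simp
    qed
    also have "\<dots> = cls (fps_const (fps_of_poly (op_prod_coeff V n i)))"
    proof -
      have fin: "finite {m. m \<le> i \<and> i \<le> n + m}" by (rule finite_subset[of _ "{..i}"]) auto
      have const_sum: "(\<Sum>m\<in>A. fps_const (fps_of_poly (g m))) = fps_const (fps_of_poly (\<Sum>m\<in>A. g m))"
        if "finite A" for g :: "nat \<Rightarrow> 'k poly" and A
        using that by (induction A rule: finite_induct) (simp_all add: fps_of_poly_add)
      show ?thesis
        by (simp only: cls_finsum[OF fin tate_fps_const_poly] const_sum[OF fin] op_prod_coeff_def)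
    qed
    finally show ?thesis by (simp add: cls_mult e tate_fps_const_poly)
  qed
  then have "D_mult av q (\<lambda>i. cls (e i)) (\<lambda>l. cls (fps_const (fps_of_poly (V l)))) n
    = X_suminf av q (\<lambda>i. cls (e i * fps_const (fps_of_poly (op_prod_coeff V n i))))"
    by (simp add: D_mult_def)
  also have "\<dots> = cls (\<Sum>i<M. e i * fps_const (fps_of_poly (op_prod_coeff V n i)))"
    by (rule X_suminf_finite) (auto intro: tate_mult e tate_fps_const_poly simp: zero)
  finally show ?thesis .
qed

end

section \<open>Expansion at the origin\<close>

lemma (in nonarch_field) gbound_fps_sum:
  "(\<And>i. i \<in> A \<Longrightarrow> gbound 1 C (fps_nth (f i))) \<Longrightarrow> 0 \<le> C \<Longrightarrow> gbound 1 C (fps_nth (sum f A))"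
  by (auto simp: gbound1_iff fps_sum_nth intro!: av_sum_le)

lemma (in nonarch_field) higher_pderiv_eq_0:
  "Polynomial.degree u < m \<Longrightarrow> (pderiv ^^ m) u = (0 :: 'k poly)"
  by (simp add: poly_eq_iff coeff_higher_pderiv coeff_eq_0)

locale affinoid_padic = affinoid av q + padic_abs av p
  for av :: "'k::field_char_0 \<Rightarrow> real" and q p :: nat +
  fixes \<pi> :: 'k
  assumes p_dvd_q: "p dvd q" and pi_nonzero: "\<pi> \<noteq> 0" and av_pi_less_1: "av \<pi> < 1"
begin

text \<open>The power series of \<open>1 / (x ^ (q - 1) - 1)\<close> at 0. Its coefficients are
  integral, so substituting it for the second variable does not increase Gauss norms.\<close>

definition yinv :: "'k fps" where
  "yinv = Abs_fps (\<lambda>n. if (q - 1) dvd n then - 1 else 0)"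

lemma yinv_inverse: "(fps_X ^ (q - 1) - 1) * yinv = 1"
proof (rule fps_ext)
  fix n
  have q: "0 < q - 1" using q_ge_2 by simp
  show "fps_nth ((fps_X ^ (q - 1) - 1) * yinv) n = fps_nth 1 n"
  proof (cases "n < q - 1")
    case True
    then show ?thesis
      by (auto simp: left_diff_distrib fps_X_power_mult_nth yinv_def dest: dvd_imp_le)
  next
    case False
    then have "(q - 1) dvd (n - (q - 1)) \<longleftrightarrow> (q - 1) dvd n"
      by (simp add: dvd_minus_self)
    then show ?thesis using False q
      by (auto simp: left_diff_distrib fps_X_power_mult_nth yinv_def)
  qed
qed

lemma gbound_yinv_power: "gbound 1 1 (fps_nth (yinv ^ j))"
proof (induction j)
  case (Suc j)
  have "gbound 1 1 (fps_nth yinv)" by (simp add: gbound1_iff yinv_def)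
  from gbound_fps_mult[OF this Suc] show ?case by simp
qed (simp add: gbound1_iff)

text \<open>The expansion at the origin, \<open>y = 1 / (x\<^bsup>q-1\<^esup> - 1) = - (1 + x\<^bsup>q-1\<^esup> + \<dots>)\<close>, cut off at the power
  \<open>y\<^bsup>J\<^esup>\<close>; on the ideal it vanishes up to the last term of a telescoping sum.\<close>

definition expand :: "nat \<Rightarrow> 'k fps2 \<Rightarrow> 'k fps" where
  "expand J f = (\<Sum>j<J. fps_nth f j * yinv ^ j)"

lemma expand_add: "expand J (f + g) = expand J f + expand J g"
  by (simp add: expand_def sum.distrib algebra_simps)

lemma expand_diff: "expand J (f - g) = expand J f - expand J g"
  by (simp add: expand_def sum_subtractf algebra_simps)

lemma expand_sum: "expand J (sum f A) = (\<Sum>i\<in>A. expand J (f i))"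
  by (induction A rule: infinite_finite_induct) (simp_all add: expand_add, simp_all add: expand_def)

lemma expand_mult_const: "expand J (f * fps_const u) = expand J f * u"
  unfolding expand_def by (subst sum_distrib_right) (simp add: mult_ac)

lemma expand_const: "expand (Suc J) (fps_const u) = u"
  unfolding expand_def by (subst sum.lessThan_Suc_shift) simp

text \<open>Each step of the telescoping uses that \<open>yinv\<close> is inverse to
  \<open>x ^ (q - 1) - 1\<close>. What is left involves only column \<open>J\<close> of
  \<open>h\<close>, which is small for suitable \<open>J\<close>; congruences modulo
  \<open>gen\<close> thus become approximate identities of power series.\<close>

lemma expand_gen: "expand (Suc J) (h * gen) = - (fps_nth h J * yinv ^ J)"
proof (induction J)
  case 0
  then show ?case by (simp add: expand_def gen_def vary_def)
next
  case (Suc J)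
  define a :: "'k fps" where "a = fps_X ^ (q - 1) - 1"
  have gen: "gen = fps_const a * fps_X - 1"
    by (simp add: gen_def varx_def vary_def a_def fps_const_power)
  have "h * gen = h * fps_const a * fps_X - h"
    by (simp add: gen algebra_simps)
  then have "fps_nth (h * gen) (Suc J) = fps_nth h J * a - fps_nth h (Suc J)"
    by simp
  then have "expand (Suc (Suc J)) (h * gen)
      = - (fps_nth h J * yinv ^ J) + (fps_nth h J * a - fps_nth h (Suc J)) * yinv ^ Suc J"
    using Suc by (simp add: expand_def)
  also have "\<dots> = - (fps_nth h J * yinv ^ J) + fps_nth h J * yinv ^ J * (a * yinv) - fps_nth h (Suc J) * yinv ^ Suc J"
    by (simp add: algebra_simps)
  finally show ?case by (simp only: yinv_inverse[folded a_def]) simp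
qed

lemma gbound_expand:
  assumes "f \<in> carrier tate"
  shows "gbound 1 (gauss_norm av f) (fps_nth (expand J f))"
  unfolding expand_def
proof (rule gbound_fps_sum)
  fix j
  have "gbound 1 (gauss_norm av f) (fps_nth (fps_nth f j))"
    using av_le_gauss_norm[OF assms] by (simp add: gbound1_iff)
  from gbound_fps_mult[OF this gbound_yinv_power]
  show "gbound 1 (gauss_norm av f) (fps_nth (fps_nth f j * yinv ^ j))" by simp
qed (rule gauss_norm_nonneg[OF assms])

section \<open>The substitution of \<open>\<pi> y\<close> for \<open>x\<close>\<close>

definition dilate :: "'k fps \<Rightarrow> 'k fps" where
  "dilate u = Abs_fps (\<lambda>n. \<pi> ^ n * fps_nth u n)"

lemma dilate_diff: "dilate (u - v) = dilate u - dilate v"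
  by (simp add: dilate_def fps_eq_iff algebra_simps)

lemma dilate_sum: "dilate (sum f A) = (\<Sum>i\<in>A. dilate (f i))"
  by (simp add: dilate_def fps_eq_iff fps_sum_nth sum_distrib_left)

lemma dilate_mult: "dilate (u * v) = dilate u * dilate v"
proof (rule fps_ext)
  fix n
  have "\<pi> ^ n = \<pi> ^ i * \<pi> ^ (n - i)" if "i \<le> n" for i
    using that by (simp flip: power_add)
  then show "fps_nth (dilate (u * v)) n = fps_nth (dilate u * dilate v) n"
    by (auto simp: dilate_def fps_mult_nth sum_distrib_left mult_ac intro!: sum.cong)
qed

lemma dilate_const: "dilate (fps_const c) = fps_const c"
  by (simp add: dilate_def fps_eq_iff)

lemma dilate_fps_of_poly: "dilate (fps_of_poly u) = fps_of_poly (pcompose u [:0, \<pi>:])"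
  by (simp add: dilate_def fps_eq_iff coeff_pcompose_linear)

lemma av_pi_pos: "0 < av \<pi>"
  using pi_nonzero by (simp add: less_le)

text \<open>The unit disc in \<open>x\<close> is the disc of radius \<open>1 / av \<pi>\<close> in
  \<open>y\<close>.\<close>

lemma gbound_dilate: "gbound 1 C (fps_nth u) \<Longrightarrow> gbound (1 / av \<pi>) C (fps_nth (dilate u))"
  using av_pi_pos
  by (auto simp: gbound_def dilate_def av_mult av_power power_divide simp del: av_eq_0_iff)

lemma gbound_fps_const_mult:
  "gbound \<rho> C (fps_nth u) \<Longrightarrow> 0 \<le> \<rho> \<Longrightarrow> gbound \<rho> (av c * C) (fps_nth (fps_const c * u))"
  by (auto simp: gbound_def av_mult mult.assoc intro!: mult_left_mono)

section \<open>Products with R in the rescaled coordinate\<close>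

lemma op_prod_coeff_eq:
  assumes V: "\<And>l. 2 \<le> l \<Longrightarrow> V l = 0"
  shows "op_prod_coeff V n i = (if n \<le> i then of_nat (i choose n) * (pderiv ^^ (i - n)) (V 0) else 0)
    + (if 1 \<le> n \<and> n \<le> Suc i then of_nat (i choose (n - 1)) * (pderiv ^^ (Suc i - n)) (V 1) else 0)"
proof -
  define t where "t m = of_nat (i choose m) * (pderiv ^^ m) (V (n + m - i))" for m
  define S where "S = {m. m \<le> i \<and> i \<le> n + m}"
  define S' where "S' = {m \<in> S. n + m - i < 2}"
  have fin: "finite S" by (rule finite_subset[of _ "{..i}"]) (auto simp: S_def)
  have "op_prod_coeff V n i = sum t S" by (simp add: op_prod_coeff_def t_def S_def)
  also have "\<dots> = sum t S'"
  proof (intro sum.mono_neutral_right ballI fin)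
    fix m assume "m \<in> S - S'"
    then have "2 \<le> n + m - i" by (auto simp: S'_def)
    then show "t m = 0" by (simp add: t_def V)
  qed (auto simp: S'_def)
  finally have 0: "op_prod_coeff V n i = sum t S'" .
  \<comment> \<open>Only \<open>m = i - n\<close>, meeting \<open>V 0\<close>, and
    \<open>m = Suc i - n\<close>, meeting \<open>V 1\<close>, can survive; at the ends of the range
    of \<open>n\<close> one or both of them drop out.\<close>
  consider "n = 0" | "1 \<le> n" "n \<le> i" | "n = Suc i" | "Suc i < n" by linarith
  then show ?thesis
  proof cases
    case 1
    then have "S' = {i}" by (auto simp: S'_def S_def)
    then show ?thesis unfolding 0 using 1 by (simp add: t_def)
  next
    case 2
    then have "S' = {i - n, Suc i - n}" by (auto simp: S'_def S_def)
    moreover have "i - n \<noteq> Suc i - n" using 2 by simp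
    moreover have "n + (Suc i - n) - i = 1" "n + (i - n) - i = 0" using 2 by auto
    moreover have "i choose (Suc i - n) = i choose (n - 1)" "i choose (i - n) = i choose n"
      using 2 binomial_symmetric[of "n - 1" i] binomial_symmetric[of n i] by (simp_all add: Suc_diff_le)
    ultimately show ?thesis unfolding 0 using 2 by (simp add: t_def)
  next
    case 3
    then have "S' = {0}" by (auto simp: S'_def S_def)
    then show ?thesis unfolding 0 using 3 by (simp add: t_def)
  next
    case 4
    then have "S' = {}" by (auto simp: S'_def S_def)
    then show ?thesis unfolding 0 using 4 by simp
  qed
qed

text \<open>The operator R is \<open>\<Delta> d/dx + \<kappa> \<Delta>'\<close> with
  \<open>\<kappa> = k / d\<close>.\<close>

definition R_coeff :: "'k \<Rightarrow> nat \<Rightarrow> 'k poly" where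
  "R_coeff \<kappa> l = (if l = 0 then smult \<kappa> (Polynomial.monom (of_nat q) (q - 1) - [:\<pi> ^ (q - 1):])
     else if l = 1 then Polynomial.monom 1 q - smult (\<pi> ^ (q - 1)) [:0, 1:] else 0)"

abbreviation \<Delta>1 :: "'k poly" where
  "\<Delta>1 \<equiv> Polynomial.monom 1 q - [:0, 1:]"

lemma degree_R_coeff: "Polynomial.degree (R_coeff \<kappa> l) \<le> q"
  using q_ge_2
  by (intro degree_le) (auto simp: R_coeff_def coeff_pCons split: nat.splits)

lemma op_prod_R_coeff_eq_0:
  assumes "n + q < i"
  shows "op_prod_coeff (R_coeff \<kappa>) n i = 0"
proof -
  have "(pderiv ^^ m) (R_coeff \<kappa> l) = 0" if "q < m" for m l
    using degree_R_coeff[of \<kappa> l] that by (intro higher_pderiv_eq_0) auto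
  moreover have "R_coeff \<kappa> l = 0" if "2 \<le> l" for l
    using that by (simp add: R_coeff_def)
  ultimately show ?thesis
    using assms by (subst op_prod_coeff_eq) auto
qed

text \<open>As \<open>\<Delta>(\<pi> y) = \<pi> ^ q (y ^ q - y)\<close> and d/dx contributes
  \<open>1 / \<pi>\<close>, both terms of R carry the same power \<open>\<pi> ^ (q - 1)\<close> in
  the coordinate \<open>y\<close>.\<close>

lemma R_coeff_dilate:
  "pcompose (R_coeff \<kappa> 0) [:0, \<pi>:] = smult (\<pi> ^ (q - 1)) (smult \<kappa> (pderiv \<Delta>1))"
  "pcompose (R_coeff \<kappa> 1) [:0, \<pi>:] = smult (\<pi> ^ q) \<Delta>1"
proof -
  obtain m where m: "q = Suc (Suc m)" using q_ge_2 by (metis add_2_eq_Suc le_Suc_ex)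
  have c: "poly.coeff [:c::'k:] j = (if j = 0 then c else 0)" for c j
    by (simp add: coeff_pCons split: nat.splits)
  have c': "poly.coeff [:0, c::'k:] j = (if j = 1 then c else 0)" for c j
    by (simp add: coeff_pCons split: nat.splits)
  show "pcompose (R_coeff \<kappa> 0) [:0, \<pi>:] = smult (\<pi> ^ (q - 1)) (smult \<kappa> (pderiv \<Delta>1))"
    unfolding R_coeff_def
    by (rule poly_eqI) (auto simp: coeff_pcompose_linear coeff_pderiv m c c' algebra_simps)
  show "pcompose (R_coeff \<kappa> 1) [:0, \<pi>:] = smult (\<pi> ^ q) \<Delta>1"
    unfolding R_coeff_def
    by (rule poly_eqI) (auto simp: coeff_pcompose_linear m c' algebra_simps)
qed

lemma higher_pderiv_dilate:
  "pcompose ((pderiv ^^ m) u) [:0, \<pi>:] = smult (1 / \<pi> ^ m) ((pderiv ^^ m) (pcompose u [:0, \<pi>:]))"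
proof (induction m)
  case (Suc m)
  have "pcompose (pderiv ((pderiv ^^ m) u)) [:0, \<pi>:]
      = smult (1 / \<pi>) (pderiv (pcompose ((pderiv ^^ m) u) [:0, \<pi>:]))"
    using pi_nonzero by (simp add: pderiv_pcompose pderiv_pCons)
  then show ?case
    by (simp add: Suc.IH pderiv_smult mult.commute)
qed simp

text \<open>Change of basis from powers of d/dx to divided derivatives in \<open>y\<close>: the
  factor is \<open>fact n / \<pi> ^ n\<close> for the product and \<open>fact i / \<pi> ^ i\<close>
  for the left factor. Their ratio turns the binomial coefficients into the divided derivatives of
  \<open>op_coeff\<close>.\<close>

lemma scaled_op_prod_coeff:
  "smult (fact n / \<pi> ^ n) (pcompose (op_prod_coeff (R_coeff \<kappa>) n i) [:0, \<pi>:])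
    = smult (fact i * \<pi> ^ (q - 1) / \<pi> ^ i) (op_coeff (smult \<kappa> (pderiv \<Delta>1)) \<Delta>1 n i)"
proof -
  have mult_of_nat: "of_nat c * u = smult (of_nat c) u" for c and u :: "'k poly"
    by (simp add: of_nat_poly)
  have pc_of_nat: "pcompose (of_nat c * u) v = smult (of_nat c) (pcompose u v)" for c and u v :: "'k poly"
    by (simp add: mult_of_nat pcompose_smult)
  have 1: "smult (fact n / \<pi> ^ n) (pcompose (of_nat (i choose n) * (pderiv ^^ (i - n)) (R_coeff \<kappa> 0)) [:0, \<pi>:])
    = smult (fact i * \<pi> ^ (q - 1) / \<pi> ^ i) (hderiv (i - n) (smult \<kappa> (pderiv \<Delta>1)))" if n: "n \<le> i"
  proof -
    have "\<pi> ^ i = \<pi> ^ n * \<pi> ^ (i - n)" using n by (simp flip: power_add)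
    then have "fact n / \<pi> ^ n * (of_nat (i choose n) * (1 / \<pi> ^ (i - n) * (\<pi> ^ (q - 1) * \<kappa>)))
        = fact i * \<pi> ^ (q - 1) / \<pi> ^ i * (inverse (fact (i - n)) * \<kappa>)"
      using n pi_nonzero by (simp add: binomial_fact field_simps)
    then show ?thesis
      by (simp only: pc_of_nat higher_pderiv_dilate R_coeff_dilate higher_pderiv_smult hderiv_def smult_smult)
  qed
  have 2: "smult (fact n / \<pi> ^ n) (pcompose (of_nat (i choose (n - 1)) * (pderiv ^^ (Suc i - n)) (R_coeff \<kappa> 1)) [:0, \<pi>:])
    = smult (fact i * \<pi> ^ (q - 1) / \<pi> ^ i) (smult (of_nat n) (hderiv (Suc i - n) \<Delta>1))" if n: "1 \<le> n" "n \<le> Suc i"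
  proof -
    obtain n' where n': "n = Suc n'" "n' \<le> i" using n by (cases n) auto
    obtain q' where q': "q = Suc q'" using q_ge_2 by (cases q) auto
    have "\<pi> ^ i = \<pi> ^ n' * \<pi> ^ (i - n')" using n' by (simp flip: power_add)
    then have "fact n / \<pi> ^ n * (of_nat (i choose (n - 1)) * (1 / \<pi> ^ (Suc i - n) * \<pi> ^ q))
        = fact i * \<pi> ^ (q - 1) / \<pi> ^ i * (of_nat n * inverse (fact (Suc i - n)))"
      using n' pi_nonzero by (simp add: binomial_fact field_simps q')
    then show ?thesis
      by (simp only: pc_of_nat higher_pderiv_dilate R_coeff_dilate higher_pderiv_smult hderiv_def smult_smult)
  qed
  have 3: "(if 1 \<le> n \<and> n \<le> Suc i then smult (of_nat n) u else 0) = (if n \<le> Suc i then smult (of_nat n) u else 0)" for u :: "'k poly"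
    by auto
  have "op_prod_coeff (R_coeff \<kappa>) n i = (if n \<le> i then of_nat (i choose n) * (pderiv ^^ (i - n)) (R_coeff \<kappa> 0) else 0)
    + (if 1 \<le> n \<and> n \<le> Suc i then of_nat (i choose (n - 1)) * (pderiv ^^ (Suc i - n)) (R_coeff \<kappa> 1) else 0)"
    by (rule op_prod_coeff_eq) (simp add: R_coeff_def)
  then show ?thesis
    using 1 2 unfolding op_coeff_def 3[symmetric]
    by (auto simp only: pcompose_add smult_add_right pcompose_0 smult_0_right split: if_splits)
qed

text \<open>Representatives almost attain the residue norm; the slack
  \<open>1 / (c ^ i * (i + 1))\<close> still tends to 0 after weighting by
  \<open>c ^ i\<close>.\<close>

lemma D_c_representatives:
  assumes "a \<in> D_c av q c" "0 < c"
  obtains e where "\<And>i. e i \<in> carrier tate" "\<And>i. cls (e i) = a i"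
    "(\<lambda>i. gauss_norm av (e i) * c ^ i) \<longlonglongrightarrow> 0"
proof -
  have a: "\<And>i. a i \<in> carrier OX" "(\<lambda>i. X_norm av (a i) * c ^ i) \<longlonglongrightarrow> 0"
    using assms by (auto simp: D_c_def)
  have "\<exists>f. f \<in> carrier tate \<and> cls f = a i \<and> gauss_norm av f < X_norm av (a i) + 1 / (c ^ i * real (Suc i))" for i
  proof -
    obtain f where f: "f \<in> carrier tate" "a i = cls f" using a(1)[of i] by (auto simp: carrier_O)
    have "0 < 1 / (c ^ i * real (Suc i))" using assms(2) by simp
    from X_norm_representative[OF f(1) this] show ?thesis unfolding f(2) by metis
  qed
  then obtain e where e: "\<And>i. e i \<in> carrier tate" "\<And>i. cls (e i) = a i"
    "\<And>i. gauss_norm av (e i) < X_norm av (a i) + 1 / (c ^ i * real (Suc i))"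
    by metis
  have "(\<lambda>i. X_norm av (a i) * c ^ i + 1 / real (Suc i)) \<longlonglongrightarrow> 0 + 0"
    by (intro tendsto_add a) (use LIMSEQ_inverse_real_of_nat in \<open>simp add: inverse_eq_divide\<close>)
  then have lim: "(\<lambda>i. X_norm av (a i) * c ^ i + 1 / real (Suc i)) \<longlonglongrightarrow> 0" by simp
  have "(\<lambda>i. gauss_norm av (e i) * c ^ i) \<longlonglongrightarrow> 0"
  proof (rule tendsto_sandwich[OF _ _ tendsto_const lim])
    show "eventually (\<lambda>i. 0 \<le> gauss_norm av (e i) * c ^ i) sequentially"
      using gauss_norm_nonneg[OF e(1)] assms(2) by auto
    have "gauss_norm av (e i) * c ^ i \<le> X_norm av (a i) * c ^ i + 1 / real (Suc i)" for i
    proof -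
      have "gauss_norm av (e i) * c ^ i \<le> (X_norm av (a i) + 1 / (c ^ i * real (Suc i))) * c ^ i"
        using e(3)[of i] assms(2) by (intro mult_right_mono) auto
      also have "\<dots> = X_norm av (a i) * c ^ i + 1 / real (Suc i)"
        using assms(2) by (simp add: distrib_right)
      finally show ?thesis .
    qed
    then show "eventually (\<lambda>i. gauss_norm av (e i) * c ^ i \<le> X_norm av (a i) * c ^ i + 1 / real (Suc i)) sequentially"
      by (intro always_eventually allI)
  qed
  then show thesis by (rule that[OF e(1) e(2)])
qed

lemma R_op_eq:
  "R_op av q \<pi> d k = (\<lambda>l. cls (fps_const (fps_of_poly (R_coeff (of_nat k / of_nat d) l))))"
proof
  fix l
  have mon: "fps_of_poly (Polynomial.monom c m) = fps_const c * fps_X ^ m" for c :: 'k and m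
    by (simp add: fps_of_poly_monom)
  have ofn: "(of_nat q :: 'k fps2) = fps_const (fps_const (of_nat q))"
    by (simp add: fps_of_nat)
  show "R_op av q \<pi> d k l = cls (fps_const (fps_of_poly (R_coeff (of_nat k / of_nat d) l)))"
    by (auto simp: R_op_def R_coeff_def Delta_def const2_def varx_def ofn mon fps_const_power
        fps_of_poly_smult fps_of_poly_diff fps_of_poly_const fps_of_poly_pCons mult.commute)
qed

text \<open>Only finitely many coefficients of a Tate series reach \<open>\<epsilon>\<close>, so
  finitely many series have a common column free of them.\<close>

lemma small_column:
  fixes N :: nat
  assumes h: "\<And>n. n \<le> N \<Longrightarrow> h n \<in> carrier tate" and \<epsilon>: "0 < \<epsilon>"
  obtains J where "\<And>n i. n \<le> N \<Longrightarrow> av (coeff2 (h n) i J) \<le> \<epsilon>"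
proof -
  define B where "B = (\<Union>n\<le>N. snd ` {(i, j). \<epsilon> \<le> av (coeff2 (h n) i j)})"
  have "finite B" unfolding B_def by (intro finite_UN_I finite_imageI tateD[OF h \<epsilon>]) auto
  then obtain J where J: "J \<notin> B" using ex_new_if_finite[OF infinite_UNIV_nat] by blast
  have "av (coeff2 (h n) i J) \<le> \<epsilon>" if "n \<le> N" for n i
  proof (rule ccontr)
    assume "\<not> av (coeff2 (h n) i J) \<le> \<epsilon>"
    then have "(i, J) \<in> {(i, j). \<epsilon> \<le> av (coeff2 (h n) i j)}" by simp
    then have "J \<in> B" unfolding B_def using that by (intro UN_I[of n] image_eqI[of _ _ "(i, J)"]) auto
    then show False using J by blast
  qed
  then show thesis using that by blast
qed

section \<open>The contradiction for given P and Q\<close>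

theorem beta_not_in_sum:
  assumes complete: "Metric_space.mcomplete UNIV (\<lambda>x y. av (x - y))"
    and q: "\<exists>f. q = p ^ f" and d: "\<not> p dvd d" "1 \<le> k" "k \<le> d"
    and P: "P \<in> D_dagger av q (varpi p / av \<pi>)" and Q: "Q \<in> D_dagger av q (varpi p)"
    and eq: "beta_op av q \<pi> = D_add av q P (D_mult av q Q (R_op av q \<pi> d k))"
  shows False
proof -
  define w where "w = 1 / av \<pi>"
  have w: "1 < w" using av_pi_pos av_pi_less_1 by (simp add: w_def)
  have vp: "0 < varpi p" using p_ge_2 by (simp add: varpi_def)
  define \<kappa> :: 'k where "\<kappa> = of_nat k / of_nat d"
  obtain c where c: "varpi p * w < c" "P \<in> D_c av q c"
    using P by (auto simp: D_dagger_def w_def)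
  obtain c' where c': "varpi p < c'" "Q \<in> D_c av q c'"
    using Q by (auto simp: D_dagger_def)
  have c0: "0 < c" "0 < c'" using c c' vp w by (auto intro: less_trans[OF mult_pos_pos[of "varpi p" w]] less_trans)
  obtain f where f: "\<And>i. f i \<in> carrier tate" "\<And>i. cls (f i) = P i"
    "(\<lambda>i. gauss_norm av (f i) * c ^ i) \<longlonglongrightarrow> 0"
    using D_c_representatives[OF c(2) c0(1)] by blast
  obtain e where e: "\<And>i. e i \<in> carrier tate" "\<And>i. cls (e i) = Q i"
    "(\<lambda>i. gauss_norm av (e i) * c' ^ i) \<longlonglongrightarrow> 0"
    using D_c_representatives[OF c'(2) c0(2)] by blast
  \<comment> \<open>The size of the coefficients of Q with respect to divided derivatives in
    \<open>x\<close>; it tends to 0 because \<open>c'\<close> exceeds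
    \<open>varpi p\<close>.\<close>
  define \<delta> where "\<delta> i = av (fact i) * gauss_norm av (e i)" for i
  have \<delta>0: "0 \<le> \<delta> i" for i
    using gauss_norm_nonneg[OF e(1)] by (simp add: \<delta>_def)
  have \<delta>lim: "\<delta> \<longlonglongrightarrow> 0"
  proof -
    obtain C1 where C1: "0 < C1" "\<And>n. av (fact n) \<le> C1 * c' ^ n" using av_fact_bound[OF c'(1)] by blast
    have lim: "(\<lambda>i. C1 * (gauss_norm av (e i) * c' ^ i)) \<longlonglongrightarrow> 0"
      using tendsto_mult_left[OF e(3), of C1] by simp
    show ?thesis
    proof (rule tendsto_sandwich[OF _ _ tendsto_const lim])
      show "eventually (\<lambda>i. 0 \<le> \<delta> i) sequentially" using \<delta>0 by simp
      have "\<delta> i \<le> C1 * (gauss_norm av (e i) * c' ^ i)" for i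
        using mult_right_mono[OF C1(2)[of i] gauss_norm_nonneg[OF e(1)[of i]]] by (simp add: \<delta>_def mult_ac)
      then show "eventually (\<lambda>i. \<delta> i \<le> C1 * (gauss_norm av (e i) * c' ^ i)) sequentially" by simp
    qed
  qed
  obtain C\<delta> where C\<delta>: "\<And>i. \<delta> i \<le> C\<delta>"
  proof -
    have "Bseq \<delta>" using \<delta>lim by (intro convergent_imp_Bseq convergentI)
    then obtain K where "\<And>n. norm (\<delta> n) \<le> K" by (auto simp: Bseq_def)
    then show thesis using that[of K] by (metis abs_le_D1 real_norm_def)
  qed
  obtain K where K: "0 < K" "\<And>n. gauss_norm av (f n) * c ^ n \<le> K"
  proof -
    have "Bseq (\<lambda>i. gauss_norm av (f i) * c ^ i)" using f(3) by (intro convergent_imp_Bseq convergentI)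
    then obtain K where "0 < K" "\<And>n. norm (gauss_norm av (f n) * c ^ n) \<le> K" by (auto simp: Bseq_def)
    then show thesis using that[of K] by (metis abs_le_D1 real_norm_def)
  qed
  \<comment> \<open>A radius strictly between \<open>varpi p\<close> and \<open>c / w\<close>:
    factorials are bounded by a multiple of \<open>c1 ^ n\<close>, and the ratio
    \<open>c1 * w / c\<close> is below 1.\<close>
  define c1 where "c1 = (varpi p + c / w) / 2"
  have "varpi p < c / w" using c(1) w by (simp add: field_simps)
  moreover have "a < (a + b) / 2 \<and> (a + b) / 2 < b" if "a < b" for a b :: real
    using that by simp
  ultimately have c1: "varpi p < c1 \<and> c1 < c / w" unfolding c1_def by blast
  obtain C1 where C1: "0 < C1" "\<And>n. av (fact n) \<le> C1 * c1 ^ n" using av_fact_bound[OF c1[THEN conjunct1]] by blast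
  define r0 where "r0 = c1 * w / c"
  have r0: "0 < r0" "r0 < 1" using c1 vp w c0 by (auto simp: r0_def field_simps)
  \<comment> \<open>Discs of radius \<open>r\<close> must accommodate the deviations
    \<open>a + 1 - b\<close> of size \<open>1 / p\<close> in \<open>T\<close>.\<close>
  define r where "r = max r0 (1 / real p)"
  have r: "1 / real p \<le> r" "r < 1" "0 \<le> r" "r0 \<le> r"
    using r0 p_ge_2 by (auto simp: r_def)
  define C where "C = max 1 (max C\<delta> (C1 * K))"
  have C: "1 \<le> C" "C\<delta> \<le> C" "C1 * K \<le> C" by (auto simp: C_def)
  have A_bound: "av (fact n) * w ^ n * gauss_norm av (f n) \<le> C * r ^ n" for n
  proof -
    have "gauss_norm av (f n) \<le> K / c ^ n" using K(2)[of n] c0 by (simp add: field_simps)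
    then have "av (fact n) * w ^ n * gauss_norm av (f n) \<le> (C1 * c1 ^ n) * w ^ n * (K / c ^ n)"
      using C1 w gauss_norm_nonneg[OF f(1)] c1 vp by (intro mult_mono) auto
    also have "\<dots> = (C1 * K) * r0 ^ n" by (simp add: r0_def power_mult_distrib power_divide)
    also have "\<dots> \<le> C * r ^ n"
      using C C1 K r0 r by (intro mult_mono power_mono) auto
    finally show ?thesis .
  qed
  have av_d: "av (of_nat d) = 1" using av_of_nat_coprime d by blast
  have \<kappa>1: "av \<kappa> \<le> 1" by (simp add: \<kappa>_def av_divide av_d av_of_nat_le_1)
  define V0 where "V0 = smult \<kappa> (pderiv \<Delta>1)"
  have deg\<Delta>: "Polynomial.degree \<Delta>1 \<le> q"
    using q_ge_2 by (intro degree_diff_le) (auto simp: degree_monom_eq)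
  have \<Delta>b: "pbound 1 1 \<Delta>1"
    by (intro pbound_diff) (auto simp: gbound1_iff coeff_pCons split: nat.splits)
  have V0b: "pbound 1 1 V0"
  proof -
    have "pbound 1 1 (pderiv \<Delta>1)"
      using pbound1_hderiv[OF \<Delta>b, of 1] by (simp add: hderiv_def)
    then show ?thesis unfolding V0_def using \<kappa>1 by (intro pbound_smult_le) auto
  qed
  have degV0: "Polynomial.degree V0 \<le> q"
    unfolding V0_def using deg\<Delta> by (intro order_trans[OF degree_smult_le]) (simp add: degree_pderiv)
  \<comment> \<open>The coefficient of index \<open>n\<close> of the operator equation, lifted to
    the Tate algebra. The sum ends at \<open>n + q\<close> because the coefficients of R have degree
    at most \<open>q\<close>.\<close>
  have "\<exists>h\<in>carrier tate. const2 (\<pi> ^ n / fact n)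
      - (f n + (\<Sum>i<Suc (n + q). e i * fps_const (fps_of_poly (op_prod_coeff (R_coeff \<kappa>) n i)))) = h * gen" for n
  proof -
    have Q': "Q = (\<lambda>i. cls (e i))" using e(2) by auto
    have S: "(\<Sum>i<Suc (n + q). e i * fps_const (fps_of_poly (op_prod_coeff (R_coeff \<kappa>) n i))) \<in> carrier tate"
      by (intro tate_sum tate_mult e tate_fps_const_poly)
    have "beta_op av q \<pi> n = P n \<oplus>\<^bsub>OX\<^esub> D_mult av q Q (R_op av q \<pi> d k) n"
      unfolding eq by (simp add: D_add_def)
    also have "D_mult av q Q (R_op av q \<pi> d k) n
      = cls (\<Sum>i<Suc (n + q). e i * fps_const (fps_of_poly (op_prod_coeff (R_coeff \<kappa>) n i)))"
      unfolding Q' R_op_eq \<kappa>_def[symmetric]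
      by (rule D_mult_cls) (auto intro: e op_prod_R_coeff_eq_0)
    finally have "cls (const2 (\<pi> ^ n / fact n))
      = cls (f n + (\<Sum>i<Suc (n + q). e i * fps_const (fps_of_poly (op_prod_coeff (R_coeff \<kappa>) n i))))"
      by (simp only: beta_op_def f(2)[symmetric] cls_add[OF f(1) S])
    then show ?thesis by (rule cls_eqD)
  qed
  then obtain h where h: "\<And>n. h n \<in> carrier tate" "\<And>n. const2 (\<pi> ^ n / fact n)
      - (f n + (\<Sum>i<Suc (n + q). e i * fps_const (fps_of_poly (op_prod_coeff (R_coeff \<kappa>) n i)))) = h n * gen"
    by metis
  have ops: "\<exists>U A. (\<forall>i. gbound w (\<delta> i * w ^ i) (fps_nth (U i))) \<and>
      (\<forall>n. gbound 1 (C * r ^ n) (fps_nth (A n))) \<and>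
      (\<forall>n\<le>N. \<forall>j. av (fps_nth (1 - A n - (\<Sum>i\<le>n + q. U i * fps_of_poly (op_coeff V0 \<Delta>1 n i))) j) \<le> \<epsilon>)"
    if \<epsilon>: "0 < \<epsilon>" for N \<epsilon>
  proof -
    \<comment> \<open>The division by \<open>w ^ N\<close> anticipates the factor
      \<open>fact n / \<pi> ^ n\<close>, which is at most \<open>w ^ N\<close> in absolute value for
      \<open>n \<le> N\<close>.\<close>
    have "0 < \<epsilon> / w ^ N" using \<epsilon> w by simp
    then obtain J where J: "\<And>n i. n \<le> N \<Longrightarrow> av (coeff2 (h n) i J) \<le> \<epsilon> / w ^ N"
      using small_column[of N h] h(1) by metis
    define U where "U i = fps_const (fact i * \<pi> ^ (q - 1) / \<pi> ^ i) * dilate (expand (Suc J) (e i))" for i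
    define A where "A n = fps_const (fact n / \<pi> ^ n) * dilate (expand (Suc J) (f n))" for n
    have "gbound w (\<delta> i * w ^ i) (fps_nth (U i))" for i
    proof -
      have "gbound w (av (fact i * \<pi> ^ (q - 1) / \<pi> ^ i) * gauss_norm av (e i)) (fps_nth (U i))"
        unfolding U_def using w
        by (intro gbound_fps_const_mult) (auto simp: w_def intro: gbound_dilate gbound_expand e)
      moreover have "av (fact i * \<pi> ^ (q - 1) / \<pi> ^ i) * gauss_norm av (e i) \<le> \<delta> i * w ^ i"
      proof -
        have "av (\<pi> ^ (q - 1)) * \<delta> i \<le> 1 * \<delta> i"
          using \<delta>0 av_pi_less_1 by (intro mult_right_mono) (auto simp: av_power power_le_one)
        then have "(av (\<pi> ^ (q - 1)) * \<delta> i) * w ^ i \<le> \<delta> i * w ^ i"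
          using w by (intro mult_right_mono) auto
        then show ?thesis by (simp add: \<delta>_def av_mult av_divide av_power w_def power_divide mult_ac)
      qed
      ultimately show ?thesis by (rule gbound_mono)
    qed
    moreover have "gbound 1 (C * r ^ n) (fps_nth (A n))" for n
    proof -
      have "gbound w (av (fact n / \<pi> ^ n) * gauss_norm av (f n)) (fps_nth (A n))"
        unfolding A_def using w
        by (intro gbound_fps_const_mult) (auto simp: w_def intro: gbound_dilate gbound_expand f)
      moreover have "av (fact n / \<pi> ^ n) * gauss_norm av (f n) = av (fact n) * w ^ n * gauss_norm av (f n)"
        by (simp add: av_divide av_power w_def power_divide)
      ultimately have "gbound w (C * r ^ n) (fps_nth (A n))"
        using A_bound[of n] gbound_mono by metis
      then show ?thesis using w by (auto intro: gbound_radius_mono)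
    qed
    moreover have "av (fps_nth (1 - A n - (\<Sum>i\<le>n + q. U i * fps_of_poly (op_coeff V0 \<Delta>1 n i))) j) \<le> \<epsilon>"
      if n: "n \<le> N" for n j
    proof -
      define s where "s = fact n / \<pi> ^ n"
      define E where "E = expand (Suc J)"
      have "fps_const (\<pi> ^ n / fact n) - (E (f n) + (\<Sum>i\<le>n + q. E (e i) * fps_of_poly (op_prod_coeff (R_coeff \<kappa>) n i)))
          = - (fps_nth (h n) J * yinv ^ J)"
        using arg_cong[OF h(2)[of n], of E]
        by (simp only: E_def expand_gen expand_diff expand_add expand_sum expand_mult_const const2_def
            expand_const lessThan_Suc_atMost)
      then have "fps_const s * dilate (fps_const (\<pi> ^ n / fact n) - E (f n)
          - (\<Sum>i\<le>n + q. E (e i) * fps_of_poly (op_prod_coeff (R_coeff \<kappa>) n i)))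
          = fps_const s * dilate (- (fps_nth (h n) J * yinv ^ J))"
        by (simp only: diff_diff_eq)
      moreover have "fps_const s * dilate (fps_const (\<pi> ^ n / fact n) - E (f n)
          - (\<Sum>i\<le>n + q. E (e i) * fps_of_poly (op_prod_coeff (R_coeff \<kappa>) n i)))
        = 1 - A n - (\<Sum>i\<le>n + q. U i * fps_of_poly (op_coeff V0 \<Delta>1 n i))"
      proof -
        have "fps_const s * (dilate (E (e i)) * dilate (fps_of_poly (op_prod_coeff (R_coeff \<kappa>) n i)))
            = U i * fps_of_poly (op_coeff V0 \<Delta>1 n i)" for i
        proof -
          have "fps_const s * dilate (fps_of_poly (op_prod_coeff (R_coeff \<kappa>) n i))
              = fps_of_poly (smult s (pcompose (op_prod_coeff (R_coeff \<kappa>) n i) [:0, \<pi>:]))"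
            by (simp add: dilate_fps_of_poly fps_of_poly_smult)
          also have "\<dots> = fps_const (fact i * \<pi> ^ (q - 1) / \<pi> ^ i) * fps_of_poly (op_coeff V0 \<Delta>1 n i)"
            by (simp only: s_def scaled_op_prod_coeff V0_def fps_of_poly_smult)
          finally show ?thesis by (simp add: U_def E_def mult.assoc mult.left_commute)
        qed
        moreover have "fps_const s * fps_const (\<pi> ^ n / fact n) = 1"
          using pi_nonzero by (simp add: s_def)
        ultimately show ?thesis
          by (simp only: dilate_diff dilate_sum dilate_mult dilate_const right_diff_distrib
              sum_distrib_left A_def E_def s_def)
      qed
      moreover have "av (fps_nth (fps_const s * dilate (- (fps_nth (h n) J * yinv ^ J))) j) \<le> \<epsilon>"
      proof -
        have "gbound 1 (\<epsilon> / w ^ N) (fps_nth (fps_nth (h n) J))" using J[OF n] by (simp add: gbound1_iff)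
        from gbound_fps_mult[OF this gbound_yinv_power]
        have 1: "av (fps_nth (fps_nth (h n) J * yinv ^ J) j) \<le> \<epsilon> / w ^ N" by (simp add: gbound1_iff)
        have "av (\<pi> ^ j) \<le> 1" using av_pi_less_1 by (simp add: av_power power_le_one)
        then have 2: "av (\<pi> ^ j) * av (fps_nth (fps_nth (h n) J * yinv ^ J) j) \<le> 1 * (\<epsilon> / w ^ N)"
          using 1 by (intro mult_mono) auto
        have "av s \<le> w ^ N"
        proof -
          have "av s = av (fact n) * w ^ n" by (simp add: s_def av_divide av_power w_def power_divide)
          also have "\<dots> \<le> 1 * w ^ N"
            using av_of_nat_le_1[of "fact n"] n w by (intro mult_mono power_increasing) auto
          finally show ?thesis by simp
        qed
        then have "av s * (av (\<pi> ^ j) * av (fps_nth (fps_nth (h n) J * yinv ^ J) j)) \<le> w ^ N * (1 * (\<epsilon> / w ^ N))"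
          by (rule mult_mono[OF _ 2]) (use w in auto)
        then show ?thesis using w by (simp add: dilate_def av_mult)
      qed
      ultimately show ?thesis by simp
    qed
    ultimately show ?thesis by blast
  qed
  obtain T where T: "finite T" "card T = p" "1 \<in> T" "\<And>a. a \<in> T \<Longrightarrow> a ^ p = a"
    "\<And>a. a \<in> T \<Longrightarrow> av a \<le> 1"
    "\<And>a b. a \<in> T \<Longrightarrow> b \<in> T \<Longrightarrow> a \<noteq> b \<Longrightarrow> av (b - a) = 1"
    "\<And>a. a \<in> T \<Longrightarrow> \<exists>b\<in>T. av (a + 1 - b) \<le> 1 / real p"
    using teichmueller_set[OF complete] by metis
  \<comment> \<open>As \<open>q\<close> is a power of \<open>p\<close>, the points of
    \<open>T\<close> are zeros of the rescaled \<open>\<Delta>\<close>.\<close>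
  have root: "a ^ q = a" if "a \<in> T" for a
  proof -
    obtain n where "q = p ^ n" using q by blast
    moreover have "a ^ (p ^ n) = a" by (induction n) (simp_all add: power_mult T(4)[OF that])
    ultimately show ?thesis by simp
  qed
  show False
  proof (rule translation_not_overconvergent[OF T(1-3) root T(5-7) p_dvd_q _ d C(1) r(1,2) less_imp_le[OF w] refl])
    fix g D and \<epsilon> :: real
    assume g: "pbound 1 1 g" "Polynomial.degree g \<le> D" and \<epsilon>: "0 < \<epsilon>"
    have \<delta>C: "\<delta> i \<le> C" for i using C\<delta>[of i] C(2) by linarith
    obtain N G B where GB: "pbound w (C * w ^ D) G" "\<forall>n. pbound 1 (C * r ^ n) (B n)"
      "pbound 1 \<epsilon> (recenter (- 1) g - (\<Sum>n\<le>N. smult ((- 1) ^ n) (hderiv n (B n * g)))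
        - (V0 * G - pderiv (\<Delta>1 * G)))"
      using adjoint_approximation[OF \<delta>0 \<delta>C \<delta>lim V0b \<Delta>b degV0 deg\<Delta> w _ r(3) ops g \<epsilon>] C(1) by auto
    \<comment> \<open>The adjoint of \<open>\<Delta> d/dy + \<kappa> \<Delta>'\<close> is minus an
      operator of the same shape with \<open>1 - \<kappa>\<close> in place of
      \<open>\<kappa>\<close>; this is the origin of the exponent in the equation.\<close>
    have "- (V0 * G - pderiv (\<Delta>1 * G)) = \<Delta>1 * pderiv G + smult (1 - of_nat k / of_nat d) (pderiv \<Delta>1 * G)"
    proof -
      have "- (smult \<kappa> (pderiv D) * G - pderiv (D * G)) = D * pderiv G + smult (1 - \<kappa>) (pderiv D * G)" for D
        by (simp add: pderiv_mult smult_diff_left algebra_simps)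
      then show ?thesis unfolding V0_def \<kappa>_def .
    qed
    then have eqY: "Y - (V0 * G - pderiv (\<Delta>1 * G)) = Y + (\<Delta>1 * pderiv G + smult (1 - of_nat k / of_nat d) (pderiv \<Delta>1 * G))" for Y
      by (metis diff_conv_add_uminus)
    then show "\<exists>I G B. pbound w (C * w ^ D) G \<and> (\<forall>n. pbound 1 (C * r ^ n) (B n)) \<and>
      pbound 1 \<epsilon> (recenter (- 1) g - (\<Sum>n\<le>I. smult ((- 1) ^ n) (hderiv n (B n * g)))
        + (\<Delta>1 * pderiv G + smult (1 - of_nat k / of_nat d) (pderiv \<Delta>1 * G)))"
      using GB(1,2) GB(3)[unfolded eqY] by blast
  qed (use q_ge_2 in auto)
qed

end

text \<open>The number \<open>p\<close> is a nonzero element of the valuation ideal, which forces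
  the generator to be nonzero, and it kills the residue field, whose additive group is therefore a
  p-group.\<close>

lemma (in padic_abs) uniformiser_and_residue_field:
  assumes F: "finite_ext_of_padic av F" and \<pi>: "is_uniformiser av F \<pi>"
    and fin: "finite (carrier (residue_field av F))"
  shows "\<pi> \<noteq> 0" "av \<pi> < 1"
    "2 \<le> card (carrier (residue_field av F))"
    "\<exists>f. card (carrier (residue_field av F)) = p ^ f"
proof -
  define KK :: "'k ring" where "KK = ring_of_type_algebra"
  define R where "R = valuation_ring av F"
  define I where "I = valuation_ideal av F"
  have K_simps [simp]: "x \<otimes>\<^bsub>KK\<^esub> y = x * y" "x \<oplus>\<^bsub>KK\<^esub> y = x + y" "\<one>\<^bsub>KK\<^esub> = 1" "\<zero>\<^bsub>KK\<^esub> = 0"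
    "carrier KK = UNIV" for x y
    by (simp_all add: KK_def ring_of_type_algebra_def)
  have R_simps [simp]: "x \<otimes>\<^bsub>R\<^esub> y = x * y" "x \<oplus>\<^bsub>R\<^esub> y = x + y" "\<one>\<^bsub>R\<^esub> = 1" "\<zero>\<^bsub>R\<^esub> = 0" for x y
    by (simp_all add: R_def valuation_ring_def ring_of_type_algebra_def)
  have carrier_R: "carrier R = {x \<in> F. av x \<le> 1}"
    by (simp add: R_def valuation_ring_def)
  have I_eq: "I = {x \<in> F. av x < 1}" by (simp add: I_def valuation_ideal_def)
  interpret KK: ring KK unfolding KK_def by (rule ring_from_type_algebra)
  have minus_K: "\<ominus>\<^bsub>KK\<^esub> x = - x" for x
    by (rule KK.minus_equality) auto
  have sub: "subring F KK"
    using F unfolding finite_ext_of_padic_def KK_def by (auto intro: subfieldE(1))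
  note F_closed = subringE(2,3,5-7)[OF sub, simplified minus_K K_simps]
  have F_of_nat: "of_nat n \<in> F" for n
    by (induction n) (auto intro: F_closed)
  have av_p_lt: "av (of_nat p) < 1" using p_ge_2 by (simp add: av_p)
  have av_add_lt: "av (x + y) < 1" if "av x < 1" "av y < 1" for x y
    using that by (rule av_add_less)
  have av_mult_le: "av (x * y) \<le> 1" if "av x \<le> 1" "av y \<le> 1" for x y
    using that by (simp add: av_mult mult_le_one)
  have av_mult_lt: "av (x * y) < 1" if "av x < 1" "av y \<le> 1" for x y
    using that mult_left_le[of "av y" "av x"] by (simp add: av_mult)
  have ring_R: "cring R"
  proof (rule cringI)
    show "abelian_group R"
    proof (rule abelian_groupI)
      fix x assume "x \<in> carrier R"
      then show "\<exists>y\<in>carrier R. y \<oplus>\<^bsub>R\<^esub> x = \<zero>\<^bsub>R\<^esub>"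
        by (intro bexI[of _ "- x"]) (auto simp: carrier_R intro: F_closed)
    qed (auto simp: carrier_R algebra_simps intro: F_closed av_add_le)
    show "Group.comm_monoid R"
      by (rule comm_monoidI) (auto simp: carrier_R algebra_simps intro: F_closed av_mult_le)
  qed (auto simp: algebra_simps)
  interpret R: cring R by (rule ring_R)
  have minus_R: "\<ominus>\<^bsub>R\<^esub> x = - x" if "x \<in> carrier R" for x
    using that by (intro R.minus_equality) (auto simp: carrier_R intro: F_closed)
  have ideal: "ideal I R"
  proof (rule idealI[OF R.ring_axioms])
    show "subgroup I (add_monoid R)"
    proof (rule subgroup.intro)
      fix x assume x: "x \<in> I"
      then have "x \<in> carrier R" by (auto simp: I_eq carrier_R)
      then show "inv\<^bsub>add_monoid R\<^esub> x \<in> I"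
        using x minus_R by (auto simp: a_inv_def I_eq intro: F_closed)
    qed (auto simp: I_eq carrier_R intro: F_closed av_add_lt)
  next
    fix a x assume ax: "a \<in> I" "x \<in> carrier R"
    then show "a \<otimes>\<^bsub>R\<^esub> x \<in> I"
      by (auto simp: I_eq carrier_R intro: F_closed av_mult_lt)
    then show "x \<otimes>\<^bsub>R\<^esub> a \<in> I" by (simp add: mult.commute)
  qed
  interpret I: ideal I R by (rule ideal)
  have p_in: "of_nat p \<in> I" using av_p_lt F_of_nat by (simp add: I_eq)
  show "av \<pi> < 1" using \<pi> by (auto simp: is_uniformiser_def valuation_ideal_def)
  show "\<pi> \<noteq> 0"
  proof
    assume "\<pi> = 0"
    then have "I = PIdl\<^bsub>R\<^esub> 0" using \<pi> by (simp add: is_uniformiser_def I_def R_def)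
    with p_in have "of_nat p \<in> PIdl\<^bsub>R\<^esub> 0" by (simp only:)
    then obtain x where "of_nat p = x \<otimes>\<^bsub>R\<^esub> 0" unfolding cgenideal_def by blast
    then have "of_nat p = (0 :: 'k)" by simp
    then show False using p_ge_2 by simp
  qed
  define k where "k = R Quot I"
  have k: "residue_field av F = k" by (simp add: residue_field_def k_def R_def I_def)
  interpret k: ring k unfolding k_def by (rule I.quotient_is_ring)
  have hom: "(\<lambda>x. I +>\<^bsub>R\<^esub> x) \<in> ring_hom R k" unfolding k_def by (rule I.rcos_ring_hom)
  have zero_k: "\<zero>\<^bsub>k\<^esub> = I" by (simp add: k_def FactRing_def)
  have ne: "\<one>\<^bsub>k\<^esub> \<noteq> \<zero>\<^bsub>k\<^esub>"
  proof
    assume "\<one>\<^bsub>k\<^esub> = \<zero>\<^bsub>k\<^esub>"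
    then have "I +>\<^bsub>R\<^esub> \<one>\<^bsub>R\<^esub> = I" using ring_hom_one[OF hom] zero_k by simp
    then have "\<one>\<^bsub>R\<^esub> \<in> I" using I.a_rcos_self[OF R.one_closed] by simp
    then show False by (simp add: I_eq)
  qed
  have "card {\<one>\<^bsub>k\<^esub>, \<zero>\<^bsub>k\<^esub>} \<le> card (carrier k)"
    using fin by (intro card_mono) (auto simp: k)
  then show "2 \<le> card (carrier (residue_field av F))" using ne by (simp add: k)
  have mult_p: "[n] \<cdot>\<^bsub>k\<^esub> (I +>\<^bsub>R\<^esub> y) = I +>\<^bsub>R\<^esub> (of_nat n * y) \<and> of_nat n * y \<in> carrier R"
    if y: "y \<in> carrier R" for n :: nat and y
  proof (induction n)
    case 0
    have "I +>\<^bsub>R\<^esub> \<zero>\<^bsub>R\<^esub> = I" using I.a_rcos_const[of "\<zero>\<^bsub>R\<^esub>"] I.zero_closed by simp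
    then show ?case using zero_k R.zero_closed by simp
  next
    case (Suc n)
    then have "[Suc n] \<cdot>\<^bsub>k\<^esub> (I +>\<^bsub>R\<^esub> y) = I +>\<^bsub>R\<^esub> (of_nat n * y \<oplus>\<^bsub>R\<^esub> y)"
      using y ring_hom_add[OF hom] by simp
    moreover have "of_nat n * y \<oplus>\<^bsub>R\<^esub> y \<in> carrier R" using Suc y by (intro R.a_closed) auto
    ultimately show ?case by (simp add: algebra_simps)
  qed
  have "\<exists>f. Coset.order (add_monoid k) = p ^ f"
  proof (rule group.order_prime_power[OF k.a_group _ prime_p])
    show "finite (carrier (add_monoid k))" using fin by (simp add: k)
    fix x assume "x \<in> carrier (add_monoid k)"
    then obtain y where y: "y \<in> carrier R" "x = I +>\<^bsub>R\<^esub> y"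
      by (auto simp: k_def FactRing_def A_RCOSETS_def')
    have "of_nat p * y \<in> I" using p_in y(1) I.I_r_closed[of "of_nat p" y] by simp
    then have "[p] \<cdot>\<^bsub>k\<^esub> x = \<zero>\<^bsub>k\<^esub>"
      using mult_p[OF y(1), of p] I.a_rcos_const by (simp add: y(2) zero_k)
    then show "x [^]\<^bsub>add_monoid k\<^esub> p = \<one>\<^bsub>add_monoid k\<^esub>"
      by (simp add: add_pow_def)
  qed
  then show "\<exists>f. card (carrier (residue_field av F)) = p ^ f"
    by (simp add: Coset.order_def k)
qed

theorem theorem6p3p21:
  fixes av :: "'k::field_char_0 \<Rightarrow> real"
    and F :: "'k set"
    and \<pi> :: 'k
    and p q d k :: nat
  assumes "Factorial_Ring.prime p"
    and "complete_discretely_valued av"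
    and "av (of_nat p) = 1 / real p"
    and "finite_ext_of_padic av F"
    and "is_uniformiser av F \<pi>"
    and "finite (carrier (residue_field av F))"
    and "card (carrier (residue_field av F)) = q"
    and "d \<ge> 1" and "d dvd q + 1"
    and "1 \<le> k" and "k \<le> d"
  shows "beta_op av q \<pi> \<notin>
    {D_add av q P (D_mult av q Q (R_op av q \<pi> d k)) | P Q.
       P \<in> D_dagger av q (varpi p / av \<pi>) \<and> Q \<in> D_dagger av q (varpi p)}"
proof -
  have nonarch: "nonarch_abs av" and complete: "Metric_space.mcomplete UNIV (\<lambda>x y. av (x - y))"
    using assms(2) by (auto simp: complete_discretely_valued_def)
  interpret padic_abs av p
    by unfold_locales (use nonarch assms(1,3) in auto)
  note res = uniformiser_and_residue_field[OF assms(4-6), unfolded assms(7)]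
  obtain f where f: "q = p ^ f" using res(4) by blast
  have "f \<noteq> 0" using res(3) f by (intro notI) simp
  then have "p dvd q" using f by simp
  interpret affinoid_padic av q p \<pi>
    by unfold_locales (use res \<open>p dvd q\<close> in auto)
  \<comment> \<open>Modulo \<open>p\<close> the number \<open>q + 1\<close> is 1, so its divisor
    \<open>d\<close> is prime to \<open>p\<close>.\<close>
  have "\<not> p dvd d"
  proof
    assume "p dvd d"
    then have "p dvd q + 1" using assms(9) dvd_trans by blast
    then have "p dvd 1" using \<open>p dvd q\<close> dvd_add_right_iff by blast
    then show False using p_ge_2 by simp
  qed
  then show ?thesis
    using beta_not_in_sum[OF complete res(4) _ assms(10,11)] by blast
qed

end
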